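(* Let $\Omega\subset\mathbb{C}$ be an exceptional domain (in the weak sense) whose complement $\mathbb{C}\setminus\Omega$ is bounded and connected, and assume $\Omega$ is a Smirnov domain. Then $\Omega$ is the exterior of a disk.
   Context: A domain $\Omega\subset\mathbb{C}$ is exceptional in the weak sense if there is a positive harmonic function $u$ on $\Omega$ (a roof function) whose boundary values are $0$ and whose normal derivative is a nonzero constant almost everywhere with respect to arclength on $\partial\Omega$ (boundary values understood as nontangential limits). Here $\partial\Omega$ is a rectifiable Jordan curve and, with $\varphi$ a conformal map from $\{|\zeta|>1\}\cup\{\infty\}$ onto $\Omega\cup\{\infty\}$, $\Omega$ is called Smirnov if $\varphi'$ is an outer function (no singular inner factor in its canonical factorization). *)

theory Defs
  imports "HOL-Analysis.Analysis"
begin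

definition cgrad :: "(complex \<Rightarrow> real) \<Rightarrow> complex \<Rightarrow> complex" where
  "cgrad u z = Complex (frechet_derivative u (at z) 1) (frechet_derivative u (at z) \<i>)"

definition harmonic_on :: "complex set \<Rightarrow> (complex \<Rightarrow> real) \<Rightarrow> bool" where
  "harmonic_on S u \<longleftrightarrow> open S \<and>
     (\<forall>z\<in>S. u differentiable (at z)) \<and>
     (\<forall>z\<in>S. cgrad u differentiable (at z)) \<and>
     continuous_on S (\<lambda>z. frechet_derivative (cgrad u) (at z) 1) \<and>
     continuous_on S (\<lambda>z. frechet_derivative (cgrad u) (at z) \<i>) \<and>
     (\<forall>z\<in>S. Re (frechet_derivative (cgrad u) (at z) 1)
              + Im (frechet_derivative (cgrad u) (at z) \<i>) = 0)"

definition nt_tendsto :: "complex set \<Rightarrow> (complex \<Rightarrow> 'a::topological_space) \<Rightarrow> complex \<Rightarrow> 'a \<Rightarrow> bool" where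
  "nt_tendsto \<Omega> f \<zeta> l \<longleftrightarrow>
     (\<forall>\<alpha>>0. (f \<longlongrightarrow> l)
        (at \<zeta> within {z\<in>\<Omega>. cmod (z - \<zeta>) < (1 + \<alpha>) * infdist z (frontier \<Omega>)}))"

definition arclength_jordan :: "(real \<Rightarrow> complex) \<Rightarrow> real \<Rightarrow> bool" where
  "arclength_jordan \<gamma> L \<longleftrightarrow> 0 < L \<and> \<gamma> 0 = \<gamma> L \<and> inj_on \<gamma> {0..<L} \<and>
     (\<forall>s\<in>{0..L}. \<forall>t\<in>{0..L}. cmod (\<gamma> s - \<gamma> t) \<le> \<bar>s - t\<bar>) \<and>
     (AE t in lborel. t \<in> {0..L} \<longrightarrow>
        (\<exists>v. (\<gamma> has_vector_derivative v) (at t) \<and> cmod v = 1))"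

text \<open>Exceptional in the weak sense (boundary parametrized by arclength via gamma):
  a positive harmonic roof function u with nontangential boundary values 0 and
  nontangential normal derivative (gradient dotted with the unit normal
  i * gamma'(t)) equal to a nonzero constant, a.e. with respect to arclength.\<close>
definition exceptional_weak :: "complex set \<Rightarrow> (real \<Rightarrow> complex) \<Rightarrow> real \<Rightarrow> bool" where
  "exceptional_weak \<Omega> \<gamma> L \<longleftrightarrow>
     (\<exists>u. harmonic_on \<Omega> u \<and> (\<forall>z\<in>\<Omega>. 0 < u z) \<and>
       (\<exists>c::real. c \<noteq> 0 \<and>
          (AE t in lborel. t \<in> {0..L} \<longrightarrow>
             nt_tendsto \<Omega> u (\<gamma> t) 0 \<and>
             nt_tendsto \<Omega> (\<lambda>z. Re (cgrad u z * cnj (\<i> * vector_derivative \<gamma> (at t))))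
                (\<gamma> t) c)))"

text \<open>Outer function on the unit disk (Garnett): c * exp of the Herglotz integral
  of an integrable real function k = log psi, with |c| = 1.\<close>
definition outer_function :: "(complex \<Rightarrow> complex) \<Rightarrow> bool" where
  "outer_function F \<longleftrightarrow>
     (\<exists>c k. cmod c = 1 \<and> set_integrable lborel {0..2*pi} (k :: real \<Rightarrow> real) \<and>
        (\<forall>w\<in>ball 0 1. F w = c * exp ((LINT t:{0..2*pi}|lborel.
              ((cis t + w) / (cis t - w)) * complex_of_real (k t)) / complex_of_real (2*pi))))"

text \<open>Conformal map of {|zeta| > 1} \<union> {\<infinity>} onto \<Omega> \<union> {\<infinity>}.\<close>
definition exterior_conformal_map :: "(complex \<Rightarrow> complex) \<Rightarrow> complex set \<Rightarrow> bool" where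
  "exterior_conformal_map \<phi> \<Omega> \<longleftrightarrow>
     \<phi> holomorphic_on {z. 1 < cmod z} \<and> inj_on \<phi> {z. 1 < cmod z} \<and>
     \<phi> ` {z. 1 < cmod z} = \<Omega> \<and> filterlim \<phi> at_infinity at_infinity"

definition smirnov_domain :: "complex set \<Rightarrow> bool" where
  "smirnov_domain \<Omega> \<longleftrightarrow>
     (\<exists>\<phi>. exterior_conformal_map \<phi> \<Omega> \<and>
        (\<exists>F. outer_function F \<and>
           (\<forall>w. 0 < cmod w \<and> cmod w < 1 \<longrightarrow> F w = deriv \<phi> (1 / w))))"

end

theory Submission
  imports Defs "HOL-Complex_Analysis.Complex_Analysis"
begin

text \<open>Let \<open>\<psi> w = \<phi> (1 / w)\<close> on the punctured disk and \<open>v = u \<circ> \<psi>\<close>. As \<open>F\<close> is a quotient of bounded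
  holomorphic functions, \<open>\<psi>'\<close> has finite nonzero nontangential limits almost everywhere on the circle,
  of modulus \<open>exp k\<close>. Hence \<open>\<psi>\<close> is bi-Lipschitz on countably many pieces covering almost all of the
  circle, so null sets of \<open>\<gamma>\<close> pull back to null sets, and at almost every point \<open>\<psi>\<close> is conformal up to
  the boundary with the normal of \<open>\<gamma>\<close> as image of the radial direction; this makes
  \<open>v / (1 - |w|)\<close> tend to \<open>|c| exp k\<close> along a curve ending there. The sign condition \<open>u > 0\<close> forbids
  approaching the same boundary point from both sides, so the boundary map is almost everywhere
  injective and \<open>exp k\<close> is integrable because \<open>\<gamma>\<close> has finite length. By Bocher's theorem
  \<open>v = A log (1 / |w|) + h\<close> with \<open>h\<close> nonnegative harmonic in the whole disk; a nonzero \<open>h\<close> would have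
  nonintegrable normal derivative, so \<open>h = 0\<close> and \<open>exp k = A / |c|\<close> almost everywhere. As \<open>F\<close> is outer,
  it is constant and \<open>\<phi>\<close> is affine.\<close>

section \<open>Harmonic functions\<close>

text \<open>Being outer makes only \<open>k\<close>, the logarithm of the boundary modulus,
  integrable. Neither integrability of \<open>exp k\<close> nor a continuous extension of
  \<open>\<phi>\<close> to the circle is available at the start. So the boundary map is an almost
  everywhere defined radial limit \<open>P\<close>, and arclength is compared with angle piece by
  piece, through bi-Lipschitz estimates. The weak roof condition is just as thin: it controls the
  gradient of \<open>u\<close> in the single direction \<open>\<i> * \<tau>\<close>, so the normal
  of \<open>\<gamma>\<close> must be matched with the image of the radius before the condition says
  anything about \<open>v\<close>. Boundary values 0 almost everywhere do not force a nonnegative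
  harmonic function to vanish: a Poisson kernel with its pole on the circle is a counterexample. Its
  normal derivative grows like the inverse square of the distance to the pole, and this failure of
  integrability is what the uniqueness argument exploits. That is why the finite length has to be
  used before uniqueness.\<close>

text \<open>The mean value theorem is run first along \<open>a\<close>, then along \<open>b\<close>,
  so only the derivative in that order has to exist. Exchanging \<open>a\<close> and
  \<open>b\<close> leaves the left-hand side unchanged, which is how the two mixed derivatives get
  compared.\<close>

lemma second_difference_mvt:
  fixes u :: "complex \<Rightarrow> real" and a b :: complex
  assumes h: "0 < h"
    and S: "\<And>x y. 0 \<le> x \<Longrightarrow> x \<le> h \<Longrightarrow> 0 \<le> y \<Longrightarrow> y \<le> h \<Longrightarrow> z + x *\<^sub>R a + y *\<^sub>R b \<in> S"
    and du: "\<And>w. w \<in> S \<Longrightarrow> (u has_derivative u' w) (at w)"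
    and dA: "\<And>w. w \<in> S \<Longrightarrow> ((\<lambda>w. u' w a) has_derivative A' w) (at w)"
  shows "\<exists>x y. 0 < x \<and> x < h \<and> 0 < y \<and> y < h \<and>
    u (z + h *\<^sub>R a + h *\<^sub>R b) - u (z + h *\<^sub>R a) - u (z + h *\<^sub>R b) + u z
      = h\<^sup>2 * A' (z + x *\<^sub>R a + y *\<^sub>R b) b"
proof -
  have lin1: "linear (u' w)" if "w \<in> S" for w
    using du[OF that] has_derivative_linear by blast
  have lin2: "linear (A' w)" if "w \<in> S" for w
    using dA[OF that] has_derivative_linear by blast
  define \<Phi> where "\<Phi> x = u (z + x *\<^sub>R a + h *\<^sub>R b) - u (z + x *\<^sub>R a)" for x
  have d1: "(\<Phi> has_real_derivative (u' (z + x *\<^sub>R a + h *\<^sub>R b) a - u' (z + x *\<^sub>R a) a)) (at x)"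
    if "0 \<le> x" "x \<le> h" for x
  proof -
    have m1: "z + x *\<^sub>R a + h *\<^sub>R b \<in> S" using S[of x h] that h by auto
    have m2: "z + x *\<^sub>R a \<in> S" using S[of x 0] that h by auto
    have "((\<lambda>x. z + x *\<^sub>R a + h *\<^sub>R b) has_derivative (\<lambda>d. d *\<^sub>R a)) (at x)"
      by (auto intro!: derivative_eq_intros)
    from has_derivative_compose[OF this du[OF m1]]
    have e1: "((\<lambda>x. u (z + x *\<^sub>R a + h *\<^sub>R b)) has_derivative (\<lambda>d. u' (z + x *\<^sub>R a + h *\<^sub>R b) (d *\<^sub>R a))) (at x)" .
    have "((\<lambda>x. z + x *\<^sub>R a) has_derivative (\<lambda>d. d *\<^sub>R a)) (at x)"
      by (auto intro!: derivative_eq_intros)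
    from has_derivative_compose[OF this du[OF m2]]
    have e2: "((\<lambda>x. u (z + x *\<^sub>R a)) has_derivative (\<lambda>d. u' (z + x *\<^sub>R a) (d *\<^sub>R a))) (at x)" .
    from has_derivative_diff[OF e1 e2]
    show ?thesis unfolding \<Phi>_def has_field_derivative_def
      by (rule has_derivative_eq_rhs)
         (auto simp: fun_eq_iff linear_scale[OF lin1[OF m1]] linear_scale[OF lin1[OF m2]] left_diff_distrib right_diff_distrib mult.commute)
  qed
  obtain x where x: "0 < x" "x < h"
    and ex: "\<Phi> h - \<Phi> 0 = (h - 0) * (u' (z + x *\<^sub>R a + h *\<^sub>R b) a - u' (z + x *\<^sub>R a) a)"
    using MVT2[OF h, of \<Phi>, OF d1] by auto
  define \<Psi> where "\<Psi> y = u' (z + x *\<^sub>R a + y *\<^sub>R b) a" for y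
  have d2: "(\<Psi> has_real_derivative (A' (z + x *\<^sub>R a + y *\<^sub>R b) b)) (at y)"
    if "0 \<le> y" "y \<le> h" for y
  proof -
    have m1: "z + x *\<^sub>R a + y *\<^sub>R b \<in> S" using S[of x y] that x by auto
    have "((\<lambda>y. z + x *\<^sub>R a + y *\<^sub>R b) has_derivative (\<lambda>d. d *\<^sub>R b)) (at y)"
      by (auto intro!: derivative_eq_intros)
    from has_derivative_compose[OF this dA[OF m1]]
    show ?thesis unfolding \<Psi>_def has_field_derivative_def
      by (rule has_derivative_eq_rhs) (auto simp: fun_eq_iff linear_scale[OF lin2[OF m1]] mult.commute)
  qed
  obtain y where y: "0 < y" "y < h"
    and ey: "\<Psi> h - \<Psi> 0 = (h - 0) * A' (z + x *\<^sub>R a + y *\<^sub>R b) b"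
    using MVT2[OF h, of \<Psi>, OF d2] by auto
  have "u (z + h *\<^sub>R a + h *\<^sub>R b) - u (z + h *\<^sub>R a) - u (z + h *\<^sub>R b) + u z = \<Phi> h - \<Phi> 0"
    by (simp add: \<Phi>_def)
  also have "\<dots> = h * (\<Psi> h - \<Psi> 0)" using ex by (simp add: \<Psi>_def)
  also have "\<dots> = h\<^sup>2 * A' (z + x *\<^sub>R a + y *\<^sub>R b) b" using ey by (simp add: power2_eq_square)
  finally show ?thesis using x y by blast
qed

text \<open>Laplace's equation is one Cauchy-Riemann equation for the conjugate gradient. The other
  one is the symmetry of the mixed second derivatives, which \<open>harmonic_on\<close> does not
  state and which has to be derived from their continuity.\<close>

lemma harmonic_on_holomorphic_gradient:
  assumes "harmonic_on S u"
  shows "(\<lambda>z. cnj (cgrad u z)) holomorphic_on S"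
    and "\<And>z. z \<in> S \<Longrightarrow> (u has_derivative (\<lambda>d. Re (cnj (cgrad u z) * d))) (at z)"
proof -
  define u' where "u' z = frechet_derivative u (at z)" for z
  define G' where "G' z = frechet_derivative (cgrad u) (at z)" for z
  have op: "open S" using assms by (simp add: harmonic_on_def)
  have du: "(u has_derivative u' z) (at z)" if "z \<in> S" for z
    using assms that unfolding harmonic_on_def u'_def by (simp add: frechet_derivative_works)
  have dG: "(cgrad u has_derivative G' z) (at z)" if "z \<in> S" for z
    using assms that unfolding harmonic_on_def G'_def by (simp add: frechet_derivative_works)
  have c1: "continuous_on S (\<lambda>z. G' z 1)" and c2: "continuous_on S (\<lambda>z. G' z \<i>)"
    and lap: "\<And>z. z \<in> S \<Longrightarrow> Re (G' z 1) + Im (G' z \<i>) = 0"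
    using assms unfolding harmonic_on_def G'_def by auto
  have cg: "cgrad u z = Complex (u' z 1) (u' z \<i>)" for z by (simp add: cgrad_def u'_def)
  have P: "((\<lambda>w. u' w 1) has_derivative (\<lambda>d. Re (G' z d))) (at z)" if "z \<in> S" for z
    using has_derivative_Re[OF dG[OF that]] by (simp add: cg)
  have Q: "((\<lambda>w. u' w \<i>) has_derivative (\<lambda>d. Im (G' z d))) (at z)" if "z \<in> S" for z
    using has_derivative_Im[OF dG[OF that]] by (simp add: cg)
  show D: "(u has_derivative (\<lambda>d. Re (cnj (cgrad u z) * d))) (at z)" if z: "z \<in> S" for z
  proof (rule has_derivative_eq_rhs[OF du[OF z]])
    have l: "linear (u' z)" using du[OF z] has_derivative_linear by blast
    have "u' z d = Re (cnj (cgrad u z) * d)" for d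
    proof -
      have "d = Re d *\<^sub>R 1 + Im d *\<^sub>R \<i>" by (simp add: complex_eq_iff)
      hence "u' z d = Re d * u' z 1 + Im d * u' z \<i>"
        using linear_add[OF l, of "Re d *\<^sub>R 1" "Im d *\<^sub>R \<i>"] linear_scale[OF l, of "Re d" 1] linear_scale[OF l, of "Im d" "\<i>"]
        by simp
      thus ?thesis by (simp add: cg)
    qed
    thus "u' z = (\<lambda>d. Re (cnj (cgrad u z) * d))" by auto
  qed
  \<comment> \<open>Schwarz's theorem: a gap of \<open>2 * e\<close> between the mixed derivatives
    at \<open>z\<close> would persist on a small square, yet both represent the same second
    difference at points of that square.\<close>
  have sym: "Re (G' z \<i>) = Im (G' z 1)" if z: "z \<in> S" for z
  proof (rule ccontr)
    assume ne: "Re (G' z \<i>) \<noteq> Im (G' z 1)"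
    define e where "e = \<bar>Re (G' z \<i>) - Im (G' z 1)\<bar> / 2"
    have e: "e > 0" using ne by (simp add: e_def)
    have "continuous (at z) (\<lambda>z. G' z 1)" "continuous (at z) (\<lambda>z. G' z \<i>)"
      using c1 c2 op z by (auto simp: continuous_on_eq_continuous_at)
    then obtain d1 d2 where d1: "d1 > 0" "\<And>w. dist w z < d1 \<Longrightarrow> dist (G' w 1) (G' z 1) < e"
      and d2: "d2 > 0" "\<And>w. dist w z < d2 \<Longrightarrow> dist (G' w \<i>) (G' z \<i>) < e"
      using e unfolding continuous_at_eps_delta by metis
    obtain r where r: "r > 0" "ball z r \<subseteq> S" using op z open_contains_ball by blast
    define h where "h = min r (min d1 d2) / 4"
    have h: "h > 0" "h < r/2" "h < d1/2" "h < d2/2" using r d1 d2 by (auto simp: h_def)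
    have near: "dist (z + x *\<^sub>R 1 + y *\<^sub>R \<i>) z \<le> 2 * h" if "0 \<le> x" "x \<le> h" "0 \<le> y" "y \<le> h" for x y
    proof -
      have "dist (z + x *\<^sub>R 1 + y *\<^sub>R \<i>) z = norm (x *\<^sub>R 1 + y *\<^sub>R \<i>)" by (simp add: dist_norm)
      also have "\<dots> \<le> \<bar>x\<bar> + \<bar>y\<bar>"
        by (rule order_trans[OF norm_triangle_ineq]) (simp add: norm_mult)
      finally show ?thesis using that by linarith
    qed
    have inS: "z + x *\<^sub>R 1 + y *\<^sub>R \<i> \<in> S" if "0 \<le> x" "x \<le> h" "0 \<le> y" "y \<le> h" for x y
      using near[OF that] h r by (auto simp: dist_commute subset_iff)
    have inS': "z + x *\<^sub>R \<i> + y *\<^sub>R 1 \<in> S" if "0 \<le> x" "x \<le> h" "0 \<le> y" "y \<le> h" for x y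
      using inS[of y x] that by (simp add: algebra_simps)
    obtain x y where xy: "0 < x" "x < h" "0 < y" "y < h"
      and e1: "u (z + h *\<^sub>R 1 + h *\<^sub>R \<i>) - u (z + h *\<^sub>R 1) - u (z + h *\<^sub>R \<i>) + u z
        = h\<^sup>2 * Re (G' (z + x *\<^sub>R 1 + y *\<^sub>R \<i>) \<i>)"
      using second_difference_mvt[of h z 1 \<i> S u u' "\<lambda>z d. Re (G' z d)", OF h(1) inS du P] by blast
    obtain x' y' where xy': "0 < x'" "x' < h" "0 < y'" "y' < h"
      and e2: "u (z + h *\<^sub>R \<i> + h *\<^sub>R 1) - u (z + h *\<^sub>R \<i>) - u (z + h *\<^sub>R 1) + u z
        = h\<^sup>2 * Im (G' (z + x' *\<^sub>R \<i> + y' *\<^sub>R 1) 1)"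
      using second_difference_mvt[of h z \<i> 1 S u u' "\<lambda>z d. Im (G' z d)", OF h(1) inS' du Q] by blast
    have "h\<^sup>2 * Re (G' (z + x *\<^sub>R 1 + y *\<^sub>R \<i>) \<i>) = h\<^sup>2 * Im (G' (z + x' *\<^sub>R \<i> + y' *\<^sub>R 1) 1)"
    proof -
      have "z + h *\<^sub>R \<i> + h *\<^sub>R 1 = z + h *\<^sub>R 1 + h *\<^sub>R \<i>" by simp
      with e2 have "u (z + h *\<^sub>R 1 + h *\<^sub>R \<i>) - u (z + h *\<^sub>R \<i>) - u (z + h *\<^sub>R 1) + u z
        = h\<^sup>2 * Im (G' (z + x' *\<^sub>R \<i> + y' *\<^sub>R 1) 1)" by (simp only:)
      with e1 show ?thesis by linarith
    qed
    hence eq: "Re (G' (z + x *\<^sub>R 1 + y *\<^sub>R \<i>) \<i>) = Im (G' (z + y' *\<^sub>R 1 + x' *\<^sub>R \<i>) 1)"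
      using h by (simp add: add.commute add.left_commute)
    have a: "dist (G' (z + x *\<^sub>R 1 + y *\<^sub>R \<i>) \<i>) (G' z \<i>) < e"
      by (rule d2) (use near[of x y] xy h in linarith)
    have b: "dist (G' (z + y' *\<^sub>R 1 + x' *\<^sub>R \<i>) 1) (G' z 1) < e"
      by (rule d1) (use near[of y' x'] xy' h in linarith)
    have "\<bar>Re (G' (z + x *\<^sub>R 1 + y *\<^sub>R \<i>) \<i>) - Re (G' z \<i>)\<bar> < e"
      using a abs_Re_le_cmod[of "G' (z + x *\<^sub>R 1 + y *\<^sub>R \<i>) \<i> - G' z \<i>"] by (simp add: dist_norm)
    moreover have "\<bar>Im (G' (z + y' *\<^sub>R 1 + x' *\<^sub>R \<i>) 1) - Im (G' z 1)\<bar> < e"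
      using b abs_Im_le_cmod[of "G' (z + y' *\<^sub>R 1 + x' *\<^sub>R \<i>) 1 - G' z 1"] by (simp add: dist_norm)
    moreover have "2 * e = \<bar>Re (G' z \<i>) - Im (G' z 1)\<bar>" by (simp add: e_def)
    ultimately show False using eq by (simp only: abs_if split: if_splits)
  qed
  show "(\<lambda>z. cnj (cgrad u z)) holomorphic_on S"
    unfolding holomorphic_on_open[OF op]
  proof (intro ballI exI)
    fix z assume z: "z \<in> S"
    have l: "linear (G' z)" using dG[OF z] has_derivative_linear by blast
    have d: "((\<lambda>z. cnj (cgrad u z)) has_derivative (\<lambda>d. cnj (G' z d))) (at z)"
      by (rule has_derivative_cnj[OF dG[OF z]])
    have "cnj (G' z d) = cnj (G' z 1) * d" for d
    proof -
      have "d = Re d *\<^sub>R 1 + Im d *\<^sub>R \<i>" by (simp add: complex_eq_iff)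
      hence "G' z d = Re d *\<^sub>R G' z 1 + Im d *\<^sub>R G' z \<i>"
        using linear_add[OF l, of "Re d *\<^sub>R 1" "Im d *\<^sub>R \<i>"] linear_scale[OF l, of "Re d" 1] linear_scale[OF l, of "Im d" "\<i>"]
        by simp
      \<comment> \<open>Both Cauchy-Riemann equations at once; they make the conjugate of
        \<open>G' z\<close> complex linear.\<close>
      moreover have "G' z \<i> = - \<i> * G' z 1"
        by (rule complex_eqI) (use sym[OF z] lap[OF z] in simp_all)
      ultimately have "G' z d = G' z 1 * (of_real (Re d) - \<i> * of_real (Im d))"
        by (simp add: scaleR_conv_of_real algebra_simps)
      also have "of_real (Re d) - \<i> * of_real (Im d) = cnj d" by (simp add: complex_eq_iff)
      finally show ?thesis by simp
    qed
    hence "(\<lambda>d. cnj (G' z d)) = (*) (cnj (G' z 1))" by (rule ext)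
    with d show "((\<lambda>z. cnj (cgrad u z)) has_field_derivative cnj (G' z 1)) (at z)"
      by (simp add: has_field_derivative_def)
  qed
qed

section \<open>Bocher's theorem in the punctured disk\<close>

text \<open>On the universal cover \<open>exp\<close> of the punctured disk, \<open>v\<close> is the
  real part of a holomorphic \<open>\<Phi>\<close> with an imaginary period. A suitable multiple
  makes \<open>exp (- s * \<Phi>)\<close> single valued on the disk; positivity of \<open>v\<close>
  bounds it by 1, so its singularity is removable, and the order \<open>n\<close> of its zero at 0
  is the source of the logarithm, with \<open>A = n / s\<close>.\<close>

lemma positive_harmonic_punctured_disk:
  fixes v :: "complex \<Rightarrow> real"
  assumes g: "g holomorphic_on ball 0 1 - {0}"
    and dv: "\<And>w. w \<in> ball 0 1 - {0} \<Longrightarrow> (v has_derivative (\<lambda>d. Re (g w * d))) (at w)"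
    and pos: "\<And>w. w \<in> ball 0 1 - {0} \<Longrightarrow> 0 < v w"
  shows "\<exists>A H. 0 \<le> A \<and> H holomorphic_on ball 0 1 \<and> (\<forall>w\<in>ball 0 1. 0 \<le> Re (H w)) \<and>
    (\<forall>w\<in>ball 0 1 - {0}. v w = A * ln (1 / norm w) + Re (H w))"
proof -
  let ?D = "ball 0 1 - {0::complex}"
  define U where "U = {\<xi>::complex. Re \<xi> < 0}"
  have convU: "convex U" unfolding U_def by (rule convex_halfspace_Re_lt)
  have openU: "open U" unfolding U_def by (rule open_halfspace_Re_lt)
  have expU: "exp \<xi> \<in> ?D" if "\<xi> \<in> U" for \<xi>
    using that by (auto simp: U_def)
  have LnU: "Ln w \<in> U" if "w \<in> ?D" for w
    using that by (auto simp: U_def)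
  define K where "K \<xi> = g (exp \<xi>) * exp \<xi>" for \<xi>
  have "K holomorphic_on U" unfolding K_def
    by (intro holomorphic_intros holomorphic_on_compose_gen[OF _ g, unfolded o_def] ) (use expU in auto)
  then obtain \<Phi>0 where \<Phi>0: "\<And>x. x \<in> U \<Longrightarrow> (\<Phi>0 has_field_derivative K x) (at x)"
    using holomorphic_convex_primitive'[OF convU openU, of K] openU
    by (metis at_within_open)
  have dV: "((\<lambda>\<xi>. v (exp \<xi>)) has_derivative (\<lambda>d. Re (K \<xi> * d))) (at \<xi>)" if "\<xi> \<in> U" for \<xi>
  proof -
    have "(exp has_derivative (\<lambda>d. exp \<xi> * d)) (at \<xi>)"
      using DERIV_exp[of \<xi>] unfolding has_field_derivative_def by simp
    from has_derivative_compose[OF this dv[OF expU[OF that]]]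
    show ?thesis by (simp add: K_def mult.assoc)
  qed
  have "\<exists>c. \<forall>\<xi>\<in>U. v (exp \<xi>) - Re (\<Phi>0 \<xi>) = c"
  proof (rule has_derivative_zero_constant[OF convU])
    fix \<xi> assume x: "\<xi> \<in> U"
    have "(\<Phi>0 has_derivative (*) (K \<xi>)) (at \<xi>)" using \<Phi>0[OF x] by (simp add: has_field_derivative_def)
    from has_derivative_diff[OF dV[OF x] has_derivative_Re[OF this]]
    have "((\<lambda>\<xi>. v (exp \<xi>) - Re (\<Phi>0 \<xi>)) has_derivative (\<lambda>h. 0)) (at \<xi>)" by simp
    thus "((\<lambda>\<xi>. v (exp \<xi>) - Re (\<Phi>0 \<xi>)) has_derivative (\<lambda>h. 0)) (at \<xi> within U)"
      by (rule has_derivative_at_withinI)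
  qed
  then obtain c where c: "\<And>\<xi>. \<xi> \<in> U \<Longrightarrow> v (exp \<xi>) - Re (\<Phi>0 \<xi>) = c" by blast
  define \<Phi> where "\<Phi> \<xi> = \<Phi>0 \<xi> + of_real c" for \<xi>
  have d\<Phi>: "(\<Phi> has_field_derivative K x) (at x)" if "x \<in> U" for x
    unfolding \<Phi>_def using \<Phi>0[OF that] by (auto intro!: derivative_eq_intros)
  have Re\<Phi>: "Re (\<Phi> \<xi>) = v (exp \<xi>)" if "\<xi> \<in> U" for \<xi>
    using c[OF that] by (simp add: \<Phi>_def)
  let ?T = "2 * of_real pi * \<i>"
  have UT: "\<xi> + ?T \<in> U" if "\<xi> \<in> U" for \<xi> using that by (simp add: U_def)
  have KT: "K (\<xi> + ?T) = K \<xi>" for \<xi>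
  proof -
    have "exp (\<xi> + ?T) = exp \<xi>" by (simp add: exp_add)
    thus ?thesis by (simp add: K_def)
  qed
  have "\<exists>c. \<forall>\<xi>\<in>U. \<Phi> (\<xi> + ?T) - \<Phi> \<xi> = c"
  proof (rule has_field_derivative_zero_constant[OF convU])
    fix \<xi> assume x: "\<xi> \<in> U"
    have "((\<lambda>\<xi>. \<Phi> (\<xi> + ?T)) has_field_derivative K (\<xi> + ?T)) (at \<xi>)"
      using d\<Phi>[OF UT[OF x]] by (subst (asm) DERIV_shift)
    from DERIV_diff[OF this d\<Phi>[OF x]]
    show "((\<lambda>\<xi>. \<Phi> (\<xi> + ?T) - \<Phi> \<xi>) has_field_derivative 0) (at \<xi> within U)"
      by (simp only: KT diff_self) (rule has_field_derivative_at_within)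
  qed
  then obtain \<beta> where \<beta>: "\<And>\<xi>. \<xi> \<in> U \<Longrightarrow> \<Phi> (\<xi> + ?T) = \<Phi> \<xi> + \<beta>" by (metis add.commute diff_add_cancel)
  have m1U: "-1 \<in> U" by (simp add: U_def)
  \<comment> \<open>The period is imaginary because the real part \<open>v (exp \<xi>)\<close> does
    descend to the disk.\<close>
  have "Re \<beta> = Re (\<Phi> (-1 + ?T)) - Re (\<Phi> (-1))" using \<beta>[OF m1U] by simp
  also have "\<dots> = 0"
  proof -
    have "exp (- 1 + ?T) = exp (-1) * exp ?T" by (rule exp_add)
    hence "exp (- 1 + ?T) = exp (-1)" by simp
    thus ?thesis using Re\<Phi>[OF UT[OF m1U]] Re\<Phi>[OF m1U] by simp
  qed
  finally have Re\<beta>: "Re \<beta> = 0" .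
  \<comment> \<open>With this \<open>s\<close> the product \<open>s * \<beta>\<close> is 0 or
    \<open>2 * pi * \<i>\<close> up to sign, so the exponential kills the period. If
    \<open>\<beta>\<close> vanishes, any positive value would do.\<close>
  define s where "s = (if Im \<beta> = 0 then 1 else 2 * pi / \<bar>Im \<beta>\<bar>)"
  have s: "s > 0" by (simp add: s_def)
  have es: "exp (- (of_real s * \<beta>)) = 1"
  proof -
    have "\<beta> = \<i> * of_real (Im \<beta>)" using Re\<beta> by (simp add: complex_eq_iff)
    moreover have "s * Im \<beta> = 0 \<or> s * Im \<beta> = 2*pi \<or> s * Im \<beta> = - (2*pi)"
      unfolding s_def by (auto simp: abs_if)
    moreover have "of_real s * \<beta> = \<i> * of_real (s * Im \<beta>)"
      using Re\<beta> by (simp add: complex_eq_iff)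
    ultimately have "of_real s * \<beta> = 0 \<or> of_real s * \<beta> = \<i> * of_real (2*pi) \<or> of_real s * \<beta> = \<i> * of_real (-(2*pi))"
      by (elim disjE) simp_all
    thus ?thesis
      by (auto simp: exp_minus) (simp_all add: mult.commute)
  qed
  define E where "E \<xi> = exp (- (of_real s * \<Phi> \<xi>))" for \<xi>
  have ET: "E (\<xi> + ?T) = E \<xi>" if "\<xi> \<in> U" for \<xi>
  proof -
    have "E (\<xi> + ?T) = E \<xi> * exp (- (of_real s * \<beta>))"
      unfolding E_def \<beta>[OF that] exp_add[symmetric] by (simp add: distrib_left)
    thus ?thesis by (simp add: es)
  qed
  have ETn: "E (\<xi> + of_nat n * ?T) = E \<xi>" if "\<xi> \<in> U" for \<xi> n
  proof (induction n)
    case (Suc n)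
    have "\<xi> + of_nat n * ?T \<in> U" using that by (simp add: U_def)
    from ET[OF this] Suc show ?case by (simp add: algebra_simps)
  qed simp
  have Eexp: "E \<xi> = E \<eta>" if xe: "\<xi> \<in> U" "\<eta> \<in> U" "exp \<xi> = exp \<eta>" for \<xi> \<eta>
  proof -
    obtain n :: int where n: "\<xi> = \<eta> + (of_int (2 * n) * pi) * \<i>" using xe(3) exp_eq by blast
    show ?thesis
    proof (cases "n \<ge> 0")
      case True
      hence "\<xi> = \<eta> + of_nat (nat n) * ?T" using n by (simp add: algebra_simps)
      thus ?thesis using ETn[OF xe(2)] by simp
    next
      case False
      hence "\<eta> = \<xi> + of_nat (nat (-n)) * ?T" using n by (simp add: algebra_simps)
      thus ?thesis using ETn[OF xe(1), of "nat (-n)"] by simp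
    qed
  qed
  have holE: "E holomorphic_on U"
  proof -
    have "\<Phi> holomorphic_on U" using d\<Phi> openU by (auto simp: holomorphic_on_open)
    thus ?thesis unfolding E_def by (intro holomorphic_intros)
  qed
  \<comment> \<open>\<open>Ln\<close> jumps across its cut, but \<open>E\<close> does not see the
    choice of logarithm by \<open>Eexp\<close>; holomorphy is checked with a local branch
    instead.\<close>
  define f where "f w = E (Ln w)" for w
  have nf: "norm (f w) = exp (- s * v w)" if "w \<in> ?D" for w
    using Re\<Phi>[OF LnU[OF that]] that by (simp add: f_def E_def)
  have holf: "f holomorphic_on ?D"
  proof (rule holomorphic_on_open[THEN iffD2])
    show "open ?D" by auto
    show "\<forall>w\<in>?D. \<exists>f'. (f has_field_derivative f') (at w)"
    proof
      fix w0 assume w0: "w0 \<in> ?D"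
      define B where "B = ball w0 (min (norm w0) (1 - norm w0))"
      have B0: "w0 \<in> B" using w0 by (auto simp: B_def)
      have BD: "w \<in> ?D" if "w \<in> B" for w
      proof -
        have "norm (w0 - w) < norm w0" "norm (w0 - w) < 1 - norm w0"
          using that by (auto simp: B_def dist_norm)
        thus ?thesis using norm_triangle_ineq2[of w w0] norm_minus_commute[of w w0] by auto
      qed
      have Bpos: "w / w0 \<notin> \<real>\<^sub>\<le>\<^sub>0" if "w \<in> B" for w
      proof
        assume "w / w0 \<in> \<real>\<^sub>\<le>\<^sub>0"
        then obtain r where r: "r \<le> 0" "w / w0 = of_real r" by (auto elim!: nonpos_Reals_cases)
        have "w0 \<noteq> 0" using w0 by auto
        hence "w = of_real r * w0" using r by (simp add: field_simps)
        hence "w0 - w = of_real (1 - r) * w0" by (simp add: algebra_simps)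
        hence "norm (w0 - w) = (1 - r) * norm w0"
          using r by (simp only: norm_mult norm_of_real)
        moreover have "norm (w0 - w) < norm w0" using that by (auto simp: B_def dist_norm)
        moreover have "1 * norm w0 \<le> (1 - r) * norm w0"
          using r by (intro mult_right_mono) auto
        ultimately show False by linarith
      qed
      \<comment> \<open>A branch of the logarithm around \<open>w0\<close>: the ball
        \<open>B\<close> is so small that \<open>w / w0\<close> avoids the cut.\<close>
      define M where "M w = Ln (w / w0) + Ln w0" for w
      have expM: "exp (M w) = w" if "w \<in> B" for w
        using BD[OF that] w0 by (auto simp: M_def exp_add)
      have MU: "M w \<in> U" if "w \<in> B" for w
        using BD[OF that] w0 by (auto simp: M_def U_def norm_divide ln_div)
      have "M holomorphic_on B" unfolding M_def
        by (intro holomorphic_intros) (use w0 Bpos in auto)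
      hence "(\<lambda>w. E (M w)) holomorphic_on B"
        by (intro holomorphic_on_compose_gen[OF _ holE, unfolded o_def]) (use MU in auto)
      hence "f holomorphic_on B"
        by (rule holomorphic_transform)
           (use BD in \<open>auto simp: f_def expM intro!: Eexp MU LnU\<close>)
      thus "\<exists>f'. (f has_field_derivative f') (at w0)"
        using B0 by (auto simp: B_def holomorphic_on_open)
    qed
  qed
  have fle: "norm (f w) \<le> 1" if "w \<in> ?D" for w
    using nf[OF that] pos[OF that] s by simp
  have "\<exists>F. F holomorphic_on ball 0 1 \<and> (\<forall>z\<in>?D. F z = f z)"
    using holomorphic_on_extend_bounded[of f "ball 0 1" 0] holf fle
    by (metis (no_types, lifting) DiffI centre_in_ball eventually_at_topological interior_open mem_Collect_eq open_ball singletonD zero_less_one)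
  then obtain F where F: "F holomorphic_on ball 0 1" "\<And>z. z \<in> ?D \<Longrightarrow> F z = f z" by blast
  have Fnz: "F z \<noteq> 0" if "z \<in> ?D" for z
    using nf[OF that] F(2)[OF that] by (metis exp_not_eq_zero norm_zero)
  \<comment> \<open>The zero at 0 is split off so that the other factor has a holomorphic logarithm.
    \<open>F\<close> is not identically 0, since off the origin its modulus is an
    exponential.\<close>
  obtain n G where G: "G holomorphic_on ball 0 1" "\<And>w. w \<in> ball 0 1 \<Longrightarrow> G w \<noteq> 0"
      "\<And>w. w \<in> ball 0 1 \<Longrightarrow> F w = w ^ n * G w"
  proof (cases "F 0 = 0")
    case False
    show ?thesis
    proof (rule that[of F 0])
      show "F holomorphic_on ball 0 1" by fact
    qed (use False Fnz in force)+
  next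
    case True
    have nc: "\<not> F constant_on ball 0 1"
    proof
      assume "F constant_on ball 0 1"
      hence "F 0 = F (1/2)" by (auto simp: constant_on_def)
      moreover have "F (1/2) \<noteq> 0" by (rule Fnz) auto
      ultimately show False using True by simp
    qed
    have c0: "(0::complex) \<in> ball 0 1" by simp
    obtain g r n where r: "0 < n" "0 < r" "ball 0 r \<subseteq> ball (0::complex) 1" "g holomorphic_on ball 0 r"
      "\<And>w. w \<in> ball 0 r \<Longrightarrow> F w = (w - 0)^n * g w" "\<And>w. w \<in> ball 0 r \<Longrightarrow> g w \<noteq> 0"
      by (rule holomorphic_factor_zero_nonconstant[OF F(1) open_ball connected_ball c0 True nc]) (rule that)
    define G where "G w = (if w \<in> ball 0 r then g w else F w / w ^ n)" for w
    have "G holomorphic_on ball 0 r \<union> ?D" unfolding G_def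
    proof (rule holomorphic_on_If_Un)
      show "g holomorphic_on ball 0 r" by fact
      show "(\<lambda>w. F w / w ^ n) holomorphic_on ?D"
        by (intro holomorphic_intros holomorphic_on_subset[OF F(1)]) auto
      show "open ?D" by auto
    qed (use r in auto)
    moreover have "ball 0 r \<union> ?D = ball 0 1" using r by auto
    ultimately have "G holomorphic_on ball 0 1" by simp
    thus ?thesis
    proof (rule that[of G n])
      fix w :: complex assume w: "w \<in> ball 0 1"
      have "w \<noteq> 0" if "w \<notin> ball 0 r" using that r by auto
      thus "G w \<noteq> 0" "F w = w ^ n * G w"
        using r w Fnz[of w] by (auto simp: G_def)
    qed
  qed
  \<comment> \<open>Dividing by \<open>w ^ n\<close> weakens the bound inside the disk. The maximum
    modulus principle on the disk of radius \<open>r\<close> gives \<open>1 / r ^ n\<close>, and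
    then \<open>r\<close> tends to 1.\<close>
  have Gle: "norm (G w) \<le> 1" if w: "w \<in> ball 0 1" for w
  proof -
    have "norm (G w) * r ^ n \<le> 1" if r: "norm w < r" "r < 1" for r
    proof -
      have r0: "r > 0" using r norm_ge_zero[of w] by linarith
      have "norm (G w) \<le> 1 / r ^ n"
      proof (rule maximum_modulus_frontier[of G "ball 0 r"])
        show "G holomorphic_on interior (ball 0 r)"
          using r by (intro holomorphic_on_subset[OF G(1)]) auto
        show "continuous_on (closure (ball 0 r)) G"
          using r r0 by (intro continuous_on_subset[OF holomorphic_on_imp_continuous_on[OF G(1)]]) auto
        fix z :: complex assume "z \<in> frontier (ball 0 r)"
        hence z: "norm z = r" using r0 by auto
        have zD: "z \<in> ?D" using z r r0 by auto
        have "norm (z ^ n * G z) \<le> 1" using fle[OF zD] F(2)[OF zD] G(3)[of z] zD by simp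
        thus "norm (G z) \<le> 1 / r ^ n" using r0 z by (simp add: norm_mult norm_power field_simps)
      qed (use r in auto)
      thus ?thesis using r0 by (simp add: field_simps)
    qed
    hence ev: "\<forall>\<^sub>F r in at_left 1. norm (G w) * r ^ n \<le> 1"
      using w by (intro eventually_mono[OF eventually_at_left_real[of "norm w" 1]]) auto
    have "((\<lambda>r. norm (G w) * r ^ n) \<longlongrightarrow> norm (G w) * 1 ^ n) (at_left 1)"
      by (intro tendsto_intros)
    from tendsto_upperbound[OF this ev] show ?thesis by simp
  qed
  obtain H0 where H0: "H0 holomorphic_on ball 0 1" "\<And>z. z \<in> ball 0 1 \<Longrightarrow> G z = exp (H0 z)"
    using contractible_imp_holomorphic_log[OF G(1) convex_imp_contractible[OF convex_ball] G(2)] by blast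
  define H where "H z = - H0 z / of_real s" for z
  show ?thesis
  proof (intro exI[of _ "real n / s"] exI[of _ H] conjI ballI)
    show "0 \<le> real n / s" using s by simp
    show "H holomorphic_on ball 0 1" unfolding H_def
      by (intro holomorphic_intros H0) (use s in auto)
    fix w :: complex assume w: "w \<in> ball 0 1"
    have "exp (Re (H0 w)) \<le> 1" using Gle[OF w] H0(2)[OF w] by simp
    thus "0 \<le> Re (H w)" using s by (simp add: H_def divide_nonpos_pos)
  next
    fix w assume w: "w \<in> ?D"
    have w1: "w \<in> ball 0 1" "w \<noteq> 0" using w by auto
    have "exp (- s * v w) = norm (w ^ n * exp (H0 w))"
      using nf[OF w] F(2)[OF w] G(3)[OF w1(1)] H0(2)[OF w1(1)] by simp
    hence "exp (- s * v w) = norm w ^ n * exp (Re (H0 w))" by (simp add: norm_mult norm_power)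
    hence "- s * v w = ln (norm w ^ n * exp (Re (H0 w)))" by (metis ln_exp)
    also have "\<dots> = n * ln (norm w) + Re (H0 w)" using w1 by (simp add: ln_mult ln_realpow)
    finally have "v w = - (n * ln (norm w) + Re (H0 w)) / s" using s by (simp add: field_simps)
    thus "v w = real n / s * ln (1 / norm w) + Re (H w)"
      using w1 s by (simp add: H_def ln_div field_simps)
  qed
qed

section \<open>Poisson integrals\<close>

text \<open>Cauchy's formula at \<open>w\<close> is added to Cauchy's theorem for the kernel with
  its pole at the reflected point \<open>\<rho>\<^sup>2 / cnj w\<close>; on the circle the two
  kernels add up to the Poisson kernel. As \<open>\<rho>\<close> stays below \<open>R\<close>, no
  boundary values are involved.\<close>

lemma poisson_formula:
  assumes f: "f holomorphic_on ball 0 R" and \<rho>: "0 < \<rho>" "\<rho> < R" and w: "norm w < \<rho>"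
  shows "((\<lambda>t. of_real ((\<rho>\<^sup>2 - (norm w)\<^sup>2) / (norm (\<rho> * cis t - w))\<^sup>2) * f (\<rho> * cis t))
    has_integral (of_real (2 * pi) * f w)) {0..2*pi}"
proof -
  have hf: "f holomorphic_on cball 0 \<rho>" using \<rho> by (intro holomorphic_on_subset[OF f]) auto
  have 1: "((\<lambda>u. f u / (u - w)) has_contour_integral (2 * of_real pi * \<i> * f w)) (circlepath 0 \<rho>)"
    by (rule Cauchy_integral_circlepath_simple[OF hf]) (use w in auto)
  \<comment> \<open>A radius beyond \<open>\<rho>\<close> whose disk still misses the reflected
    pole.\<close>
  define \<rho>' where "\<rho>' = min R (if w = 0 then R else \<rho>\<^sup>2 / norm w)"
  have \<rho>': "\<rho> < \<rho>'" using \<rho> w by (auto simp: \<rho>'_def field_simps power2_eq_square)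
  have nz: "of_real (\<rho>\<^sup>2) - cnj w * u \<noteq> 0" if "norm u < \<rho>'" for u
  proof
    assume "of_real (\<rho>\<^sup>2) - cnj w * u = 0"
    hence "norm (of_real (\<rho>\<^sup>2) :: complex) = norm (cnj w * u)" by simp
    hence e: "\<rho>\<^sup>2 = norm w * norm u" by (simp only: norm_mult norm_of_real complex_mod_cnj) simp
    hence "w \<noteq> 0" using \<rho> by auto
    hence "norm u < \<rho>\<^sup>2 / norm w" using that by (auto simp: \<rho>'_def)
    thus False using e \<open>w \<noteq> 0\<close> by (simp add: field_simps)
  qed
  have 2: "((\<lambda>u. f u * (cnj w / (of_real (\<rho>\<^sup>2) - cnj w * u))) has_contour_integral 0) (circlepath 0 \<rho>)"
  proof (rule Cauchy_theorem_disc_simple[of _ 0 \<rho>'])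
    show "(\<lambda>u. f u * (cnj w / (of_real (\<rho>\<^sup>2) - cnj w * u))) holomorphic_on ball 0 \<rho>'"
      by (intro holomorphic_intros holomorphic_on_subset[OF f]) (use nz in \<open>auto simp: \<rho>'_def\<close>)
    show "path_image (circlepath 0 \<rho>) \<subseteq> ball 0 \<rho>'" using \<rho> \<rho>' by auto
  qed auto
  have "((\<lambda>u. f u / (u - w) + f u * (cnj w / (of_real (\<rho>\<^sup>2) - cnj w * u))) has_contour_integral (2 * of_real pi * \<i> * f w + 0)) (circlepath 0 \<rho>)"
    by (rule has_contour_integral_add[OF 1 2])
  hence "((\<lambda>t. (f (\<rho> * cis t) / (\<rho> * cis t - w) + f (\<rho> * cis t) * (cnj w / (of_real (\<rho>\<^sup>2) - cnj w * (\<rho> * cis t)))) * \<rho> * \<i> * cis t)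
     has_integral (2 * of_real pi * \<i> * f w)) {0..2*pi}"
    unfolding circlepath_def by (subst (asm) has_contour_integral_part_circlepath_iff) auto
  from has_integral_mult_right[OF this, of "-\<i>"]
  have 3: "((\<lambda>t. -\<i> * ((f (\<rho> * cis t) / (\<rho> * cis t - w) + f (\<rho> * cis t) * (cnj w / (of_real (\<rho>\<^sup>2) - cnj w * (\<rho> * cis t)))) * \<rho> * \<i> * cis t))
     has_integral (of_real (2 * pi) * f w)) {0..2*pi}" by (simp add: algebra_simps)
  show ?thesis
  proof (rule has_integral_eq[OF _ 3])
    fix t assume "t \<in> {0..2*pi}"
    define u where "u = \<rho> * cis t"
    have nu: "norm u = \<rho>" using \<rho> by (simp add: u_def norm_mult)
    have u0: "u \<noteq> 0" "u \<noteq> w" "cnj u \<noteq> cnj w" using nu \<rho> w by (auto dest!: arg_cong[of u w norm])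
    have uu: "of_real (\<rho>\<^sup>2) = u * cnj u" using nu complex_norm_square[of u] by simp
    have ww: "of_real ((norm w)\<^sup>2) = w * cnj w" using complex_norm_square[of w] by simp
    have uw: "of_real ((norm (u - w))\<^sup>2) = (u - w) * cnj (u - w)" using complex_norm_square[of "u - w"] by simp
    have "1 / (u - w) + cnj w / (u * cnj u - cnj w * u) = (u * cnj u - w * cnj w) / ((u - w) * cnj (u - w)) / u"
    proof -
      have a: "u * cnj u - cnj w * u = u * cnj (u - w)" by (simp add: algebra_simps)
      have b: "cnj (u - w) \<noteq> 0" "u - w \<noteq> 0" using u0 by auto
      have "1 / (u - w) + cnj w / (u * cnj (u - w)) = (u * cnj (u - w) + cnj w * (u - w)) / ((u - w) * cnj (u - w)) / u"
        using u0(1) b by (simp add: field_simps)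
      also have "u * cnj (u - w) + cnj w * (u - w) = u * cnj u - w * cnj w" by (simp add: algebra_simps)
      finally show ?thesis by (simp add: a)
    qed
    hence "f u * (1 / (u - w) + cnj w / (u * cnj u - cnj w * u)) * u = (u * cnj u - w * cnj w) / ((u - w) * cnj (u - w)) * f u"
      using u0 by simp
    hence "(f u / (u - w) + f u * (cnj w / (of_real (\<rho>\<^sup>2) - cnj w * u))) * u = of_real ((\<rho>\<^sup>2 - (norm w)\<^sup>2) / (norm (u - w))\<^sup>2) * f u"
      by (simp only: uu[symmetric] ww uw of_real_divide of_real_diff) (simp add: algebra_simps)
    thus "- \<i> * ((f (\<rho> * cis t) / (\<rho> * cis t - w) + f (\<rho> * cis t) * (cnj w / (of_real (\<rho>\<^sup>2) - cnj w * (\<rho> * cis t)))) * \<rho> * \<i> * cis t)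
      = of_real ((\<rho>\<^sup>2 - (norm w)\<^sup>2) / (norm (\<rho> * cis t - w))\<^sup>2) * f (\<rho> * cis t)"
      by (simp add: u_def algebra_simps)
  qed
qed

text \<open>The nontangential approach region, or Stolz cone, with vertex \<open>e\<close>. For
  unimodular \<open>e\<close> it is empty unless \<open>1 < M\<close>, which explains that side
  condition in later lemmas.\<close>

definition stolz :: "complex \<Rightarrow> real \<Rightarrow> complex set" where
  "stolz e M = {w. norm w < 1 \<and> norm (w - e) < M * (1 - norm w)}"

text \<open>Normalized to total mass \<open>2 * pi\<close> over a full turn.\<close>

definition poisson_kernel :: "complex \<Rightarrow> real \<Rightarrow> real" where
  "poisson_kernel w t = (1 - (norm w)\<^sup>2) / (norm (cis t - w))\<^sup>2"

lemma cis_minus_ge: "norm w < 1 \<Longrightarrow> 1 - norm w \<le> norm (cis t - w)"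
  using norm_triangle_ineq2[of "cis t" w] by simp

lemma cis_minus_pos: "norm w < 1 \<Longrightarrow> 0 < norm (cis t - w)"
  using cis_minus_ge[of w t] by linarith

lemma cis_neq_disk: "norm w < 1 \<Longrightarrow> cis t \<noteq> w"
  using cis_minus_pos[of w t] by auto

lemma poisson_kernel_nonneg: "norm w < 1 \<Longrightarrow> 0 \<le> poisson_kernel w t"
  by (auto simp: poisson_kernel_def power_le_one)

lemma continuous_on_poisson_kernel: "norm w < 1 \<Longrightarrow> continuous_on A (poisson_kernel w)"
  unfolding poisson_kernel_def by (intro continuous_intros) (auto simp: cis_neq_disk)

lemma poisson_formula_unit:
  assumes "f holomorphic_on ball 0 R" "1 < R" "norm w < 1"
  shows "((\<lambda>t. of_real (poisson_kernel w t) * f (cis t)) has_integral (of_real (2 * pi) * f w)) {0..2*pi}"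
  using poisson_formula[OF assms(1), of 1 w] assms(2,3) by (simp add: poisson_kernel_def)

lemma poisson_kernel_has_integral:
  assumes "norm w < 1" shows "(poisson_kernel w has_integral (2 * pi)) {0..2*pi}"
proof -
  have "((\<lambda>t. complex_of_real (poisson_kernel w t)) has_integral (of_real (2 * pi))) {0..2*pi}"
    using poisson_formula_unit[of "\<lambda>_. 1" 2 w] assms by simp
  from has_integral_Re[OF this] show ?thesis by simp
qed

lemma set_integrable_mult_continuous:
  fixes g :: "real \<Rightarrow> 'a::{banach,second_countable_topology}"
  assumes q: "continuous_on {a..b} q" and g: "set_integrable lborel {a..b} g"
  shows "set_integrable lborel {a..b} (\<lambda>t. q t *\<^sub>R g t)"
proof -
  obtain B where B0: "\<forall>y\<in>q ` {a..b}. norm y \<le> B"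
    using compact_imp_bounded[OF compact_continuous_image[OF q compact_Icc]] unfolding bounded_iff by blast
  have B: "\<bar>q t\<bar> \<le> \<bar>B\<bar>" if "t \<in> {a..b}" for t using B0 that by (metis abs_ge_self imageI order_trans real_norm_def)
  have g': "integrable lborel (\<lambda>t. indicator {a..b} t *\<^sub>R g t)" using g by (simp add: set_integrable_def)
  have qm: "(\<lambda>t. indicator {a..b} t *\<^sub>R q t) \<in> borel_measurable lborel"
    using borel_measurable_continuous_on_indicator[OF _ q] by simp
  have eq: "indicator {a..b} t *\<^sub>R (q t *\<^sub>R g t) = (indicator {a..b} t *\<^sub>R q t) *\<^sub>R (indicator {a..b} t *\<^sub>R g t)" for t
    by (simp add: indicator_def)
  show ?thesis unfolding set_integrable_def eq
  proof (rule Bochner_Integration.integrable_bound[of _ "\<lambda>t. B *\<^sub>R (indicator {a..b} t *\<^sub>R g t)"])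
    show "integrable lborel (\<lambda>t. B *\<^sub>R (indicator {a..b} t *\<^sub>R g t))" using g' by (rule integrable_scaleR_right)
    show "(\<lambda>t. (indicator {a..b} t *\<^sub>R q t) *\<^sub>R (indicator {a..b} t *\<^sub>R g t)) \<in> borel_measurable lborel"
      using qm borel_measurable_integrable[OF g'] by (rule borel_measurable_scaleR)
    show "AE t in lborel. norm ((indicator {a..b} t *\<^sub>R q t) *\<^sub>R (indicator {a..b} t *\<^sub>R g t)) \<le> norm (B *\<^sub>R (indicator {a..b} t *\<^sub>R g t))"
      using B by (intro AE_I2) (auto simp: indicator_def intro!: mult_right_mono B)
  qed
qed

lemma set_integrable_subinterval:
  fixes g :: "real \<Rightarrow> 'a::{banach,second_countable_topology}"
  assumes "set_integrable lborel {a..b} g" "{c..d} \<subseteq> {a..b}"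
  shows "set_integrable lborel {c..d} g"
  using set_integrable_subset[OF assms(1) _ assms(2)] by simp

section \<open>Fatou's theorem for integrable boundary data\<close>

text \<open>The primitive of an integrable \<open>g\<close> need not be differentiable everywhere,
  so the formula is obtained from Fubini's theorem on the triangle
  \<open>a \<le> t \<le> s \<le> b\<close>.\<close>

lemma integral_by_parts_L1:
  fixes g :: "real \<Rightarrow> complex" and Q :: "real \<Rightarrow> real"
  assumes ab: "a \<le> b" and g: "set_integrable lborel {a..b} g"
    and dQ: "\<And>t. t \<in> {a..b} \<Longrightarrow> (Q has_vector_derivative Q' t) (at t within {a..b})"
    and cQ': "continuous_on {a..b} Q'"
  shows "integral {a..b} (\<lambda>t. Q t *\<^sub>R g t)
    = Q b *\<^sub>R integral {a..b} g - integral {a..b} (\<lambda>s. Q' s *\<^sub>R integral {a..s} g)"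
proof -
  have cQ: "continuous_on {a..b} Q"
    using dQ by (meson continuous_on_eq_continuous_within has_vector_derivative_continuous)
  define G where "G t = indicator {a..b} t *\<^sub>R g t" for t
  define q where "q t = indicator {a..b} t *\<^sub>R Q' t" for t
  have Gi: "integrable lborel G" using g by (simp add: G_def[abs_def] set_integrable_def)
  have qi: "integrable lborel q"
    using borel_integrable_compact[OF compact_Icc cQ'] by (simp add: q_def[abs_def] indicator_def if_distrib cong: if_cong)
  have Gm: "G \<in> borel_measurable lborel" "q \<in> borel_measurable lborel" using Gi qi by auto
  define f where "f t s = (if t \<le> s then q s *\<^sub>R G t else 0)" for t s
  have fm: "case_prod f \<in> borel_measurable (lborel \<Otimes>\<^sub>M lborel)"
    unfolding f_def split_beta' using Gm by measurable
  have prodint: "integrable (lborel \<Otimes>\<^sub>M lborel) (\<lambda>(t,s). q s *\<^sub>R G t)"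
  proof (rule lborel_pair.Fubini_integrable)
    show "(\<lambda>(t,s). q s *\<^sub>R G t) \<in> borel_measurable (lborel \<Otimes>\<^sub>M lborel)"
      unfolding split_beta' using Gm by measurable
    have "(\<lambda>t. LINT s|lborel. norm (case (t, s) of (t, s) \<Rightarrow> q s *\<^sub>R G t)) = (\<lambda>t. (LINT s|lborel. \<bar>q s\<bar>) * norm (G t))"
      by (auto simp: fun_eq_iff)
    thus "integrable lborel (\<lambda>t. LINT s|lborel. norm (case (t, s) of (t, s) \<Rightarrow> q s *\<^sub>R G t))"
      using Gi by simp
    show "AE t in lborel. integrable lborel (\<lambda>s. case (t, s) of (t, s) \<Rightarrow> q s *\<^sub>R G t)"
      using qi by simp
  qed
  have fint: "integrable (lborel \<Otimes>\<^sub>M lborel) (case_prod f)"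
    by (rule Bochner_Integration.integrable_bound[OF prodint fm]) (auto simp: f_def)
  have fub: "(LINT s|lborel. LINT t|lborel. f t s) = (LINT t|lborel. LINT s|lborel. f t s)"
    by (rule lborel_pair.Fubini_integral[OF fint])
  have inner1: "(LINT t|lborel. f t s) = indicator {a..b} s *\<^sub>R (Q' s *\<^sub>R integral {a..s} g)" for s
  proof (cases "s \<in> {a..b}")
    case True
    have "(LINT t|lborel. f t s) = (LINT t|lborel. Q' s *\<^sub>R (indicator {a..s} t *\<^sub>R g t))"
      using True by (intro Bochner_Integration.integral_cong) (auto simp: f_def q_def G_def indicator_def)
    also have "\<dots> = Q' s *\<^sub>R (LINT t:{a..s}|lborel. g t)"
      unfolding set_lebesgue_integral_def by (rule integral_scaleR_right)
    also have "(LINT t:{a..s}|lborel. g t) = integral {a..s} g"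
      using True by (intro set_borel_integral_eq_integral set_integrable_subinterval[OF g]) auto
    finally show ?thesis using True by simp
  next
    case False
    hence "f t s = 0" for t by (simp add: f_def q_def)
    thus ?thesis using False by simp
  qed
  have inner2: "(LINT s|lborel. f t s) = indicator {a..b} t *\<^sub>R ((Q b - Q t) *\<^sub>R g t)" for t
  proof (cases "t \<in> {a..b}")
    case True
    have 1: "(Q' has_integral (Q b - Q t)) {t..b}"
      by (rule fundamental_theorem_of_calculus) (use True in \<open>auto intro!: has_vector_derivative_within_subset[OF dQ]\<close>)
    have si: "set_integrable lborel {t..b} Q'" unfolding set_integrable_def
      using True borel_integrable_compact[OF compact_Icc continuous_on_subset[OF cQ', of "{t..b}"]]
      by (simp add: indicator_def if_distrib cong: if_cong)
    have "(LINT s|lborel. f t s) = (LINT s|lborel. (indicator {t..b} s *\<^sub>R Q' s) *\<^sub>R g t)"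
      using True by (intro Bochner_Integration.integral_cong) (auto simp: f_def q_def G_def indicator_def)
    also have "\<dots> = (LINT s:{t..b}|lborel. Q' s) *\<^sub>R g t"
      unfolding set_lebesgue_integral_def
      by (rule integral_scaleR_left) (use si in \<open>simp add: set_integrable_def\<close>)
    also have "(LINT s:{t..b}|lborel. Q' s) = Q b - Q t"
      using set_borel_integral_eq_integral(2)[OF si] 1 by (simp add: integral_unique)
    finally show ?thesis using True by simp
  next
    case False
    hence "f t s = 0" for s by (simp add: f_def G_def)
    thus ?thesis using False by simp
  qed
  have gi: "g integrable_on {a..b}" using set_borel_integral_eq_integral(1)[OF g] .
  have Qgs: "set_integrable lborel {a..b} (\<lambda>t. Q t *\<^sub>R g t)" by (rule set_integrable_mult_continuous[OF cQ g])
  have i1: "(LINT s|lborel. LINT t|lborel. f t s) = integral {a..b} (\<lambda>s. Q' s *\<^sub>R integral {a..s} g)"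
  proof -
    have "continuous_on {a..b} (\<lambda>s. integral {a..s} g)" by (rule indefinite_integral_continuous_1[OF gi])
    hence "continuous_on {a..b} (\<lambda>s. Q' s *\<^sub>R integral {a..s} g)" using cQ' by (intro continuous_intros)
    hence "set_integrable lborel {a..b} (\<lambda>s. Q' s *\<^sub>R integral {a..s} g)"
      unfolding set_integrable_def by (rule borel_integrable_compact[OF compact_Icc, THEN back_subst[of "integrable lborel"]])
         (auto simp: indicator_def)
    from set_borel_integral_eq_integral(2)[OF this] show ?thesis
      by (simp add: inner1 set_lebesgue_integral_def)
  qed
  have Qbg: "set_integrable lborel {a..b} (\<lambda>t. Q b *\<^sub>R g t)" using g by simp
  have i2: "(LINT t|lborel. LINT s|lborel. f t s) = Q b *\<^sub>R integral {a..b} g - integral {a..b} (\<lambda>t. Q t *\<^sub>R g t)"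
  proof -
    have "(LINT t|lborel. LINT s|lborel. f t s) = (LINT t:{a..b}|lborel. Q b *\<^sub>R g t - Q t *\<^sub>R g t)"
      by (simp add: inner2 set_lebesgue_integral_def scaleR_diff_left)
    also have "\<dots> = (LINT t:{a..b}|lborel. Q b *\<^sub>R g t) - (LINT t:{a..b}|lborel. Q t *\<^sub>R g t)"
      by (rule set_integral_diff(2)[OF Qbg Qgs])
    also have "(LINT t:{a..b}|lborel. Q b *\<^sub>R g t) = Q b *\<^sub>R integral {a..b} g"
      using set_borel_integral_eq_integral(2)[OF g] by simp
    also have "(LINT t:{a..b}|lborel. Q t *\<^sub>R g t) = integral {a..b} (\<lambda>t. Q t *\<^sub>R g t)"
      by (rule set_borel_integral_eq_integral(2)[OF Qgs])
    finally show ?thesis .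
  qed
  show ?thesis using fub i1 i2 by (simp add: algebra_simps)
qed

text \<open>Only the norm of the averaged difference is controlled, not the average of its norm;
  after integration by parts the Poisson estimate needs no more. Averages to the left are averages
  to the right for the reflected function.\<close>

lemma lebesgue_points:
  fixes g :: "real \<Rightarrow> complex"
  assumes g: "\<And>a b. g integrable_on {a..b}"
  shows "\<exists>N. negligible N \<and> (\<forall>x e. x \<notin> N \<longrightarrow> 0 < e \<longrightarrow> (\<exists>d>0. \<forall>h. 0 \<le> h \<and> h < d \<longrightarrow>
      norm (integral {0..h} (\<lambda>s. g (x + s) - g x)) \<le> e * h \<and>
      norm (integral {0..h} (\<lambda>s. g (x - s) - g x)) \<le> e * h))"
proof -
  have one: "\<exists>N. negligible N \<and> (\<forall>x e. x \<notin> N \<longrightarrow> 0 < e \<longrightarrow> (\<exists>d>0. \<forall>h. 0 \<le> h \<and> h < d \<longrightarrow>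
      norm (integral {0..h} (\<lambda>s. g (x + s) - g x)) \<le> e * h))"
    if g: "\<And>a b. g integrable_on {a..b}" for g :: "real \<Rightarrow> complex"
  proof -
    obtain N where N: "negligible N" "\<And>x e. \<lbrakk>x \<notin> N; 0 < e\<rbrakk> \<Longrightarrow>
               \<exists>d>0. \<forall>h. 0 < h \<and> h < d \<longrightarrow>
                         norm(integral (cbox x (x + h *\<^sub>R One)) g /\<^sub>R h ^ DIM(real) - g x) < e"
      using integrable_ccontinuous_explicit[of g] g by (metis box_real(2))
    have "\<exists>d>0. \<forall>h. 0 \<le> h \<and> h < d \<longrightarrow> norm (integral {0..h} (\<lambda>s. g (x + s) - g x)) \<le> e * h"
      if x: "x \<notin> N" "0 < e" for x e
    proof -
      obtain d where d: "d > 0" "\<And>h. 0 < h \<Longrightarrow> h < d \<Longrightarrow> norm(integral {x..x + h} g /\<^sub>R h - g x) < e"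
        using N(2)[OF x] by auto
      have "norm (integral {0..h} (\<lambda>s. g (x + s) - g x)) \<le> e * h" if h: "0 \<le> h" "h < d" for h
      proof (cases "h = 0")
        case False
        hence h0: "h > 0" using h by simp
        have gx: "(g has_integral integral {x..x+h} g) {x..x+h}" using g by (simp add: integrable_integral)
        have "((\<lambda>s. g (x + s)) has_integral integral {x..x+h} g) {0..h}"
          using has_integral_affinity[of g "integral {x..x+h} g" x "x+h" 1 x] gx
          by (simp add: add.commute)
        hence "((\<lambda>s. g (x + s) - g x) has_integral (integral {x..x+h} g - h *\<^sub>R g x)) {0..h}"
          using has_integral_diff[OF _ has_integral_const_real[of "g x" 0 h]] h0 by simp
        hence "integral {0..h} (\<lambda>s. g (x + s) - g x) = integral {x..x+h} g - h *\<^sub>R g x" by (rule integral_unique)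
        also have "\<dots> = h *\<^sub>R (integral {x..x + h} g /\<^sub>R h - g x)" using h0 by (simp add: scaleR_diff_right)
        also have "norm \<dots> \<le> h * e" using h0 d(2)[of h] h by (simp add: less_imp_le)
        finally show ?thesis by (simp add: mult.commute)
      qed simp
      thus ?thesis using d(1) by blast
    qed
    thus ?thesis using N(1) by blast
  qed
  obtain N1 where N1: "negligible N1" "\<And>x e. x \<notin> N1 \<Longrightarrow> 0 < e \<Longrightarrow> \<exists>d>0. \<forall>h. 0 \<le> h \<and> h < d \<longrightarrow>
      norm (integral {0..h} (\<lambda>s. g (x + s) - g x)) \<le> e * h" using one[OF g] by blast
  have "(\<lambda>x. g (-x)) integrable_on {a..b}" for a b
    using g[of "-b" "-a"] Henstock_Kurzweil_Integration.integrable_reflect_real[where f=g and a="-b" and b="-a"] by simp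
  from one[OF this] obtain N2 where N2: "negligible N2" "\<And>x e. x \<notin> N2 \<Longrightarrow> 0 < e \<Longrightarrow> \<exists>d>0. \<forall>h. 0 \<le> h \<and> h < d \<longrightarrow>
      norm (integral {0..h} (\<lambda>s. g (- (x + s)) - g (-x))) \<le> e * h" by blast
  have negl: "negligible (uminus ` N2)"
    by (rule negligible_differentiable_image_negligible[OF order_refl N2(1)]) (auto intro!: derivative_intros simp: differentiable_on_def)
  show ?thesis
  proof (intro exI[of _ "N1 \<union> uminus ` N2"] conjI allI impI)
    show "negligible (N1 \<union> uminus ` N2)" using N1(1) negl by simp
    fix x e :: real assume x: "x \<notin> N1 \<union> uminus ` N2" and e: "0 < e"
    have x1: "x \<notin> N1" and x2: "- x \<notin> N2" using x by (auto simp: image_iff)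
    obtain d1 where d1: "d1 > 0" "\<And>h. 0 \<le> h \<Longrightarrow> h < d1 \<Longrightarrow>
      norm (integral {0..h} (\<lambda>s. g (x + s) - g x)) \<le> e * h" using N1(2)[OF x1 e] by blast
    obtain d2 where d2: "d2 > 0" "\<And>h. 0 \<le> h \<Longrightarrow> h < d2 \<Longrightarrow>
      norm (integral {0..h} (\<lambda>s. g (x - s) - g x)) \<le> e * h" using N2(2)[OF x2 e] by auto
    show "\<exists>d>0. \<forall>h. 0 \<le> h \<and> h < d \<longrightarrow>
      norm (integral {0..h} (\<lambda>s. g (x + s) - g x)) \<le> e * h \<and>
      norm (integral {0..h} (\<lambda>s. g (x - s) - g x)) \<le> e * h"
      by (rule exI[of _ "min d1 d2"]) (use d1 d2 in auto)
  qed
qed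

text \<open>The chord is twice the sine of half the angle. Half angles up to \<open>1/2\<close> lie
  below \<open>pi / 3\<close>, where the cosine is at least \<open>1/2\<close>; this gives the
  factor 2.\<close>

lemma cis_diff_bounds:
  shows "norm (cis s - cis t) \<le> \<bar>s - t\<bar>"
    and "\<bar>s - t\<bar> \<le> 1 \<Longrightarrow> \<bar>s - t\<bar> \<le> 2 * norm (cis s - cis t)"
proof -
  have eq: "norm (cis s - cis t) = 2 * \<bar>sin ((s - t) / 2)\<bar>"
  proof -
    have "(norm (cis s - cis t))\<^sup>2 = (cos s - cos t)\<^sup>2 + (sin s - sin t)\<^sup>2"
      by (simp add: cmod_power2)
    also have "\<dots> = 2 - 2 * cos (s - t)"
    proof -
      have "(cos s - cos t)\<^sup>2 + (sin s - sin t)\<^sup>2 = ((sin s)\<^sup>2 + (cos s)\<^sup>2) + ((sin t)\<^sup>2 + (cos t)\<^sup>2) - 2 * (cos s * cos t + sin s * sin t)"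
        by (simp add: power2_eq_square algebra_simps)
      thus ?thesis by (simp add: cos_diff)
    qed
    also have "\<dots> = (2 * \<bar>sin ((s - t) / 2)\<bar>)\<^sup>2"
    proof -
      have "2 * ((s - t) / 2) = s - t" by simp
      hence "cos (s - t) = 1 - 2 * (sin ((s - t) / 2))\<^sup>2" using cos_double_sin[of "(s - t) / 2"] by (simp only:)
      thus ?thesis by (simp add: power_mult_distrib)
    qed
    finally show ?thesis by (rule power2_eq_imp_eq) auto
  qed
  show "norm (cis s - cis t) \<le> \<bar>s - t\<bar>"
    using abs_sin_x_le_abs_x[of "(s - t) / 2"] by (simp add: eq)
  assume st: "\<bar>s - t\<bar> \<le> 1"
  define y where "y = \<bar>s - t\<bar> / 2"
  have y: "0 \<le> y" "y \<le> 1/2" using st by (auto simp: y_def)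
  have "(s - t) / 2 = y \<or> (s - t) / 2 = - y" by (auto simp: y_def abs_if)
  hence "\<bar>sin ((s - t) / 2)\<bar> = \<bar>sin y\<bar>" by (elim disjE) simp_all
  moreover have "y / 2 \<le> sin y"
  proof (cases "y = 0")
    case False
    obtain z where z: "0 < z" "z < y" "sin y - sin 0 = (y - 0) * cos z"
      using MVT2[of 0 y sin cos] y False by (auto intro: DERIV_sin)
    have "cos (pi/3) \<le> cos z" using z y pi_gt3 by (intro cos_monotone_0_pi_le) auto
    hence "y * (1/2) \<le> y * cos z" using y by (intro mult_left_mono) (auto simp: cos_60)
    thus ?thesis using z by simp
  qed simp
  ultimately show "\<bar>s - t\<bar> \<le> 2 * norm (cis s - cis t)" using y by (simp add: eq y_def)
qed

text \<open>Bounding the derivative by the kernel itself means that after integration by parts no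
  integral other than the known mass of the kernel has to be estimated.\<close>

lemma poisson_kernel_deriv:
  assumes w: "norm w < 1"
  shows "\<exists>Q'. continuous_on UNIV Q' \<and> (\<forall>t. (poisson_kernel w has_real_derivative Q' t) (at t)) \<and>
    (\<forall>t. \<bar>Q' t\<bar> \<le> 2 / norm (cis t - w) * poisson_kernel w t)"
proof -
  define n where "n t = (norm (cis t - w))\<^sup>2" for t
  have n_eq: "n t = (cos t - Re w)\<^sup>2 + (sin t - Im w)\<^sup>2" for t
    by (simp add: n_def cmod_power2)
  have npos: "n t > 0" for t using cis_minus_pos[OF w, of t] by (simp add: n_def)
  define n' where "n' t = 2 * (cos t - Re w) * (- sin t) + 2 * (sin t - Im w) * cos t" for t
  have dn: "(n has_real_derivative n' t) (at t)" for t
    unfolding n_eq[abs_def] n'_def by (auto intro!: derivative_eq_intros simp: algebra_simps)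
  have n'_le: "\<bar>n' t\<bar> \<le> 2 * norm (cis t - w)" for t
  proof -
    have "n' t = 2 * Re ((cis t - w) * cnj (\<i> * cis t))" by (simp add: n'_def algebra_simps)
    moreover have "\<bar>Re ((cis t - w) * cnj (\<i> * cis t))\<bar> \<le> norm ((cis t - w) * cnj (\<i> * cis t))" by (rule abs_Re_le_cmod)
    ultimately show ?thesis by (simp add: norm_mult)
  qed
  define Q' where "Q' t = - (1 - (norm w)\<^sup>2) * n' t / (n t)\<^sup>2" for t
  have pk: "poisson_kernel w = (\<lambda>t. (1 - (norm w)\<^sup>2) / n t)" by (auto simp: poisson_kernel_def n_def)
  have d: "(poisson_kernel w has_real_derivative Q' t) (at t)" for t
    unfolding pk Q'_def using npos[of t]
    by (auto intro!: derivative_eq_intros dn simp: power2_eq_square left_diff_distrib diff_divide_distrib)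
  have c: "continuous_on UNIV Q'" unfolding Q'_def n'_def n_def
    by (intro continuous_intros) (auto simp: cis_neq_disk[OF w])
  have b: "\<bar>Q' t\<bar> \<le> 2 / norm (cis t - w) * poisson_kernel w t" for t
  proof -
    have w1: "0 \<le> 1 - (norm w)\<^sup>2" using w by (simp add: power_le_one)
    have "\<bar>Q' t\<bar> = (1 - (norm w)\<^sup>2) * \<bar>n' t\<bar> / (n t)\<^sup>2" using w1 npos[of t] by (simp add: Q'_def abs_mult)
    also have "\<dots> \<le> (1 - (norm w)\<^sup>2) * (2 * norm (cis t - w)) / (n t)\<^sup>2"
      by (intro divide_right_mono mult_left_mono n'_le w1) auto
    also have "\<dots> = 2 / norm (cis t - w) * poisson_kernel w t"
      using cis_minus_pos[OF w, of t] by (simp add: poisson_kernel_def n_def field_simps power2_eq_square)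
    finally show ?thesis .
  qed
  show ?thesis using c d b by blast
qed

text \<open>For \<open>w\<close> in a cone, \<open>s\<close> is at most a multiple of
  \<open>norm (cis s - w)\<close>. Differentiating the kernel costs one factor of that distance, the
  primitive of \<open>g\<close> pays it back with its factor \<open>s\<close>, and what remains is
  the kernel, of mass at most \<open>2 * pi\<close>. The constant is \<open>4 * (1 + M)\<close> from
  the end point plus \<open>4 * (1 + M) * (2 * pi)\<close> from the integral.\<close>

lemma poisson_kernel_one_sided:
  fixes g :: "real \<Rightarrow> complex"
  assumes \<delta>: "0 < \<delta>" "\<delta> \<le> 1" and M: "0 < M" and g: "set_integrable lborel {0..\<delta>} g"
    and G: "\<And>s. s \<in> {0..\<delta>} \<Longrightarrow> norm (integral {0..s} g) \<le> \<epsilon> * s"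
    and w: "w \<in> stolz 1 M"
  shows "norm (integral {0..\<delta>} (\<lambda>t. poisson_kernel w t *\<^sub>R g t)) \<le> \<epsilon> * ((1 + M) * (4 + 8 * pi))"
proof -
  let ?P = "poisson_kernel w"
  have w1: "norm w < 1" and wM: "norm (w - 1) < M * (1 - norm w)" using w by (auto simp: stolz_def)
  have "0 \<le> \<epsilon> * \<delta>" using order_trans[OF norm_ge_zero G[of \<delta>]] \<delta> by simp
  hence e0: "0 \<le> \<epsilon>" using \<delta> by (simp add: zero_le_mult_iff)
  obtain Q' where cQ': "continuous_on UNIV Q'" and dQ: "\<And>t. (?P has_real_derivative Q' t) (at t)"
    and bQ: "\<And>t. \<bar>Q' t\<bar> \<le> 2 / norm (cis t - w) * ?P t" using poisson_kernel_deriv[OF w1] by blast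
  have close: "t \<le> 2 * (1 + M) * norm (cis t - w)" if "t \<in> {0..\<delta>}" for t
  proof -
    have 1: "t \<le> 2 * norm (cis t - 1)" using cis_diff_bounds(2)[of t 0] that \<delta> by auto
    have 2: "norm (cis t - 1) \<le> norm (cis t - w) + norm (w - 1)"
      using norm_triangle_ineq[of "cis t - w" "w - 1"] by simp
    have 3: "norm (w - 1) \<le> M * norm (cis t - w)"
      using wM mult_left_mono[OF cis_minus_ge[OF w1, of t], of M] M by linarith
    have "norm (cis t - 1) \<le> norm (cis t - w) + M * norm (cis t - w)"
      by (rule order_trans[OF 2 add_left_mono[OF 3]])
    hence "2 * norm (cis t - 1) \<le> 2 * (norm (cis t - w) + M * norm (cis t - w))" by (rule mult_left_mono) simp
    hence "t \<le> 2 * (norm (cis t - w) + M * norm (cis t - w))" by (rule order_trans[OF 1])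
    thus ?thesis by (simp add: algebra_simps)
  qed
  have parts: "integral {0..\<delta>} (\<lambda>t. ?P t *\<^sub>R g t) = ?P \<delta> *\<^sub>R integral {0..\<delta>} g - integral {0..\<delta>} (\<lambda>s. Q' s *\<^sub>R integral {0..s} g)"
  proof (rule integral_by_parts_L1[OF _ g])
    show "continuous_on {0..\<delta>} Q'" by (rule continuous_on_subset[OF cQ']) auto
    show "(?P has_vector_derivative Q' t) (at t within {0..\<delta>})" for t
      by (rule has_vector_derivative_at_within) (use dQ[of t] in \<open>simp only: has_real_derivative_iff_has_vector_derivative\<close>)
  qed (use \<delta> in auto)
  have Ple: "integral {0..\<delta>} ?P \<le> 2 * pi"
  proof -
    have "integral {0..\<delta>} ?P \<le> integral {0..2*pi} ?P"
    proof (rule integral_subset_le)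
      show "{0..\<delta>} \<subseteq> {0..2*pi}" using \<delta> pi_gt3 by auto
      show "?P integrable_on {0..\<delta>}" by (intro integrable_continuous_interval continuous_on_poisson_kernel w1)
      show "?P integrable_on {0..2*pi}" by (intro integrable_continuous_interval continuous_on_poisson_kernel w1)
    qed (use poisson_kernel_nonneg[OF w1] in auto)
    thus ?thesis using poisson_kernel_has_integral[OF w1] by (simp add: integral_unique)
  qed
  have t1: "norm (?P \<delta> *\<^sub>R integral {0..\<delta>} g) \<le> \<epsilon> * (4 * (1 + M))"
  proof -
    have pos: "0 < norm (cis \<delta> - w)" by (rule cis_minus_pos[OF w1])
    have "norm (?P \<delta> *\<^sub>R integral {0..\<delta>} g) \<le> ?P \<delta> * (\<epsilon> * \<delta>)"
      using G[of \<delta>] \<delta> poisson_kernel_nonneg[OF w1, of \<delta>] by (auto intro!: mult_left_mono)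
    also have "\<dots> \<le> ?P \<delta> * (\<epsilon> * (2 * (1 + M) * norm (cis \<delta> - w)))"
      using close[of \<delta>] \<delta> e0 poisson_kernel_nonneg[OF w1, of \<delta>] by (intro mult_left_mono) auto
    also have "\<dots> = \<epsilon> * (2 * (1 + M)) * ((1 - (norm w)\<^sup>2) / norm (cis \<delta> - w))"
      using pos by (simp add: poisson_kernel_def power2_eq_square)
    also have "\<dots> \<le> \<epsilon> * (2 * (1 + M)) * 2"
    proof (rule mult_left_mono)
      have "1 - (norm w)\<^sup>2 = (1 + norm w) * (1 - norm w)" by (simp add: power2_eq_square algebra_simps)
      also have "\<dots> \<le> 2 * norm (cis \<delta> - w)" using w1 cis_minus_ge[OF w1, of \<delta>] by (intro mult_mono) auto
      finally show "(1 - (norm w)\<^sup>2) / norm (cis \<delta> - w) \<le> 2" using pos by (simp add: divide_le_eq)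
    qed (use e0 M in auto)
    finally show ?thesis by (simp add: mult.assoc)
  qed
  have t2: "norm (integral {0..\<delta>} (\<lambda>s. Q' s *\<^sub>R integral {0..s} g)) \<le> \<epsilon> * (8 * pi * (1 + M))"
  proof -
    have gi: "g integrable_on {0..\<delta>}" using set_borel_integral_eq_integral(1)[OF g] .
    have "norm (integral {0..\<delta>} (\<lambda>s. Q' s *\<^sub>R integral {0..s} g)) \<le> integral {0..\<delta>} (\<lambda>s. \<epsilon> * (4 * (1 + M)) * ?P s)"
    proof (rule integral_norm_bound_integral)
      show "(\<lambda>s. Q' s *\<^sub>R integral {0..s} g) integrable_on {0..\<delta>}"
        by (intro integrable_continuous_interval continuous_on_scaleR continuous_on_subset[OF cQ'] indefinite_integral_continuous_1[OF gi]) auto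
      show "(\<lambda>s. \<epsilon> * (4 * (1 + M)) * ?P s) integrable_on {0..\<delta>}"
        by (intro integrable_continuous_interval continuous_intros continuous_on_poisson_kernel w1)
      fix s assume s: "s \<in> {0..\<delta>}"
      have pos: "0 < norm (cis s - w)" by (rule cis_minus_pos[OF w1])
      have "norm (Q' s *\<^sub>R integral {0..s} g) \<le> (2 / norm (cis s - w) * ?P s) * (\<epsilon> * s)"
        unfolding norm_scaleR using G[OF s] bQ[of s] poisson_kernel_nonneg[OF w1, of s] by (intro mult_mono) auto
      also have "\<dots> \<le> (2 / norm (cis s - w) * ?P s) * (\<epsilon> * (2 * (1 + M) * norm (cis s - w)))"
        using close[OF s] e0 poisson_kernel_nonneg[OF w1, of s] by (intro mult_left_mono) auto
      also have "\<dots> = \<epsilon> * (4 * (1 + M)) * ?P s" using pos by (simp add: field_simps)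
      finally show "norm (Q' s *\<^sub>R integral {0..s} g) \<le> \<epsilon> * (4 * (1 + M)) * ?P s" .
    qed
    also have "\<dots> = \<epsilon> * (4 * (1 + M)) * integral {0..\<delta>} ?P" by (rule integral_mult_right)
    also have "\<dots> \<le> \<epsilon> * (4 * (1 + M)) * (2 * pi)" using Ple e0 M by (intro mult_left_mono) auto
    finally show ?thesis by (simp add: algebra_simps)
  qed
  have "norm (integral {0..\<delta>} (\<lambda>t. ?P t *\<^sub>R g t)) \<le> \<epsilon> * (4 * (1 + M)) + \<epsilon> * (8 * pi * (1 + M))"
    unfolding parts by (rule order_trans[OF norm_triangle_ineq4 add_mono[OF t1 t2]])
  also have "\<dots> = \<epsilon> * ((1 + M) * (4 + 8 * pi))" by (simp add: algebra_simps)
  finally show ?thesis .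
qed

lemma cis_neq_cis:
  assumes "0 < x" "x < 2 * pi" "0 \<le> t" "t \<le> 2 * pi" "t \<noteq> x"
  shows "cis t \<noteq> cis x"
proof
  assume "cis t = cis x"
  hence eq: "exp (\<i> * complex_of_real t) = exp (\<i> * complex_of_real x)" by (simp add: cis_conv_exp)
  have "\<i> * complex_of_real t = \<i> * complex_of_real x"
    by (rule exp_complex_eqI[OF _ eq]) (use assms in simp)
  thus False using assms by simp
qed

text \<open>Rotation moves the vertex to 1, and conjugation turns an arc to the left of it into one
  to the right, so the one-sided estimate serves both sides.\<close>

lemma poisson_kernel_rotate:
  "poisson_kernel w (x + s) = poisson_kernel (cis (- x) * w) s"
  "poisson_kernel w (x - s) = poisson_kernel (cnj (cis (- x) * w)) s"
proof -
  have fac: "cis x * (cis s - cis (- x) * w) = cis (x + s) - w" for s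
  proof -
    have "cis x * (cis s - cis (- x) * w) = cis x * cis s - (cis x * cis (- x)) * w"
      by (simp only: right_diff_distrib mult.assoc)
    thus ?thesis by (simp only: cis_mult) simp
  qed
  from fac[of s] have "cis (x + s) - w = cis x * (cis s - cis (- x) * w)" by (rule sym)
  hence "norm (cis (x + s) - w) = norm (cis s - cis (- x) * w)" by (simp add: norm_mult)
  thus "poisson_kernel w (x + s) = poisson_kernel (cis (- x) * w) s"
    by (simp add: poisson_kernel_def norm_mult)
  have "cis (x - s) - w = cis x * (cis (- s) - cis (- x) * w)" using fac[of "- s"] by simp
  hence "norm (cis (x - s) - w) = norm (cis (- s) - cis (- x) * w)" by (simp add: norm_mult)
  also have "\<dots> = norm (cnj (cis (- s) - cis (- x) * w))" by (rule complex_mod_cnj[symmetric])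
  also have "cnj (cis (- s) - cis (- x) * w) = cis s - cnj (cis (- x) * w)"
    by (simp add: cis_cnj)
  finally show "poisson_kernel w (x - s) = poisson_kernel (cnj (cis (- x) * w)) s"
    by (simp add: poisson_kernel_def norm_mult)
qed

lemma stolz_rotate:
  assumes "w \<in> stolz (cis x) M"
  shows "cis (- x) * w \<in> stolz 1 M" "cnj (cis (- x) * w) \<in> stolz 1 M"
proof -
  have "cis (- x) * (w - cis x) = cis (- x) * w - cis (- x) * cis x" by (rule right_diff_distrib)
  hence "cis (- x) * w - 1 = cis (- x) * (w - cis x)" by (simp only: cis_mult) simp
  hence 1: "norm (cis (- x) * w - 1) = norm (w - cis x)" by (simp add: norm_mult)
  thus "cis (- x) * w \<in> stolz 1 M" using assms by (simp add: stolz_def norm_mult)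
  have "norm (cnj (cis (- x) * w) - 1) = norm (cnj (cis (- x) * w - 1))" by simp
  also have "\<dots> = norm (w - cis x)" using 1 by (simp only: complex_mod_cnj)
  finally show "cnj (cis (- x) * w) \<in> stolz 1 M" using assms
    by (simp add: stolz_def norm_mult)
qed

text \<open>At a Lebesgue point \<open>x\<close>, the data minus \<open>g x\<close> is handled on
  two short arcs ending at \<open>x\<close> by the one-sided estimate. On the rest of the circle the
  kernel tends to 0 uniformly as \<open>w\<close> approaches \<open>cis x\<close>.\<close>

lemma poisson_integral_nt_limit:
  fixes g :: "real \<Rightarrow> complex"
  assumes g: "set_integrable lborel {0..2*pi} g"
  shows "\<exists>N. negligible N \<and> (\<forall>x\<in>{0<..<2*pi} - N. \<forall>M>0.
    ((\<lambda>w. integral {0..2*pi} (\<lambda>t. poisson_kernel w t *\<^sub>R g t) /\<^sub>R (2 * pi)) \<longlongrightarrow> g x)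
      (at (cis x) within stolz (cis x) M))"
proof -
  define G where "G t = indicator {0..2*pi} t *\<^sub>R g t" for t
  have Gi: "integrable lborel G" using g by (simp add: G_def[abs_def] set_integrable_def)
  have GS: "set_integrable lborel S G" if "S \<in> sets borel" for S
    using integrable_mult_indicator[of S lborel G] that Gi by (simp add: set_integrable_def)
  have GI: "G integrable_on {a..b}" for a b
    using set_borel_integral_eq_integral(1)[OF GS] by simp
  from lebesgue_points[of G, OF GI] obtain N where N: "negligible N" "\<forall>x e. x \<notin> N \<longrightarrow> 0 < e \<longrightarrow> (\<exists>d>0. \<forall>h. 0 \<le> h \<and> h < d \<longrightarrow>
      norm (integral {0..h} (\<lambda>s. G (x + s) - G x)) \<le> e * h \<and>
      norm (integral {0..h} (\<lambda>s. G (x - s) - G x)) \<le> e * h)"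
    by (elim exE conjE)
  have main: "((\<lambda>w. integral {0..2*pi} (\<lambda>t. poisson_kernel w t *\<^sub>R g t) /\<^sub>R (2 * pi)) \<longlongrightarrow> g x)
      (at (cis x) within stolz (cis x) M)"
    if x: "x \<in> {0<..<2*pi}" "x \<notin> N" and M: "M > 0" for x M
  proof -
    define g0 where "g0 t = G t - G x" for t
    have gx: "G x = g x" using x by (simp add: G_def)
    have g0S: "set_integrable lborel {a..b} g0" for a b
    proof -
      have "set_integrable lborel {a..b} (\<lambda>t. G t - G x)"
        by (intro set_integral_diff(1) GS borel_integrable_atLeastAtMost') auto
      thus ?thesis by (simp add: g0_def[abs_def])
    qed
    let ?I = "\<lambda>w. integral {0..2*pi} (\<lambda>t. poisson_kernel w t *\<^sub>R g0 t)"
    have Pg0: "set_integrable lborel {a..b} (\<lambda>t. poisson_kernel w t *\<^sub>R g0 t)" if "norm w < 1" for a b w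
      by (intro set_integrable_mult_continuous continuous_on_poisson_kernel that g0S)
    note Pg0I = set_borel_integral_eq_integral(1)[OF Pg0]
    have split: "integral {0..2*pi} (\<lambda>t. poisson_kernel w t *\<^sub>R g t) /\<^sub>R (2 * pi) - g x = ?I w /\<^sub>R (2 * pi)"
      if w: "norm w < 1" for w
    proof -
      have "((\<lambda>t. poisson_kernel w t *\<^sub>R g x) has_integral (2 * pi) *\<^sub>R g x) {0..2*pi}"
        by (rule has_integral_scaleR_left[OF poisson_kernel_has_integral[OF w]])
      from has_integral_add[OF integrable_integral[OF Pg0I[OF w]] this]
      have "((\<lambda>t. poisson_kernel w t *\<^sub>R g0 t + poisson_kernel w t *\<^sub>R g x) has_integral (?I w + (2 * pi) *\<^sub>R g x)) {0..2*pi}" .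
      hence "((\<lambda>t. poisson_kernel w t *\<^sub>R g t) has_integral (?I w + (2 * pi) *\<^sub>R g x)) {0..2*pi}"
      proof (rule has_integral_eq[rotated])
        fix t assume "t \<in> {0..2*pi}"
        hence "G t = g t" by (simp add: G_def)
        thus "poisson_kernel w t *\<^sub>R g0 t + poisson_kernel w t *\<^sub>R g x = poisson_kernel w t *\<^sub>R g t"
          by (simp add: g0_def gx scaleR_diff_right)
      qed
      hence "integral {0..2*pi} (\<lambda>t. poisson_kernel w t *\<^sub>R g t) = ?I w + (2 * pi) *\<^sub>R g x"
        by (rule integral_unique)
      thus ?thesis by (simp add: scaleR_add_right)
    qed
    have lim0: "(?I \<longlongrightarrow> 0) (at (cis x) within stolz (cis x) M)"
      unfolding tendsto_iff dist_norm
    proof (intro allI impI)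
      fix e :: real assume e: "e > 0"
      define K where "K = (1 + M) * (4 + 8 * pi)"
      have K: "K > 0" using M by (simp add: K_def add_pos_pos)
      \<comment> \<open>Each of the two near arcs contributes at most \<open>\<epsilon> * K\<close>,
        a quarter of \<open>e\<close>; each of the two far arcs will stay below another
        quarter.\<close>
      define \<epsilon> where "\<epsilon> = e / (4 * K)"
      have \<epsilon>: "\<epsilon> > 0" using e K by (simp add: \<epsilon>_def)
      from N(2)[rule_format, OF x(2) \<epsilon>] obtain d where d0: "d > 0" "\<forall>h. 0 \<le> h \<and> h < d \<longrightarrow>
        norm (integral {0..h} (\<lambda>s. G (x + s) - G x)) \<le> \<epsilon> * h \<and>
        norm (integral {0..h} (\<lambda>s. G (x - s) - G x)) \<le> \<epsilon> * h" by (elim exE conjE)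
      have d: "d > 0" "\<And>h. 0 \<le> h \<Longrightarrow> h < d \<Longrightarrow>
        norm (integral {0..h} (\<lambda>s. G (x + s) - G x)) \<le> \<epsilon> * h \<and>
        norm (integral {0..h} (\<lambda>s. G (x - s) - G x)) \<le> \<epsilon> * h" using d0 by simp_all
      \<comment> \<open>The bounds \<open>x\<close> and \<open>2 * pi - x\<close> keep both arcs
        inside the interval of integration, so that nothing wraps around at angle 0; the bound 1 is
        for the chord estimate.\<close>
      define \<delta> where "\<delta> = min (min (d/2) 1) (min x (2 * pi - x))"
      have \<delta>: "0 < \<delta>" "\<delta> < d" "\<delta> \<le> 1" "\<delta> \<le> x" "x + \<delta> \<le> 2 * pi" using d x by (auto simp: \<delta>_def)
      define S where "S = {0..x-\<delta>} \<union> {x+\<delta>..2*pi}"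
      have "compact S" by (auto simp: S_def)
      have contS: "continuous_on S (\<lambda>t. norm (cis t - cis x))" by (intro continuous_intros)
      obtain \<kappa> where \<kappa>: "\<kappa> > 0" "\<And>t. t \<in> S \<Longrightarrow> \<kappa> \<le> norm (cis t - cis x)"
      proof (cases "S = {}")
        case False
        then obtain t0 where t0: "t0 \<in> S" "\<And>t. t \<in> S \<Longrightarrow> norm (cis t0 - cis x) \<le> norm (cis t - cis x)"
          using continuous_attains_inf[OF \<open>compact S\<close> _ contS] by blast
        have "cis t0 \<noteq> cis x" by (rule cis_neq_cis) (use t0(1) x \<delta> in \<open>auto simp: S_def\<close>)
        thus ?thesis using that[of "norm (cis t0 - cis x)"] t0(2) by simp
      qed (use that[of 1] in auto)
      define B where "B = (LINT t:{0..2*pi}|lborel. norm (g0 t))"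
      have ng0: "set_integrable lborel {a..b} (\<lambda>t. norm (g0 t))" for a b by (intro set_integrable_norm g0S)
      have B0: "integral {0..2*pi} (\<lambda>t. norm (g0 t)) = B" unfolding B_def
        using set_borel_integral_eq_integral(2)[OF ng0] by simp
      have far: "norm (integral {a..b} (\<lambda>t. poisson_kernel w t *\<^sub>R g0 t)) \<le> (1 - (norm w)\<^sup>2) * (4 / \<kappa>\<^sup>2) * B"
        if ab: "{a..b} \<subseteq> S" and w: "norm w < 1" "norm (w - cis x) < \<kappa> / 2" for a b w
      proof -
        have w1: "0 \<le> 1 - (norm w)\<^sup>2" using w by (simp add: power_le_one)
        have "norm (integral {a..b} (\<lambda>t. poisson_kernel w t *\<^sub>R g0 t))
          \<le> integral {a..b} (\<lambda>t. (1 - (norm w)\<^sup>2) * (4 / \<kappa>\<^sup>2) * norm (g0 t))"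
        proof (rule integral_norm_bound_integral[OF Pg0I[OF w(1)]])
          show "(\<lambda>t. (1 - (norm w)\<^sup>2) * (4 / \<kappa>\<^sup>2) * norm (g0 t)) integrable_on {a..b}"
            using set_borel_integral_eq_integral(1)[OF ng0] by (rule integrable_on_mult_right)
          fix t assume t: "t \<in> {a..b}"
          have "\<kappa> \<le> norm (cis t - cis x)" using \<kappa>(2) t ab by auto
          also have "\<dots> \<le> norm (cis t - w) + norm (w - cis x)" using norm_triangle_ineq[of "cis t - w" "w - cis x"] by simp
          finally have "\<kappa> / 2 \<le> norm (cis t - w)" using w by linarith
          hence "(\<kappa> / 2)\<^sup>2 \<le> (norm (cis t - w))\<^sup>2" using \<kappa> by (intro power_mono) auto
          hence "poisson_kernel w t \<le> (1 - (norm w)\<^sup>2) / (\<kappa> / 2)\<^sup>2"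
            unfolding poisson_kernel_def using w1 \<kappa> by (intro divide_left_mono mult_pos_pos) (auto simp: cis_neq_disk[OF w(1)])
          also have "\<dots> = (1 - (norm w)\<^sup>2) * (4 / \<kappa>\<^sup>2)" by (simp add: power_divide)
          finally have le: "poisson_kernel w t \<le> (1 - (norm w)\<^sup>2) * (4 / \<kappa>\<^sup>2)" .
          show "norm (poisson_kernel w t *\<^sub>R g0 t) \<le> (1 - (norm w)\<^sup>2) * (4 / \<kappa>\<^sup>2) * norm (g0 t)"
          proof -
            have "norm (poisson_kernel w t *\<^sub>R g0 t) = poisson_kernel w t * norm (g0 t)"
              using poisson_kernel_nonneg[OF w(1), of t] by simp
            also have "\<dots> \<le> (1 - (norm w)\<^sup>2) * (4 / \<kappa>\<^sup>2) * norm (g0 t)"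
              by (rule mult_right_mono[OF le]) simp
            finally show ?thesis .
          qed
        qed
        also have "\<dots> = (1 - (norm w)\<^sup>2) * (4 / \<kappa>\<^sup>2) * integral {a..b} (\<lambda>t. norm (g0 t))" by (rule integral_mult_right)
        also have "\<dots> \<le> (1 - (norm w)\<^sup>2) * (4 / \<kappa>\<^sup>2) * B"
        proof (intro mult_left_mono)
          have "integral {a..b} (\<lambda>t. norm (g0 t)) \<le> integral {0..2*pi} (\<lambda>t. norm (g0 t))"
          proof (rule integral_subset_le)
            show "{a..b} \<subseteq> {0..2*pi}" using ab \<delta> x by (force simp: S_def)
          qed (use set_borel_integral_eq_integral(1)[OF ng0] in auto)
          thus "integral {a..b} (\<lambda>t. norm (g0 t)) \<le> B" by (simp add: B0)
        qed (use w1 in auto)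
        finally show ?thesis .
      qed
      have right: "norm (integral {x..x+\<delta>} (\<lambda>t. poisson_kernel w t *\<^sub>R g0 t)) \<le> \<epsilon> * K"
        if w: "w \<in> stolz (cis x) M" for w
      proof -
        have w1: "norm w < 1" using w by (simp add: stolz_def)
        have 1: "((\<lambda>t. poisson_kernel w t *\<^sub>R g0 t) has_integral integral {x..x+\<delta>} (\<lambda>t. poisson_kernel w t *\<^sub>R g0 t)) {x..x+\<delta>}"
          by (rule integrable_integral[OF Pg0I[OF w1]])
        have "((\<lambda>s. poisson_kernel w (x + s) *\<^sub>R g0 (x + s)) has_integral integral {x..x+\<delta>} (\<lambda>t. poisson_kernel w t *\<^sub>R g0 t)) {0..\<delta>}"
          using has_integral_affinity[OF 1[unfolded interval_cbox], of 1 x] by (simp add: add.commute)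
        hence "integral {x..x+\<delta>} (\<lambda>t. poisson_kernel w t *\<^sub>R g0 t) = integral {0..\<delta>} (\<lambda>s. poisson_kernel (cis (- x) * w) s *\<^sub>R g0 (x + s))"
          by (simp add: integral_unique poisson_kernel_rotate)
        also have "norm \<dots> \<le> \<epsilon> * K" unfolding K_def
        proof (rule poisson_kernel_one_sided[OF \<delta>(1) \<delta>(3) M _ _ stolz_rotate(1)[OF w]])
          have "integrable lborel (\<lambda>s. indicator {x..x+\<delta>} (x + 1 * s) *\<^sub>R g0 (x + 1 * s))"
            using g0S[of x "x + \<delta>"] by (intro lborel_integrable_real_affine) (auto simp: set_integrable_def)
          thus "set_integrable lborel {0..\<delta>} (\<lambda>s. g0 (x + s))"
            unfolding set_integrable_def by (rule back_subst[of "integrable lborel"]) (auto simp: indicator_def)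
          show "norm (integral {0..s} (\<lambda>s. g0 (x + s))) \<le> \<epsilon> * s" if "s \<in> {0..\<delta>}" for s
            using d(2)[of s] that \<delta> by (simp add: g0_def)
        qed
        finally show ?thesis .
      qed
      have left: "norm (integral {x-\<delta>..x} (\<lambda>t. poisson_kernel w t *\<^sub>R g0 t)) \<le> \<epsilon> * K"
        if w: "w \<in> stolz (cis x) M" for w
      proof -
        have w1: "norm w < 1" using w by (simp add: stolz_def)
        have 1: "((\<lambda>t. poisson_kernel w t *\<^sub>R g0 t) has_integral integral {x-\<delta>..x} (\<lambda>t. poisson_kernel w t *\<^sub>R g0 t)) {x-\<delta>..x}"
          by (rule integrable_integral[OF Pg0I[OF w1]])
        have "((\<lambda>s. poisson_kernel w (x - s) *\<^sub>R g0 (x - s)) has_integral integral {x-\<delta>..x} (\<lambda>t. poisson_kernel w t *\<^sub>R g0 t)) {0..\<delta>}"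
          using has_integral_affinity[OF 1[unfolded interval_cbox], of "-1" x] by simp
        hence "integral {x-\<delta>..x} (\<lambda>t. poisson_kernel w t *\<^sub>R g0 t) = integral {0..\<delta>} (\<lambda>s. poisson_kernel (cnj (cis (- x) * w)) s *\<^sub>R g0 (x - s))"
          by (simp only: integral_unique poisson_kernel_rotate)
        also have "norm \<dots> \<le> \<epsilon> * K" unfolding K_def
        proof (rule poisson_kernel_one_sided[OF \<delta>(1) \<delta>(3) M _ _ stolz_rotate(2)[OF w]])
          have "integrable lborel (\<lambda>s. indicator {x-\<delta>..x} (x + (-1) * s) *\<^sub>R g0 (x + (-1) * s))"
            using g0S[of "x - \<delta>" x] by (intro lborel_integrable_real_affine) (auto simp: set_integrable_def)
          thus "set_integrable lborel {0..\<delta>} (\<lambda>s. g0 (x - s))"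
            unfolding set_integrable_def by (rule back_subst[of "integrable lborel"]) (auto simp: indicator_def)
          show "norm (integral {0..s} (\<lambda>s. g0 (x - s))) \<le> \<epsilon> * s" if "s \<in> {0..\<delta>}" for s
            using d(2)[of s] that \<delta> by (simp add: g0_def)
        qed
        finally show ?thesis .
      qed
      define h where "h w = (1 - (norm w)\<^sup>2) * (4 / \<kappa>\<^sup>2) * B" for w :: complex
      have "(h \<longlongrightarrow> (1 - (norm (cis x))\<^sup>2) * (4 / \<kappa>\<^sup>2) * B) (at (cis x) within stolz (cis x) M)"
        unfolding h_def by (intro tendsto_intros)
      hence h0: "(h \<longlongrightarrow> 0) (at (cis x) within stolz (cis x) M)" by simp
      have ev1: "\<forall>\<^sub>F w in at (cis x) within stolz (cis x) M. norm (h w) < e / 4"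
        using h0[unfolded tendsto_iff dist_norm, rule_format, of "e/4"] e by simp
      have ev2: "\<forall>\<^sub>F w in at (cis x) within stolz (cis x) M. norm (w - cis x) < \<kappa> / 2"
        using \<kappa> unfolding eventually_at by (intro exI[of _ "\<kappa>/2"]) (auto simp: dist_norm)
      have ev3: "\<forall>\<^sub>F w in at (cis x) within stolz (cis x) M. w \<in> stolz (cis x) M"
        by (simp add: eventually_at_filter)
      show "\<forall>\<^sub>F w in at (cis x) within stolz (cis x) M. norm (?I w - 0) < e"
        using ev1 ev2 ev3
      proof eventually_elim
        case (elim w)
        have w1: "norm w < 1" using elim by (simp add: stolz_def)
        let ?q = "\<lambda>t. poisson_kernel w t *\<^sub>R g0 t"
        have i1: "integral {0..x-\<delta>} ?q + integral {x-\<delta>..2*pi} ?q = ?I w"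
          by (rule Henstock_Kurzweil_Integration.integral_combine) (use \<delta> x Pg0I[OF w1] in auto)
        have i2: "integral {x-\<delta>..x} ?q + integral {x..2*pi} ?q = integral {x-\<delta>..2*pi} ?q"
          by (rule Henstock_Kurzweil_Integration.integral_combine) (use \<delta> x Pg0I[OF w1] in auto)
        have i3: "integral {x..x+\<delta>} ?q + integral {x+\<delta>..2*pi} ?q = integral {x..2*pi} ?q"
          by (rule Henstock_Kurzweil_Integration.integral_combine) (use \<delta> x Pg0I[OF w1] in auto)
        have "integral {0..x-\<delta>} ?q + (integral {x-\<delta>..x} ?q + (integral {x..x+\<delta>} ?q + integral {x+\<delta>..2*pi} ?q)) = ?I w"
          by (simp only: i3 i2 i1)
        hence e4: "(integral {0..x-\<delta>} ?q + integral {x-\<delta>..x} ?q) + (integral {x..x+\<delta>} ?q + integral {x+\<delta>..2*pi} ?q) = ?I w"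
          by (simp only: add.assoc)
        have tri: "norm ((a + b) + (c + d)) \<le> (norm a + norm b) + (norm c + norm d)" for a b c d :: complex
          by (rule order_trans[OF norm_triangle_ineq add_mono[OF norm_triangle_ineq norm_triangle_ineq]])
        have "norm (?I w) \<le> (norm (integral {0..x-\<delta>} ?q) + norm (integral {x-\<delta>..x} ?q)) + (norm (integral {x..x+\<delta>} ?q) + norm (integral {x+\<delta>..2*pi} ?q))"
          using tri[of "integral {0..x-\<delta>} ?q" "integral {x-\<delta>..x} ?q" "integral {x..x+\<delta>} ?q" "integral {x+\<delta>..2*pi} ?q"]
          by (simp only: e4)
        also have "\<dots> \<le> (h w + \<epsilon> * K) + (\<epsilon> * K + h w)"
          unfolding h_def by (rule add_mono[OF add_mono[OF far left] add_mono[OF right far]]) (use elim w1 in \<open>auto simp: S_def\<close>)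
        also have "\<epsilon> * K = e / 4" using K by (simp add: \<epsilon>_def)
        also have "(h w + e / 4) + (e / 4 + h w) < e" using elim(1) by simp
        finally show ?case by simp
      qed
    qed
    have "((\<lambda>w. ?I w /\<^sub>R (2 * pi) + g x) \<longlongrightarrow> 0 /\<^sub>R (2 * pi) + g x) (at (cis x) within stolz (cis x) M)"
      by (intro tendsto_intros lim0)
    hence lim1: "((\<lambda>w. ?I w /\<^sub>R (2 * pi) + g x) \<longlongrightarrow> g x) (at (cis x) within stolz (cis x) M)"
      by simp
    show ?thesis
    proof (rule Lim_transform_eventually[OF lim1])
      have "\<forall>\<^sub>F w in at (cis x) within stolz (cis x) M. w \<in> stolz (cis x) M"
        by (simp add: eventually_at_filter)
      thus "\<forall>\<^sub>F w in at (cis x) within stolz (cis x) M. ?I w /\<^sub>R (2 * pi) + g x = integral {0..2*pi} (\<lambda>t. poisson_kernel w t *\<^sub>R g t) /\<^sub>R (2 * pi)"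
      proof eventually_elim
        case (elim w)
        hence "norm w < 1" by (simp add: stolz_def)
        from split[OF this] show ?case by (simp only: eq_diff_eq[symmetric])
      qed
    qed
  qed
  show ?thesis
  proof (intro exI[of _ N] conjI ballI allI impI N(1))
    fix x M :: real assume "x \<in> {0<..<2*pi} - N" "0 < M"
    thus "((\<lambda>w. integral {0..2*pi} (\<lambda>t. poisson_kernel w t *\<^sub>R g t) /\<^sub>R (2 * pi)) \<longlongrightarrow> g x)
      (at (cis x) within stolz (cis x) M)" using main[of x M] by blast
  qed
qed

section \<open>Nontangential limits of outer functions\<close>

lemma has_integral_cis_power:
  "((\<lambda>t. cis (real_of_int k * t)) has_integral (if k = 0 then of_real (2*pi) else 0)) {0..2*pi}"
proof (cases "k = 0")
  case True
  have "((\<lambda>t. 1::complex) has_integral (2*pi - 0) *\<^sub>R 1) {0..2*pi}" by (rule has_integral_const_real[THEN back_subst[where P="\<lambda>z. (_ has_integral z) _"]]) simp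
  thus ?thesis using True by (simp add: scaleR_conv_of_real)
next
  case False
  have "((\<lambda>t. cis (real_of_int k * t)) has_integral
      (cis (real_of_int k * (2*pi)) / (\<i> * of_int k) - cis (real_of_int k * 0) / (\<i> * of_int k))) {0..2*pi}"
  proof (rule fundamental_theorem_of_calculus)
    fix t :: real
    have "((\<lambda>z. exp (\<i> * of_int k * z) / (\<i> * of_int k)) has_field_derivative exp (\<i> * of_int k * of_real t)) (at (of_real t))"
      using False by (auto intro!: derivative_eq_intros)
    hence "((\<lambda>t. exp (\<i> * of_int k * of_real t) / (\<i> * of_int k)) has_vector_derivative exp (\<i> * of_int k * of_real t)) (at t within {0..2*pi})"
      by (rule has_vector_derivative_real_field)
    thus "((\<lambda>t. cis (real_of_int k * t) / (\<i> * of_int k)) has_vector_derivative cis (real_of_int k * t)) (at t within {0..2*pi})"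
      by (simp add: cis_conv_exp mult.assoc)
  qed auto
  moreover have "cis (real_of_int k * (2*pi)) = 1"
    using cis_multiple_2pi[of "real_of_int k"] by (simp add: mult_ac)
  ultimately show ?thesis using False by simp
qed

lemma parseval_finite:
  fixes b :: "nat \<Rightarrow> complex"
  shows "((\<lambda>t. (norm (\<Sum>n<N. b n * cis (real n * t)))\<^sup>2) has_integral (2 * pi * (\<Sum>n<N. (norm (b n))\<^sup>2))) {0..2*pi}"
proof -
  have eq: "complex_of_real ((norm (\<Sum>n<N. b n * cis (real n * t)))\<^sup>2) = (\<Sum>n<N. \<Sum>m<N. b n * cnj (b m) * cis (real_of_int (int n - int m) * t))" for t
  proof -
    have "complex_of_real ((norm (\<Sum>n<N. b n * cis (real n * t)))\<^sup>2) = (\<Sum>n<N. b n * cis (real n * t)) * cnj (\<Sum>n<N. b n * cis (real n * t))"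
      by (rule complex_norm_square)
    also have "\<dots> = (\<Sum>n<N. \<Sum>m<N. (b n * cis (real n * t)) * (cnj (b m) * cis (- (real m * t))))"
      by (simp add: cnj_sum sum_product cis_cnj)
    also have "\<dots> = (\<Sum>n<N. \<Sum>m<N. b n * cnj (b m) * cis (real_of_int (int n - int m) * t))"
    proof (intro sum.cong refl)
      fix n m
      have "cis (real n * t) * cis (- (real m * t)) = cis (real_of_int (int n - int m) * t)"
        by (simp add: cis_mult left_diff_distrib)
      thus "(b n * cis (real n * t)) * (cnj (b m) * cis (- (real m * t))) = b n * cnj (b m) * cis (real_of_int (int n - int m) * t)"
        by (simp only: mult.assoc mult.left_commute)
    qed
    finally show ?thesis .
  qed
  have "((\<lambda>t. \<Sum>n<N. \<Sum>m<N. b n * cnj (b m) * cis (real_of_int (int n - int m) * t)) has_integral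
     (\<Sum>n<N. \<Sum>m<N. b n * cnj (b m) * (if int n - int m = 0 then of_real (2*pi) else 0))) {0..2*pi}"
    by (intro has_integral_sum has_integral_mult_right has_integral_cis_power) auto
  also have "(\<Sum>n<N. \<Sum>m<N. b n * cnj (b m) * (if int n - int m = 0 then of_real (2*pi) else 0))
     = (\<Sum>n<N. of_real (2 * pi * (norm (b n))\<^sup>2))"
  proof (rule sum.cong[OF refl])
    fix n assume n: "n \<in> {..<N}"
    have "(\<Sum>m<N. b n * cnj (b m) * (if int n - int m = 0 then of_real (2*pi) else 0))
      = (\<Sum>m<N. if m = n then b n * cnj (b n) * of_real (2*pi) else 0)"
      by (rule sum.cong) auto
    also have "\<dots> = b n * cnj (b n) * of_real (2*pi)" using n by simp
    also have "\<dots> = of_real (2 * pi * (norm (b n))\<^sup>2)"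
      by (simp only: complex_norm_square[symmetric] of_real_mult) (simp add: mult_ac)
    finally show "(\<Sum>m<N. b n * cnj (b m) * (if int n - int m = 0 then of_real (2*pi) else 0)) = of_real (2 * pi * (norm (b n))\<^sup>2)" .
  qed
  finally have "((\<lambda>t. complex_of_real ((norm (\<Sum>n<N. b n * cis (real n * t)))\<^sup>2)) has_integral (\<Sum>n<N. of_real (2 * pi * (norm (b n))\<^sup>2))) {0..2*pi}"
    by (simp only: eq)
  from has_integral_Re[OF this] show ?thesis by (simp add: sum_distrib_left)
qed

text \<open>The identity is needed only on circles of radius below 1, where the power series
  converges absolutely; that provides the constant dominating the partial sums.\<close>

lemma parseval:
  fixes b :: "nat \<Rightarrow> complex"
  assumes b: "summable (\<lambda>n. norm (b n))"
  shows "((\<lambda>t. (norm (\<Sum>n. b n * cis (real n * t)))\<^sup>2) has_integral (2 * pi * (\<Sum>n. (norm (b n))\<^sup>2))) {0..2*pi}"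
    and "summable (\<lambda>n. (norm (b n))\<^sup>2)"
proof -
  define h where "h N t = (\<Sum>n<N. b n * cis (real n * t))" for N t
  define H where "H t = (\<Sum>n. b n * cis (real n * t))" for t
  define C where "C = (\<Sum>n. norm (b n))"
  have ul: "uniform_limit {0..2*pi} h H sequentially" unfolding h_def H_def
    by (rule Weierstrass_m_test[OF _ b]) (simp add: norm_mult)
  have hb: "norm (h N t) \<le> C" for N t
  proof -
    have "norm (h N t) \<le> (\<Sum>n<N. norm (b n))" unfolding h_def
      by (rule order_trans[OF norm_sum]) (simp add: norm_mult)
    also have "\<dots> \<le> C" unfolding C_def by (rule sum_le_suminf[OF b]) auto
    finally show ?thesis .
  qed
  have ch: "continuous_on {0..2*pi} (h N)" for N unfolding h_def by (intro continuous_intros)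
  have lim: "(\<lambda>N. h N t) \<longlonglongrightarrow> H t" if "t \<in> {0..2*pi}" for t
    by (rule tendsto_uniform_limitI[OF ul that])
  have int: "((\<lambda>t. (norm (h N t))\<^sup>2) has_integral (2 * pi * (\<Sum>n<N. (norm (b n))\<^sup>2))) {0..2*pi}" for N
    unfolding h_def by (rule parseval_finite)
  have dom: "norm ((norm (h N t))\<^sup>2) \<le> C\<^sup>2" for N t
    using power_mono[OF hb norm_ge_zero, of N t 2] by simp
  have lim2: "(\<lambda>N. (norm (h N t))\<^sup>2) \<longlonglongrightarrow> (norm (H t))\<^sup>2" if "t \<in> {0..2*pi}" for t
    by (intro tendsto_intros lim that)
  note dc = dominated_convergence[of "\<lambda>N t. (norm (h N t))\<^sup>2", OF has_integral_integrable[OF int] integrable_const_ivl dom lim2]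
  have "(\<lambda>N. 2 * pi * (\<Sum>n<N. (norm (b n))\<^sup>2)) \<longlonglongrightarrow> integral {0..2*pi} (\<lambda>t. (norm (H t))\<^sup>2)"
    using dc(2) integral_unique[OF int] by simp
  hence "(\<lambda>N. 2 * pi * (\<Sum>n<N. (norm (b n))\<^sup>2) / (2 * pi)) \<longlonglongrightarrow> integral {0..2*pi} (\<lambda>t. (norm (H t))\<^sup>2) / (2 * pi)"
    by (intro tendsto_intros) auto
  hence s: "(\<lambda>n. (norm (b n))\<^sup>2) sums (integral {0..2*pi} (\<lambda>t. (norm (H t))\<^sup>2) / (2 * pi))"
    by (simp add: sums_def)
  thus "summable (\<lambda>n. (norm (b n))\<^sup>2)" by (rule sums_summable)
  have "integral {0..2*pi} (\<lambda>t. (norm (H t))\<^sup>2) = 2 * pi * (\<Sum>n. (norm (b n))\<^sup>2)"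
    using sums_unique[OF s] by (simp add: field_simps)
  thus "((\<lambda>t. (norm (\<Sum>n. b n * cis (real n * t)))\<^sup>2) has_integral (2 * pi * (\<Sum>n. (norm (b n))\<^sup>2))) {0..2*pi}"
    using integrable_integral[OF dc(1)] by (simp add: H_def)
qed

text \<open>For radii tending to 1 fast enough, the dilates of a bounded holomorphic function form a fast
  \<open>L\<^sup>2\<close> Cauchy sequence on the circle, and hence converge almost everywhere.\<close>
lemma bounded_holomorphic_radial_limit:
  assumes f: "f holomorphic_on ball 0 1" and fB: "\<forall>w\<in>ball 0 1. norm (f w) \<le> B"
  shows "\<exists>r. (\<forall>k::nat. 0 < r k \<and> r k < 1) \<and> r \<longlonglongrightarrow> 1 \<and>
    (AE t in lborel. t \<in> {0..2*pi} \<longrightarrow> convergent (\<lambda>k. f (of_real (r k) * cis t)))"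
proof -
  have B: "norm (f w) \<le> B" if "norm w < 1" for w using fB that by simp
  define a where "a n = (deriv ^^ n) f 0 / fact n" for n
  have pow: "(\<lambda>n. a n * w ^ n) sums f w" if "norm w < 1" for w
    using holomorphic_power_series[OF f, of w] that by (simp add: a_def)
  have sa: "summable (\<lambda>n. norm (a n) * r ^ n)" if "0 \<le> r" "r < 1" for r
  proof -
    define x where "x = (1 + r) / 2"
    have x: "0 \<le> x" "x < 1" "r < x" using that by (auto simp: x_def)
    have "summable (\<lambda>n. a n * of_real x ^ n)"
      by (intro sums_summable[OF pow]) (use x in simp)
    from powser_insidea[OF this, of "of_real r"] show ?thesis using that x
      by (simp add: norm_mult norm_power)
  qed
  have cisp: "(of_real r * cis t) ^ n = of_real (r ^ n) * cis (real n * t)" for r t n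
    by (simp only: power_mult_distrib Complex.DeMoivre of_real_power)
  have fr: "f (of_real r * cis t) = (\<Sum>n. (a n * of_real (r ^ n)) * cis (real n * t))" if "0 \<le> r" "r < 1" for r t
    using sums_unique[OF pow[of "of_real r * cis t"]] that by (simp add: norm_mult cisp mult.assoc)
  define I where "I r = (\<Sum>n. (norm (a n * of_real (r ^ n)))\<^sup>2)" for r
  have sr: "summable (\<lambda>n. norm (a n * of_real (r ^ n)))" if "0 \<le> r" "r < 1" for r
    using sa[OF that] that by (simp add: norm_mult norm_power)
  have sc: "summable (\<lambda>n. b n * cis (real n * t))" if "summable (\<lambda>n. norm (b n))" for b :: "nat \<Rightarrow> complex" and t
    by (rule summable_norm_cancel) (use that in \<open>simp add: norm_mult\<close>)
  have Iint: "((\<lambda>t. (norm (f (of_real r * cis t)))\<^sup>2) has_integral (2 * pi * I r)) {0..2*pi}" if "0 \<le> r" "r < 1" for r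
    using parseval(1)[OF sr[OF that]] by (simp only: fr[OF that] I_def)
  have B0: "0 \<le> B" using order_trans[OF norm_ge_zero B[of 0]] by simp
  have IB: "I r \<le> B\<^sup>2" if r: "0 \<le> r" "r < 1" for r
  proof -
    have "((\<lambda>t. B\<^sup>2) has_integral (B\<^sup>2 * (2*pi))) {0..2*pi}"
      using has_integral_const_real[of "B\<^sup>2" 0 "2*pi"] by (simp add: mult_ac)
    have "2 * pi * I r \<le> B\<^sup>2 * (2*pi)"
      by (rule has_integral_le[OF Iint[OF r] \<open>((\<lambda>t. B\<^sup>2) has_integral (B\<^sup>2 * (2*pi))) {0..2*pi}\<close>])
         (use B r in \<open>auto intro!: power_mono simp: norm_mult\<close>)
    thus ?thesis by simp
  qed
  have diff: "((\<lambda>t. (norm (f (of_real s * cis t) - f (of_real r * cis t)))\<^sup>2) has_integral (2 * pi * (\<Sum>n. (norm (a n * of_real (s ^ n - r ^ n)))\<^sup>2))) {0..2*pi}"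
    and diffle: "(\<Sum>n. (norm (a n * of_real (s ^ n - r ^ n)))\<^sup>2) \<le> I s - I r"
    if r: "0 \<le> r" "r \<le> s" "s < 1" for r s
  proof -
    have s: "0 \<le> s" "s < 1" and r1: "r < 1" using r by auto
    have le: "0 \<le> s ^ n - r ^ n" "r ^ n \<le> s ^ n" "0 \<le> r ^ n" for n using power_mono[of r s n] r by auto
    have sd: "summable (\<lambda>n. norm (a n * of_real (s ^ n - r ^ n)))"
    proof (rule summable_comparison_test'[OF sr[OF s]])
      show "norm (norm (a n * of_real (s ^ n - r ^ n))) \<le> norm (a n * of_real (s ^ n))" for n
        using le[of n] by (simp add: norm_mult mult_left_mono abs_of_nonneg del: of_real_power of_real_diff)
    qed
    have "f (of_real s * cis t) - f (of_real r * cis t) = (\<Sum>n. (a n * of_real (s ^ n - r ^ n)) * cis (real n * t))" for t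
    proof -
      have "summable (\<lambda>n. (a n * of_real (s ^ n)) * cis (real n * t))" "summable (\<lambda>n. (a n * of_real (r ^ n)) * cis (real n * t))"
        by (rule sc[OF sr[OF s]] sc[OF sr[OF r(1) r1]])+
      from suminf_diff[OF this] show ?thesis unfolding fr[OF s] fr[OF r(1) r1]
        by (simp add: algebra_simps)
    qed
    thus "((\<lambda>t. (norm (f (of_real s * cis t) - f (of_real r * cis t)))\<^sup>2) has_integral (2 * pi * (\<Sum>n. (norm (a n * of_real (s ^ n - r ^ n)))\<^sup>2))) {0..2*pi}"
      using parseval(1)[OF sd] by (simp only:)
    have s1: "summable (\<lambda>n. (norm (a n * of_real (s ^ n)))\<^sup>2)" "summable (\<lambda>n. (norm (a n * of_real (r ^ n)))\<^sup>2)"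
      by (rule parseval(2)[OF sr[OF s]] parseval(2)[OF sr[OF r(1) r1]])+
    have "(\<Sum>n. (norm (a n * of_real (s ^ n - r ^ n)))\<^sup>2) \<le> (\<Sum>n. (norm (a n * of_real (s ^ n)))\<^sup>2 - (norm (a n * of_real (r ^ n)))\<^sup>2)"
    proof (rule suminf_le[OF _ parseval(2)[OF sd] summable_diff[OF s1]])
      fix n
      \<comment> \<open>Termwise form of the fact that the squared distance of two dilates is at
        most the difference of their squared norms. Bounded increasing norms thus give a Cauchy
        sequence.\<close>
      have "(s ^ n - r ^ n)\<^sup>2 \<le> (s ^ n)\<^sup>2 - (r ^ n)\<^sup>2"
      proof -
        have "(s ^ n)\<^sup>2 - (r ^ n)\<^sup>2 - (s ^ n - r ^ n)\<^sup>2 = 2 * (r ^ n) * (s ^ n - r ^ n)"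
          by (simp add: power2_eq_square algebra_simps)
        moreover have "0 \<le> 2 * (r ^ n) * (s ^ n - r ^ n)" using le[of n] by simp
        ultimately show ?thesis by linarith
      qed
      from mult_left_mono[OF this, of "(norm (a n))\<^sup>2"]
      show "(norm (a n * of_real (s ^ n - r ^ n)))\<^sup>2 \<le> (norm (a n * of_real (s ^ n)))\<^sup>2 - (norm (a n * of_real (r ^ n)))\<^sup>2"
        by (simp only: norm_mult norm_of_real power_mult_distrib power2_abs right_diff_distrib) simp
    qed
    also have "\<dots> = I s - I r" unfolding I_def by (rule suminf_diff[OF s1, symmetric])
    finally show "(\<Sum>n. (norm (a n * of_real (s ^ n - r ^ n)))\<^sup>2) \<le> I s - I r" .
  qed
  have diff_nonneg: "0 \<le> (\<Sum>n. (norm (a n * of_real (s ^ n - r ^ n)))\<^sup>2)" if r: "0 \<le> r" "r \<le> s" "s < 1" for r s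
    by (rule mult_left_le_imp_le[of "2*pi"]) (use has_integral_nonneg[OF diff[OF that]] in auto)
  have Imono: "I r \<le> I s" if r: "0 \<le> r" "r \<le> s" "s < 1" for r s
    using diff_nonneg[OF that] diffle[OF that] by linarith
  define \<rho> where "\<rho> k = 1 - 1 / (real k + 2)" for k :: nat
  have \<rho>: "0 < \<rho> k" "\<rho> k < 1" for k by (auto simp: \<rho>_def field_simps)
  have \<rho>mono: "\<rho> i \<le> \<rho> j" if "i \<le> j" for i j using that by (simp add: \<rho>_def frac_le)
  have "incseq (\<lambda>k. I (\<rho> k))" by (intro incseq_SucI Imono \<rho>mono less_imp_le[OF \<rho>(1)] \<rho>(2)) simp
  moreover have "I (\<rho> k) \<le> B\<^sup>2" for k using IB[of "\<rho> k"] \<rho>[of k] by simp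
  ultimately obtain J where J: "(\<lambda>k. I (\<rho> k)) \<longlonglongrightarrow> J" "\<And>k. I (\<rho> k) \<le> J"
    using incseq_convergent by blast
  \<comment> \<open>Squared distances of order \<open>(1/4) ^ k\<close> become distances of order
    \<open>(1/2) ^ k\<close>, which are summable. The clause \<open>k \<le> i\<close> forces the
    radii to tend to 1.\<close>
  have "\<exists>i. J - I (\<rho> i) \<le> (1/4) ^ k \<and> k \<le> i" for k
  proof -
    have "\<forall>\<^sub>F i in sequentially. J - (1/4) ^ k < I (\<rho> i)"
      by (rule order_tendstoD(1)[OF J(1)]) simp
    hence "\<forall>\<^sub>F i in sequentially. J - (1/4) ^ k < I (\<rho> i) \<and> k \<le> i"
      by (intro eventually_conj eventually_ge_at_top)
    from eventually_happens'[OF sequentially_bot this]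
    obtain i where "J - (1/4) ^ k < I (\<rho> i)" "k \<le> i" by (elim exE conjE)
    thus ?thesis by (intro exI[of _ i]) auto
  qed
  hence "\<exists>\<tau>. \<forall>k. J - I (\<rho> (\<tau> k)) \<le> (1/4) ^ k \<and> k \<le> \<tau> k" by (intro choice allI)
  then obtain \<tau> where \<tau>0: "\<forall>k. J - I (\<rho> (\<tau> k)) \<le> (1/4) ^ k \<and> k \<le> \<tau> k" by (elim exE)
  have \<tau>: "\<And>k. J - I (\<rho> (\<tau> k)) \<le> (1/4) ^ k" "\<And>k. k \<le> \<tau> k" using \<tau>0 by simp_all
  \<comment> \<open>Running maxima make the radii monotone without losing the bound, since
    \<open>I\<close> is increasing.\<close>
  define \<sigma> where "\<sigma> k = Max (\<tau> ` {..k})" for k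
  have \<sigma>1: "\<tau> k \<le> \<sigma> k" for k by (simp add: \<sigma>_def)
  have \<sigma>mono: "\<sigma> k \<le> \<sigma> (Suc k)" for k unfolding \<sigma>_def by (rule Max_mono) auto
  define r where "r k = \<rho> (\<sigma> k)" for k
  have r: "0 < r k" "r k < 1" for k by (auto simp: r_def \<rho>)
  have rmono: "r k \<le> r (Suc k)" for k unfolding r_def by (rule \<rho>mono[OF \<sigma>mono])
  have Ir: "J - I (r k) \<le> (1/4) ^ k" for k
  proof -
    have "I (\<rho> (\<tau> k)) \<le> I (r k)" unfolding r_def
      by (intro Imono \<rho>mono \<sigma>1 less_imp_le[OF \<rho>(1)] \<rho>(2))
    thus ?thesis using \<tau>(1)[of k] by linarith
  qed
  have rlim: "r \<longlonglongrightarrow> 1"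
  proof (rule tendsto_sandwich[of \<rho> r _ "\<lambda>_. 1"])
    show "\<forall>\<^sub>F n in sequentially. \<rho> n \<le> r n"
      unfolding r_def using \<rho>mono order_trans[OF \<tau>(2) \<sigma>1] by auto
    show "\<forall>\<^sub>F n in sequentially. r n \<le> 1" using r by (auto simp: less_imp_le)
    have "(\<lambda>k. 1 - 1 / real (k + 2)) \<longlonglongrightarrow> 1 - 0"
      by (intro tendsto_diff tendsto_const LIMSEQ_ignore_initial_segment[OF lim_1_over_n])
    thus "\<rho> \<longlonglongrightarrow> 1" by (simp add: \<rho>_def[abs_def] add.commute)
  qed simp
  define q where "q k t = f (of_real (r k) * cis t)" for k t
  have inball: "of_real (r k) * cis t \<in> ball 0 1" for k t using r[of k] by (simp add: norm_mult)
  have cq: "continuous_on UNIV (q k)" for k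
    unfolding q_def by (rule continuous_on_compose2[OF holomorphic_on_imp_continuous_on[OF f]])
      (use inball in \<open>auto intro!: continuous_intros\<close>)
  have L1: "integral {0..2*pi} (\<lambda>t. norm (q (Suc k) t - q k t)) \<le> (1/2)^k * (2 * pi)" for k
  proof -
    define \<epsilon> :: real where "\<epsilon> = (1/2)^k"
    have \<epsilon>: "\<epsilon> > 0" by (simp add: \<epsilon>_def)
    have rr: "0 \<le> r k" "r k \<le> r (Suc k)" "r (Suc k) < 1" using r[of k] r[of "Suc k"] rmono[of k] by auto
    have i2: "((\<lambda>t. (norm (q (Suc k) t - q k t))\<^sup>2) has_integral (2 * pi * (\<Sum>n. (norm (a n * of_real (r (Suc k) ^ n - r k ^ n)))\<^sup>2))) {0..2*pi}"
      using diff[OF rr] by (simp add: q_def)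
    have "(\<Sum>n. (norm (a n * of_real (r (Suc k) ^ n - r k ^ n)))\<^sup>2) \<le> (1/4)^k"
      using diffle[OF rr] Ir[of k] J(2)[of "\<sigma> (Suc k)"] by (simp add: r_def)
    also have "(1/4 :: real)^k = \<epsilon>\<^sup>2" 
    proof -
      have "\<epsilon>\<^sup>2 = (1/2 * (1/2))^k" by (simp only: \<epsilon>_def power2_eq_square power_mult_distrib)
      thus ?thesis by simp
    qed
    finally have sle: "(\<Sum>n. (norm (a n * of_real (r (Suc k) ^ n - r k ^ n)))\<^sup>2) \<le> \<epsilon>\<^sup>2" .
    \<comment> \<open>Instead of Cauchy-Schwarz:
      \<open>x \<le> \<epsilon> / 2 + x\<^sup>2 / (2 * \<epsilon>)\<close>, integrated with
      \<open>\<epsilon> = (1/2) ^ k\<close>.\<close>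
    have i3: "((\<lambda>t. \<epsilon> / 2 + (1 / (2 * \<epsilon>)) * (norm (q (Suc k) t - q k t))\<^sup>2) has_integral
       ((2*pi) * (\<epsilon> / 2) + (1 / (2 * \<epsilon>)) * (2 * pi * (\<Sum>n. (norm (a n * of_real (r (Suc k) ^ n - r k ^ n)))\<^sup>2)))) {0..2*pi}"
      by (intro has_integral_add has_integral_mult_right i2) (use has_integral_const_real[of "\<epsilon>/2" 0 "2*pi"] in simp)
    have "integral {0..2*pi} (\<lambda>t. norm (q (Suc k) t - q k t)) \<le> (2*pi) * (\<epsilon> / 2) + (1 / (2 * \<epsilon>)) * (2 * pi * (\<Sum>n. (norm (a n * of_real (r (Suc k) ^ n - r k ^ n)))\<^sup>2))"
    proof (rule has_integral_le[OF integrable_integral i3])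
      show "(\<lambda>t. norm (q (Suc k) t - q k t)) integrable_on {0..2*pi}"
        by (intro integrable_continuous_interval continuous_intros continuous_on_subset[OF cq]) auto
      fix t
      define x where "x = norm (q (Suc k) t - q k t)"
      have "0 \<le> (x - \<epsilon>)\<^sup>2" by simp
      hence "2 * x * \<epsilon> \<le> \<epsilon>\<^sup>2 + x\<^sup>2" by (simp add: power2_eq_square algebra_simps)
      thus "norm (q (Suc k) t - q k t) \<le> \<epsilon> / 2 + (1 / (2 * \<epsilon>)) * (norm (q (Suc k) t - q k t))\<^sup>2"
        using \<epsilon> by (simp add: x_def[symmetric] field_simps power2_eq_square)
    qed
    also have "\<dots> \<le> (2*pi) * (\<epsilon> / 2) + (1 / (2 * \<epsilon>)) * (2 * pi * \<epsilon>\<^sup>2)"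
      using \<epsilon> by (intro add_left_mono mult_left_mono sle) auto
    also have "\<dots> = \<epsilon> * (2 * pi)" using \<epsilon> by (simp add: field_simps power2_eq_square)
    finally show ?thesis by (simp add: \<epsilon>_def)
  qed
  define d where "d k t = indicator {0..2*pi} t * norm (q (Suc k) t - q k t)" for k t
  have dint: "integrable lborel (d k)" and dle: "(LINT t|lborel. norm (d k t)) \<le> (1/2)^k * (2 * pi)" for k
  proof -
    have s: "set_integrable lborel {0..2*pi} (\<lambda>t. norm (q (Suc k) t - q k t))"
      by (intro borel_integrable_atLeastAtMost' continuous_intros continuous_on_subset[OF cq]) auto
    thus "integrable lborel (d k)" by (simp add: d_def[abs_def] set_integrable_def)
    have "norm (d k t) = d k t" for t by (simp add: d_def)
    thus "(LINT t|lborel. norm (d k t)) \<le> (1/2)^k * (2 * pi)"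
      using L1[of k] set_borel_integral_eq_integral(2)[OF s] by (simp add: d_def[abs_def] set_lebesgue_integral_def)
  qed
  have sumd: "AE t in lborel. summable (\<lambda>k. d k t)"
  proof -
    have nn: "(\<integral>\<^sup>+t. ennreal (d k t) \<partial>lborel) \<le> ennreal ((1/2)^k * (2 * pi))" for k
    proof -
      have "(\<integral>\<^sup>+t. ennreal (d k t) \<partial>lborel) = ennreal (LINT t|lborel. d k t)"
        by (rule nn_integral_eq_integral[OF dint]) (simp add: d_def)
      also have "(LINT t|lborel. d k t) \<le> (1/2)^k * (2 * pi)"
        using dle[of k] by (simp add: d_def)
      finally show ?thesis by (simp add: ennreal_leI)
    qed
    have "(\<integral>\<^sup>+t. (\<Sum>k. ennreal (d k t)) \<partial>lborel) = (\<Sum>k. (\<integral>\<^sup>+t. ennreal (d k t) \<partial>lborel))"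
      using dint by (intro nn_integral_suminf) auto
    also have le: "\<dots> \<le> (\<Sum>k. ennreal ((1/2)^k * (2 * pi)))" by (intro suminf_le nn) auto
    finally have le: "(\<integral>\<^sup>+t. (\<Sum>k. ennreal (d k t)) \<partial>lborel) \<le> (\<Sum>k. ennreal ((1/2)^k * (2 * pi)))" .
    have "(\<Sum>k. ennreal ((1/2)^k * (2 * pi))) = ennreal (\<Sum>k. (1/2)^k * (2 * pi))"
      by (rule suminf_ennreal2) (auto intro!: summable_mult2 summable_geometric)
    hence "(\<Sum>k. ennreal ((1/2)^k * (2 * pi))) \<noteq> top" by simp
    from neq_top_trans[OF this le]
    have fin: "(\<integral>\<^sup>+t. (\<Sum>k. ennreal (d k t)) \<partial>lborel) \<noteq> \<infinity>" by simp
    have "AE t in lborel. (\<Sum>k. ennreal (d k t)) \<noteq> \<infinity>"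
      using dint by (intro nn_integral_PInf_AE fin) auto
    thus ?thesis
    proof eventually_elim
      case (elim t)
      show ?case by (rule summable_suminf_not_top) (use elim in \<open>auto simp: d_def\<close>)
    qed
  qed
  show ?thesis
  proof (intro exI[of _ r] conjI allI r rlim)
    show "AE t in lborel. t \<in> {0..2*pi} \<longrightarrow> convergent (\<lambda>k. f (of_real (r k) * cis t))"
      using sumd
    proof eventually_elim
      case (elim t)
      show ?case
      proof
        assume "t \<in> {0..2*pi}"
        hence "summable (\<lambda>k. norm (q (Suc k) t - q k t))" using elim by (simp add: d_def)
        hence "summable (\<lambda>k. q (Suc k) t - q k t)" by (rule summable_norm_cancel)
        then obtain S where "(\<lambda>n. \<Sum>k<n. q (Suc k) t - q k t) \<longlonglongrightarrow> S" by (auto simp: summable_def sums_def)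
        moreover have "(\<Sum>k<n. q (Suc k) t - q k t) = q n t - q 0 t" for n
          by (rule sum_lessThan_telescope[of "\<lambda>k. q k t"])
        ultimately have "(\<lambda>n. q n t - q 0 t) \<longlonglongrightarrow> S" by (simp only:)
        from tendsto_add[OF this tendsto_const[of "q 0 t"]]
        have "(\<lambda>n. q n t) \<longlonglongrightarrow> S + q 0 t" by simp
        thus "convergent (\<lambda>k. f (of_real (r k) * cis t))" unfolding q_def by (rule convergentI)
      qed
    qed
  qed
qed

section \<open>Herglotz integrals and outer functions\<close>

text \<open>Literally the exponent in \<open>outer_function\<close>; its real part is the Poisson
  integral of \<open>m\<close>.\<close>

definition herglotz :: "(real \<Rightarrow> real) \<Rightarrow> complex \<Rightarrow> complex" where
  "herglotz m w = (LINT t:{0..2*pi}|lborel. ((cis t + w) / (cis t - w)) * complex_of_real (m t)) / complex_of_real (2*pi)"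

lemma set_integrable_of_real:
  "set_integrable lborel A m \<Longrightarrow> set_integrable lborel A (\<lambda>t. complex_of_real (m t))"
  unfolding set_integrable_def scaleR_conv_of_real
  by (drule integrable_of_real[where 'a=complex]) simp

lemma set_integrable_mult_continuous_complex:
  fixes q g :: "real \<Rightarrow> complex"
  assumes q: "continuous_on {a..b} q" and g: "set_integrable lborel {a..b} g"
  shows "set_integrable lborel {a..b} (\<lambda>t. q t * g t)"
proof -
  have "set_integrable lborel {a..b} (\<lambda>t. Re (q t) *\<^sub>R g t)" "set_integrable lborel {a..b} (\<lambda>t. Im (q t) *\<^sub>R g t)"
    by (intro set_integrable_mult_continuous continuous_intros q g)+
  hence "set_integrable lborel {a..b} (\<lambda>t. Re (q t) *\<^sub>R g t + \<i> * (Im (q t) *\<^sub>R g t))"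
    by (intro set_integral_add set_integrable_mult_right) auto
  moreover have "Re (q t) *\<^sub>R g t + \<i> * (Im (q t) *\<^sub>R g t) = q t * g t" for t
    by (simp add: complex_eq_iff algebra_simps)
  ultimately show ?thesis by simp
qed

lemma herglotz_integrable:
  assumes m: "set_integrable lborel {0..2*pi} m" and w: "norm w < 1"
  shows "set_integrable lborel {0..2*pi} (\<lambda>t. ((cis t + w) / (cis t - w)) * complex_of_real (m t))"
  by (intro set_integrable_mult_continuous_complex set_integrable_of_real m continuous_intros)
     (auto simp: cis_neq_disk[OF w])

lemma Re_herglotz_kernel:
  assumes "norm w < 1"
  shows "Re ((cis t + w) / (cis t - w)) = poisson_kernel w t"
proof -
  have "(cis t + w) / (cis t - w) = ((cis t + w) * cnj (cis t - w)) / of_real ((norm (cis t - w))\<^sup>2)"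
    by (rule complex_div_cnj)
  hence "Re ((cis t + w) / (cis t - w)) = Re ((cis t + w) * cnj (cis t - w)) / (norm (cis t - w))\<^sup>2"
    by (simp only: Re_divide_of_real)
  also have "Re ((cis t + w) * cnj (cis t - w)) = (cos t)\<^sup>2 + (sin t)\<^sup>2 - ((Re w)\<^sup>2 + (Im w)\<^sup>2)"
    by (simp add: power2_eq_square algebra_simps)
  also have "\<dots> = 1 - (norm w)\<^sup>2" by (simp add: cmod_power2)
  finally show ?thesis by (simp add: poisson_kernel_def)
qed

lemma Re_herglotz:
  assumes m: "set_integrable lborel {0..2*pi} m" and w: "norm w < 1"
  shows "Re (herglotz m w) = integral {0..2*pi} (\<lambda>t. poisson_kernel w t *\<^sub>R m t) / (2 * pi)"
proof -
  let ?h = "\<lambda>t. ((cis t + w) / (cis t - w)) * complex_of_real (m t)"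
  have hi: "?h integrable_on {0..2*pi}" "(LINT t:{0..2*pi}|lborel. ?h t) = integral {0..2*pi} ?h"
    using set_borel_integral_eq_integral[OF herglotz_integrable[OF m w]] by auto
  have "Re (integral {0..2*pi} ?h) = integral {0..2*pi} (\<lambda>t. Re (?h t))"
    using integral_linear[OF hi(1) bounded_linear_Re] by (simp add: o_def)
  also have "(\<lambda>t. Re (?h t)) = (\<lambda>t. poisson_kernel w t *\<^sub>R m t)"
  proof
    fix t
    have "Re (z * complex_of_real r) = Re z * r" for z r by simp
    thus "Re (?h t) = poisson_kernel w t *\<^sub>R m t" by (simp only: Re_herglotz_kernel[OF w] real_scaleR_def)
  qed
  finally show ?thesis by (simp only: herglotz_def hi(2) Re_divide_of_real)
qed

text \<open>The difference quotient at \<open>w\<close> is itself an integral \<open>D y\<close>,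
  divided by \<open>2 * pi\<close>, with the explicit kernel \<open>q y\<close>. A Lipschitz bound
  for this kernel makes \<open>D\<close> continuous at \<open>w\<close>, and its value there gives
  the derivative.\<close>

lemma herglotz_holomorphic:
  assumes m: "set_integrable lborel {0..2*pi} m"
  shows "herglotz m holomorphic_on ball 0 1"
  unfolding holomorphic_on_open[OF open_ball]
proof (intro ballI exI)
  fix w :: complex assume "w \<in> ball 0 1"
  hence w: "norm w < 1" by simp
  define \<mu> where "\<mu> t = complex_of_real (m t)" for t
  have \<mu>: "set_integrable lborel {0..2*pi} \<mu>" unfolding \<mu>_def by (rule set_integrable_of_real[OF m])
  define q where "q y t = 2 * cis t / ((cis t - y) * (cis t - w))" for y t
  have cq: "continuous_on {0..2*pi} (q y)" if "norm y < 1" for y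
    unfolding q_def by (intro continuous_intros) (auto simp: cis_neq_disk[OF w] cis_neq_disk[OF that])
  define D where "D y = (LINT t:{0..2*pi}|lborel. q y t * \<mu> t)" for y
  have qi: "set_integrable lborel {0..2*pi} (\<lambda>t. q y t * \<mu> t)" if "norm y < 1" for y
    by (rule set_integrable_mult_continuous_complex[OF cq[OF that] \<mu>])
  define C where "C = (LINT t:{0..2*pi}|lborel. norm (\<mu> t))"
  have ni: "set_integrable lborel {0..2*pi} (\<lambda>t. norm (\<mu> t))" using \<mu> by (rule set_integrable_norm)
  define d where "d = (1 - norm w) / 2"
  have d: "d > 0" using w by (simp add: d_def)
  have near: "norm (cis t - y) \<ge> d" "norm y < 1" if "dist y w < d" for y t
  proof -
    have "norm y \<le> norm w + d" using that norm_triangle_ineq2[of y w] by (simp add: dist_norm)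
    thus "norm y < 1" using w by (simp add: d_def field_simps)
    thus "norm (cis t - y) \<ge> d" using cis_minus_ge[of y t] \<open>norm y \<le> norm w + d\<close> by (simp add: d_def field_simps)
  qed
  have bound: "norm (D y - D w) \<le> (2 / d ^ 3 * C) * dist y w" if y: "dist y w < d" for y
  proof -
    have y1: "norm y < 1" using near(2)[OF y] .
    have "D y - D w = (LINT t:{0..2*pi}|lborel. q y t * \<mu> t - q w t * \<mu> t)"
      unfolding D_def by (rule set_integral_diff(2)[OF qi[OF y1] qi[OF w], symmetric])
    also have "norm \<dots> \<le> (LINT t:{0..2*pi}|lborel. norm (q y t * \<mu> t - q w t * \<mu> t))"
      by (rule set_integral_norm_bound[OF set_integral_diff(1)[OF qi[OF y1] qi[OF w]]])
    also have "\<dots> \<le> (LINT t:{0..2*pi}|lborel. (2 / d ^ 3 * dist y w) * norm (\<mu> t))"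
    proof (rule set_integral_mono)
      show "set_integrable lborel {0..2*pi} (\<lambda>t. norm (q y t * \<mu> t - q w t * \<mu> t))"
        by (intro set_integrable_norm set_integral_diff(1) qi y1 w)
      show "set_integrable lborel {0..2*pi} (\<lambda>t. (2 / d ^ 3 * dist y w) * norm (\<mu> t))" using ni by simp
      fix t
      have ne: "cis t - y \<noteq> 0" "cis t - w \<noteq> 0" using cis_neq_disk[OF w, of t] cis_neq_disk[OF y1, of t] by auto
      have "q y t - q w t = 2 * cis t * (y - w) / ((cis t - y) * (cis t - w) * (cis t - w))"
      proof -
        have "2 * c / (a * b) - 2 * c / (b * b) = 2 * c * (b - a) / (a * b * b)" if "a \<noteq> 0" "b \<noteq> 0" for a b c :: complex
          using that by (simp add: field_simps)
        from this[OF ne, of "cis t"] show ?thesis by (simp add: q_def)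
      qed
      hence "norm (q y t - q w t) = 2 * dist y w / (norm (cis t - y) * norm (cis t - w) * norm (cis t - w))"
        by (simp add: norm_divide norm_mult dist_norm)
      also have "\<dots> \<le> 2 * dist y w / (d * d * d)"
        using d near(1)[OF y, of t] near(1)[of w t] by (intro divide_left_mono mult_mono mult_pos_pos) auto
      finally have "norm (q y t - q w t) \<le> 2 / d ^ 3 * dist y w" by (simp add: power3_eq_cube)
      hence "norm (q y t - q w t) * norm (\<mu> t) \<le> 2 / d ^ 3 * dist y w * norm (\<mu> t)" by (rule mult_right_mono) simp
      thus "norm (q y t * \<mu> t - q w t * \<mu> t) \<le> 2 / d ^ 3 * dist y w * norm (\<mu> t)"
        by (simp add: norm_mult[symmetric] left_diff_distrib)
    qed
    also have "\<dots> = 2 / d ^ 3 * dist y w * C" unfolding C_def by (rule set_integral_mult_right)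
    finally show ?thesis by (simp add: mult_ac)
  qed
  have lim: "(D \<longlongrightarrow> D w) (at w)"
  proof (rule LIM_zero_cancel, rule Lim_null_comparison)
    show "\<forall>\<^sub>F y in at w. norm (D y - D w) \<le> (2 / d ^ 3 * C) * dist y w"
      using bound d by (auto simp: eventually_at)
    have "((\<lambda>y. (2 / d ^ 3 * C) * dist y w) \<longlongrightarrow> (2 / d ^ 3 * C) * dist w w) (at w)" by (intro tendsto_intros)
    thus "((\<lambda>y. (2 / d ^ 3 * C) * dist y w) \<longlongrightarrow> 0) (at w)" by simp
  qed
  have quot: "(herglotz m y - herglotz m w) / (y - w) = D y / of_real (2 * pi)" if y: "dist y w < d" "y \<noteq> w" for y
  proof -
    have y1: "norm y < 1" using near(2)[OF y(1)] .
    let ?h = "\<lambda>y t. ((cis t + y) / (cis t - y)) * complex_of_real (m t)"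
    have "(LINT t:{0..2*pi}|lborel. ?h y t) - (LINT t:{0..2*pi}|lborel. ?h w t)
        = (LINT t:{0..2*pi}|lborel. ?h y t - ?h w t)"
      by (rule set_integral_diff(2)[OF herglotz_integrable[OF m y1] herglotz_integrable[OF m w], symmetric])
    also have "(\<lambda>t. ?h y t - ?h w t) = (\<lambda>t. (y - w) * (q y t * \<mu> t))"
    proof
      fix t
      have ne: "cis t - y \<noteq> 0" "cis t - w \<noteq> 0" using cis_neq_disk[OF w, of t] cis_neq_disk[OF y1, of t] by auto
      have "(cis t + y) / (cis t - y) - (cis t + w) / (cis t - w) = (y - w) * q y t"
      proof -
        have "(2 * c - a) / a - (2 * c - b) / b = (b - a) * (2 * c / (a * b))" if "a \<noteq> 0" "b \<noteq> 0" for a b c :: complex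
          using that by (simp add: field_simps)
        from this[OF ne, of "cis t"] show ?thesis by (simp add: q_def)
      qed
      moreover have "?h y t - ?h w t = ((cis t + y) / (cis t - y) - (cis t + w) / (cis t - w)) * complex_of_real (m t)"
        by (rule left_diff_distrib[symmetric])
      ultimately show "?h y t - ?h w t = (y - w) * (q y t * \<mu> t)"
        by (simp only: \<mu>_def mult.assoc)
    qed
    also have "(LINT t:{0..2*pi}|lborel. (y - w) * (q y t * \<mu> t)) = (y - w) * D y"
      unfolding D_def by (rule set_integral_mult_right)
    finally have "herglotz m y - herglotz m w = (y - w) * D y / of_real (2 * pi)"
      unfolding herglotz_def diff_divide_distrib[symmetric] by simp
    thus ?thesis using y by simp
  qed
  show "(herglotz m has_field_derivative D w / of_real (2 * pi)) (at w)"
    unfolding has_field_derivative_iff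
  proof (rule Lim_transform_eventually)
    show "((\<lambda>y. D y / of_real (2 * pi)) \<longlongrightarrow> D w / of_real (2 * pi)) (at w)" by (intro tendsto_intros lim) auto
    show "\<forall>\<^sub>F y in at w. D y / of_real (2 * pi) = (herglotz m y - herglotz m w) / (y - w)"
      using quot d by (auto simp: eventually_at)
  qed
qed

text \<open>The limit \<open>g\<close> along a single sequence of radii represents \<open>f\<close>
  as a Poisson integral, by dominated convergence. Fatou's theorem applied to \<open>g\<close> then
  upgrades this one sequence to all cones.\<close>

lemma bounded_holomorphic_nt_limit:
  assumes f: "f holomorphic_on ball 0 1" and fB: "\<forall>w\<in>ball 0 1. norm (f w) \<le> B"
  shows "\<exists>N. negligible N \<and> (\<forall>x\<in>{0<..<2*pi} - N. \<exists>l. \<forall>M>0. (f \<longlongrightarrow> l) (at (cis x) within stolz (cis x) M))"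
proof -
  have B: "norm (f w) \<le> B" if "norm w < 1" for w using fB that by simp
  from bounded_holomorphic_radial_limit[OF f fB]
  obtain r where r: "\<forall>k::nat. 0 < r k \<and> r k < 1" and r1: "r \<longlonglongrightarrow> 1"
    and conv: "AE t in lborel. t \<in> {0..2*pi} \<longrightarrow> convergent (\<lambda>k. f (of_real (r k) * cis t))"
    by (elim exE conjE)
  have rk: "0 < r k" "r k < 1" for k using r by auto
  define q where "q k t = f (of_real (r k) * cis t)" for k t
  have inball: "of_real (r k) * cis t \<in> ball 0 1" for k t using rk[of k] by (simp add: norm_mult)
  have cq: "continuous_on UNIV (q k)" for k
    unfolding q_def by (rule continuous_on_compose2[OF holomorphic_on_imp_continuous_on[OF f]])
      (use inball in \<open>auto intro!: continuous_intros\<close>)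
  have qm: "q k \<in> borel_measurable borel" for k by (rule borel_measurable_continuous_onI[OF cq])
  have qB: "norm (q k t) \<le> B" for k t unfolding q_def by (rule B) (use inball in simp)
  \<comment> \<open>Where the sequence diverges, \<open>lim\<close> is an unspecified value; this
    concerns a null set only, and \<open>g\<close> is measurable regardless.\<close>
  define g where "g t = lim (\<lambda>k. q k t)" for t
  have gm: "g \<in> borel_measurable borel" unfolding g_def by (rule borel_measurable_lim_metric[OF qm])
  have lim: "AE t in lborel. t \<in> {0..2*pi} \<longrightarrow> (\<lambda>k. q k t) \<longlonglongrightarrow> g t"
    using conv unfolding g_def q_def by eventually_elim (simp add: convergent_LIMSEQ_iff)
  let ?I = "\<lambda>t. indicator {0..2*pi} t :: real"
  have domc: "integrable lborel (\<lambda>t. ?I t *\<^sub>R (p t *\<^sub>R g t))"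
    "(\<lambda>k. LINT t|lborel. ?I t *\<^sub>R (p t *\<^sub>R q k t)) \<longlonglongrightarrow> (LINT t|lborel. ?I t *\<^sub>R (p t *\<^sub>R g t))"
    if p: "continuous_on UNIV p" and pC: "\<And>t. \<bar>p t\<bar> \<le> C" for p :: "real \<Rightarrow> real" and C
  proof -
    have pm: "p \<in> borel_measurable borel" by (rule borel_measurable_continuous_onI[OF p])
    have C0: "0 \<le> C" using order_trans[OF abs_ge_zero pC[of 0]] .
    have wi: "integrable lborel (\<lambda>t. ?I t * (C * B))"
      using borel_integrable_atLeastAtMost'[of 0 "2*pi" "\<lambda>_. C * B"] by (simp add: set_integrable_def)
    have m1: "(\<lambda>t. ?I t *\<^sub>R (p t *\<^sub>R g t)) \<in> borel_measurable lborel"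
      using pm gm by (auto intro!: borel_measurable_scaleR)
    have m2: "(\<lambda>t. ?I t *\<^sub>R (p t *\<^sub>R q k t)) \<in> borel_measurable lborel" for k
      using pm qm by (auto intro!: borel_measurable_scaleR)
    show "integrable lborel (\<lambda>t. ?I t *\<^sub>R (p t *\<^sub>R g t))"
    proof (rule integrable_dominated_convergence[where w="\<lambda>t. ?I t * (C * B)" and s="\<lambda>k t. ?I t *\<^sub>R (p t *\<^sub>R q k t)"])
      show "AE t in lborel. (\<lambda>k. ?I t *\<^sub>R (p t *\<^sub>R q k t)) \<longlonglongrightarrow> ?I t *\<^sub>R (p t *\<^sub>R g t)"
        using lim by eventually_elim (auto simp: indicator_def intro!: tendsto_intros)
      show "AE t in lborel. norm (?I t *\<^sub>R (p t *\<^sub>R q k t)) \<le> ?I t * (C * B)" for k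
        using mult_mono[OF pC qB C0 norm_ge_zero] by (auto simp: indicator_def)
    qed (rule m1 m2 wi)+
    show "(\<lambda>k. LINT t|lborel. ?I t *\<^sub>R (p t *\<^sub>R q k t)) \<longlonglongrightarrow> (LINT t|lborel. ?I t *\<^sub>R (p t *\<^sub>R g t))"
    proof (rule integral_dominated_convergence[where w="\<lambda>t. ?I t * (C * B)" and s="\<lambda>k t. ?I t *\<^sub>R (p t *\<^sub>R q k t)"])
      show "AE t in lborel. (\<lambda>k. ?I t *\<^sub>R (p t *\<^sub>R q k t)) \<longlonglongrightarrow> ?I t *\<^sub>R (p t *\<^sub>R g t)"
        using lim by eventually_elim (auto simp: indicator_def intro!: tendsto_intros)
      show "AE t in lborel. norm (?I t *\<^sub>R (p t *\<^sub>R q k t)) \<le> ?I t * (C * B)" for k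
        using mult_mono[OF pC qB C0 norm_ge_zero] by (auto simp: indicator_def)
    qed (rule m1 m2 wi)+
  qed
  have gi: "set_integrable lborel {0..2*pi} g"
    using domc(1)[of "\<lambda>_. 1" 1] by (simp add: set_integrable_def)
  have rep: "integral {0..2*pi} (\<lambda>t. poisson_kernel w t *\<^sub>R g t) /\<^sub>R (2 * pi) = f w" if w: "norm w < 1" for w
  proof -
    define C where "C = 2 / (1 - norm w)"
    have pC: "\<bar>poisson_kernel w t\<bar> \<le> C" for t
    proof -
      have d: "0 < 1 - norm w" using w by simp
      have "poisson_kernel w t \<le> (1 - (norm w)\<^sup>2) / (1 - norm w)\<^sup>2"
        unfolding poisson_kernel_def using w d cis_minus_ge[OF w, of t] cis_minus_pos[OF w, of t]
        by (intro divide_left_mono power_mono mult_pos_pos zero_less_power) (auto simp: power_le_one)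
      also have "\<dots> = (1 + norm w) / (1 - norm w)" 
      proof -
        have "1 - (norm w)\<^sup>2 = (1 + norm w) * (1 - norm w)" by (simp add: power2_eq_square algebra_simps)
        thus ?thesis using d by (simp add: power2_eq_square)
      qed
      also have "\<dots> \<le> C" unfolding C_def using w d by (intro divide_right_mono) auto
      finally show ?thesis using poisson_kernel_nonneg[OF w] by simp
    qed
    have cp: "continuous_on UNIV (poisson_kernel w)" by (rule continuous_on_poisson_kernel[OF w])
    have qi: "(LINT t|lborel. ?I t *\<^sub>R (poisson_kernel w t *\<^sub>R q k t)) = of_real (2 * pi) * f (of_real (r k) * w)" for k
    proof -
      have "(\<lambda>z. f (of_real (r k) * z)) holomorphic_on ball 0 (1 / r k)"
        by (rule holomorphic_on_compose_gen[OF _ f, unfolded o_def])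
           (use rk[of k] in \<open>auto intro!: holomorphic_intros simp: norm_mult field_simps\<close>)
      from poisson_formula_unit[OF this _ w]
      have "((\<lambda>t. of_real (poisson_kernel w t) * q k t) has_integral (of_real (2 * pi) * f (of_real (r k) * w))) {0..2*pi}"
        using rk[of k] by (simp add: q_def)
      hence 1: "integral {0..2*pi} (\<lambda>t. poisson_kernel w t *\<^sub>R q k t) = of_real (2 * pi) * f (of_real (r k) * w)"
        by (simp add: integral_unique scaleR_conv_of_real)
      have "set_integrable lborel {0..2*pi} (\<lambda>t. poisson_kernel w t *\<^sub>R q k t)"
        by (intro borel_integrable_atLeastAtMost' continuous_on_scaleR continuous_on_subset[OF cp] continuous_on_subset[OF cq]) auto
      from set_borel_integral_eq_integral(2)[OF this] 1 show ?thesis by (simp add: set_lebesgue_integral_def)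
    qed
    have "(\<lambda>k. of_real (2 * pi) * f (of_real (r k) * w)) \<longlonglongrightarrow> of_real (2 * pi) * f (of_real 1 * w)"
    proof (intro tendsto_mult tendsto_const)
      have "isCont f (of_real 1 * w)"
        using holomorphic_on_imp_continuous_on[OF f] w by (simp add: continuous_on_eq_continuous_at)
      thus "(\<lambda>k. f (of_real (r k) * w)) \<longlonglongrightarrow> f (of_real 1 * w)"
        by (rule isCont_tendsto_compose) (intro tendsto_intros r1)
    qed
    from LIMSEQ_unique[OF domc(2)[OF cp pC, unfolded qi] this]
    have "(LINT t|lborel. ?I t *\<^sub>R (poisson_kernel w t *\<^sub>R g t)) = of_real (2 * pi) * f w" by simp
    moreover have "set_integrable lborel {0..2*pi} (\<lambda>t. poisson_kernel w t *\<^sub>R g t)"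
      unfolding set_integrable_def by (rule domc(1)[OF cp pC])
    ultimately have "integral {0..2*pi} (\<lambda>t. poisson_kernel w t *\<^sub>R g t) = of_real (2 * pi) * f w"
      using set_borel_integral_eq_integral(2)[of "{0..2*pi}" "\<lambda>t. poisson_kernel w t *\<^sub>R g t"]
      by (simp only: set_lebesgue_integral_def)
    thus ?thesis by (simp add: scaleR_conv_of_real)
  qed
  from poisson_integral_nt_limit[OF gi] obtain N where N: "negligible N" and
    lims: "\<forall>x\<in>{0<..<2*pi} - N. \<forall>M>0.
    ((\<lambda>w. integral {0..2*pi} (\<lambda>t. poisson_kernel w t *\<^sub>R g t) /\<^sub>R (2 * pi)) \<longlongrightarrow> g x)
      (at (cis x) within stolz (cis x) M)" by (elim exE conjE)
  show ?thesis
  proof (intro exI[of _ N] conjI ballI N)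
    fix x assume x: "x \<in> {0<..<2*pi} - N"
    show "\<exists>l. \<forall>M>0. (f \<longlongrightarrow> l) (at (cis x) within stolz (cis x) M)"
    proof (intro exI[of _ "g x"] allI impI)
      fix M :: real assume M: "M > 0"
      show "(f \<longlongrightarrow> g x) (at (cis x) within stolz (cis x) M)"
      proof (rule Lim_transform_eventually[OF lims[rule_format, OF x M]])
        show "\<forall>\<^sub>F w in at (cis x) within stolz (cis x) M. integral {0..2*pi} (\<lambda>t. poisson_kernel w t *\<^sub>R g t) /\<^sub>R (2 * pi) = f w"
        proof -
          have "\<forall>\<^sub>F w in at (cis x) within stolz (cis x) M. w \<in> stolz (cis x) M"
            by (simp add: eventually_at_filter)
          thus ?thesis by eventually_elim (rule rep, simp add: stolz_def)
        qed
      qed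
    qed
  qed
qed

text \<open>One explicit sequence on the radius serves to define boundary values. The offset 2 makes
  it start at modulus \<open>1/2\<close>, away from the puncture.\<close>

definition radial :: "real \<Rightarrow> nat \<Rightarrow> complex" where
  "radial x n = of_real (1 - 1 / (real n + 2)) * cis x"

lemma radial_lim: "radial x \<longlonglongrightarrow> cis x"
proof -
  have "(\<lambda>n. 1 / (real n + 2)) \<longlonglongrightarrow> 0"
    using LIMSEQ_ignore_initial_segment[OF lim_1_over_n, of 2] by (simp add: add.commute)
  hence "(\<lambda>n. of_real (1 - 1 / (real n + 2)) * cis x) \<longlonglongrightarrow> of_real (1 - 0) * cis x"
    by (intro tendsto_mult tendsto_of_real tendsto_diff tendsto_const)
  thus ?thesis by (simp add: radial_def[abs_def])
qed

lemma norm_radial: "norm (radial x n) = 1 - 1 / (real n + 2)"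
proof -
  have "0 \<le> 1 - 1 / (real n + 2)" by simp
  thus ?thesis by (simp only: radial_def norm_mult norm_of_real norm_cis) simp
qed

lemma radial_stolz: "1 < M \<Longrightarrow> radial x n \<in> stolz (cis x) M"
proof -
  assume M: "1 < M"
  have "radial x n - cis x = - (of_real (1 / (real n + 2)) * cis x)" by (simp add: radial_def algebra_simps)
  hence "norm (radial x n - cis x) = 1 / (real n + 2)"
    by (simp only: norm_minus_cancel norm_mult norm_of_real norm_cis) simp
  moreover have "1 * (1 / (real n + 2)) < M * (1 / (real n + 2))"
    by (rule mult_strict_right_mono[OF M]) simp
  ultimately show ?thesis by (simp add: stolz_def norm_radial)
qed

lemma cis_notin_stolz: "cis x \<notin> stolz e M"
  by (simp add: stolz_def)

lemma stolz_nontrivial: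
  assumes "1 < M" shows "at (cis x) within stolz (cis x) M \<noteq> bot"
proof -
  have "cis x islimpt stolz (cis x) M"
    unfolding islimpt_sequential
  proof (intro exI[of _ "radial x"] conjI allI radial_lim)
    fix n
    have "radial x n \<noteq> cis x" using radial_stolz[OF assms, of x n] cis_notin_stolz[of x "cis x" M] by metis
    thus "radial x n \<in> stolz (cis x) M - {cis x}" using radial_stolz[OF assms, of x n] by blast
  qed
  thus ?thesis by (simp add: trivial_limit_within)
qed

text \<open>A nonnegative \<open>m\<close> makes the exponential bounded by 1, so it has limits in
  cones. Their modulus is read off from the Poisson integral of \<open>m\<close>, whose limits are
  given by Fatou's theorem.\<close>

lemma exp_neg_herglotz_nt_limit:
  assumes m: "set_integrable lborel {0..2*pi} m" and pos: "\<forall>t. 0 \<le> m t"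
  shows "\<exists>N. negligible N \<and> (\<forall>x\<in>{0<..<2*pi} - N. \<exists>l. norm l = exp (- m x) \<and>
    (\<forall>M>0. ((\<lambda>w. exp (- herglotz m w)) \<longlongrightarrow> l) (at (cis x) within stolz (cis x) M)))"
proof -
  define f where "f w = exp (- herglotz m w)" for w
  have f: "f holomorphic_on ball 0 1" unfolding f_def
    by (intro holomorphic_intros herglotz_holomorphic m)
  have Re: "Re (herglotz m w) = integral {0..2*pi} (\<lambda>t. poisson_kernel w t *\<^sub>R m t) / (2 * pi)" if "norm w < 1" for w
    by (rule Re_herglotz[OF m that])
  have f1: "\<forall>w\<in>ball 0 1. norm (f w) \<le> 1"
  proof
    fix w :: complex assume "w \<in> ball 0 1"
    hence w: "norm w < 1" by simp
    have "0 \<le> integral {0..2*pi} (\<lambda>t. poisson_kernel w t *\<^sub>R m t)"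
      by (rule Henstock_Kurzweil_Integration.integral_nonneg[OF set_borel_integral_eq_integral(1)[OF set_integrable_mult_continuous[OF continuous_on_poisson_kernel[OF w] m]]])
         (use poisson_kernel_nonneg[OF w] pos in auto)
    thus "norm (f w) \<le> 1" by (simp add: f_def Re[OF w])
  qed
  from bounded_holomorphic_nt_limit[OF f f1]
  obtain N1 where N1: "negligible N1" and l1: "\<forall>x\<in>{0<..<2*pi} - N1. \<exists>l. \<forall>M>0. (f \<longlongrightarrow> l) (at (cis x) within stolz (cis x) M)"
    by (elim exE conjE)
  from poisson_integral_nt_limit[OF set_integrable_of_real[OF m]] obtain N2 where N2: "negligible N2" and
    l2: "\<forall>x\<in>{0<..<2*pi} - N2. \<forall>M>0.
    ((\<lambda>w. integral {0..2*pi} (\<lambda>t. poisson_kernel w t *\<^sub>R complex_of_real (m t)) /\<^sub>R (2 * pi)) \<longlongrightarrow> complex_of_real (m x))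
      (at (cis x) within stolz (cis x) M)" by (elim exE conjE)
  show ?thesis
  proof (intro exI[of _ "N1 \<union> N2"] conjI ballI)
    show "negligible (N1 \<union> N2)" using N1 N2 by simp
    fix x assume x: "x \<in> {0<..<2*pi} - (N1 \<union> N2)"
    from l1 x obtain l where l: "\<forall>M>0. (f \<longlongrightarrow> l) (at (cis x) within stolz (cis x) M)" by blast
    have nl: "((\<lambda>w. norm (f w)) \<longlongrightarrow> norm l) (at (cis x) within stolz (cis x) 2)"
      using l by (intro tendsto_norm) auto
    have "((\<lambda>w. Re (integral {0..2*pi} (\<lambda>t. poisson_kernel w t *\<^sub>R complex_of_real (m t)) /\<^sub>R (2 * pi))) \<longlongrightarrow> Re (complex_of_real (m x)))
      (at (cis x) within stolz (cis x) 2)" using l2 x by (intro tendsto_Re) auto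
    hence "((\<lambda>w. exp (- Re (integral {0..2*pi} (\<lambda>t. poisson_kernel w t *\<^sub>R complex_of_real (m t)) /\<^sub>R (2 * pi)))) \<longlongrightarrow> exp (- m x))
      (at (cis x) within stolz (cis x) 2)" by (intro tendsto_intros) simp
    moreover have "\<forall>\<^sub>F w in at (cis x) within stolz (cis x) 2.
      exp (- Re (integral {0..2*pi} (\<lambda>t. poisson_kernel w t *\<^sub>R complex_of_real (m t)) /\<^sub>R (2 * pi))) = norm (f w)"
    proof -
      have "exp (- Re (integral {0..2*pi} (\<lambda>t. poisson_kernel w t *\<^sub>R complex_of_real (m t)) /\<^sub>R (2 * pi))) = norm (f w)"
        if w: "norm w < 1" for w
      proof -
        have "(\<lambda>t. poisson_kernel w t *\<^sub>R complex_of_real (m t)) integrable_on {0..2*pi}"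
          by (rule set_borel_integral_eq_integral(1)[OF set_integrable_mult_continuous[OF continuous_on_poisson_kernel[OF w] set_integrable_of_real[OF m]]])
        from integral_linear[OF this bounded_linear_Re]
        have "Re (integral {0..2*pi} (\<lambda>t. poisson_kernel w t *\<^sub>R complex_of_real (m t))) = integral {0..2*pi} (\<lambda>t. poisson_kernel w t *\<^sub>R m t)"
          by (simp add: o_def)
        moreover have "Re (z /\<^sub>R c) = Re z / c" for z c by (simp add: divide_inverse)
        ultimately show ?thesis unfolding f_def norm_exp_eq_Re uminus_complex.sel Re[OF w] by (simp only:)
      qed
      thus ?thesis by (simp add: eventually_at_filter stolz_def)
    qed
    ultimately have "((\<lambda>w. norm (f w)) \<longlongrightarrow> exp (- m x)) (at (cis x) within stolz (cis x) 2)"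
      by (rule Lim_transform_eventually)
    hence lm: "((\<lambda>w. norm (f w)) \<longlongrightarrow> exp (- m x)) (at (cis x) within stolz (cis x) 2)" .
    have nt: "at (cis x) within stolz (cis x) 2 \<noteq> bot" by (rule stolz_nontrivial) simp
    have "norm l = exp (- m x)" by (rule tendsto_unique[OF nt nl lm])
    thus "\<exists>l. norm l = exp (- m x) \<and> (\<forall>M>0. ((\<lambda>w. exp (- herglotz m w)) \<longlongrightarrow> l) (at (cis x) within stolz (cis x) M))"
      using l unfolding f_def by blast
  qed
qed

lemma herglotz_diff:
  assumes "set_integrable lborel {0..2*pi} m1" "set_integrable lborel {0..2*pi} m2" "norm w < 1"
  shows "herglotz (\<lambda>t. m1 t - m2 t) w = herglotz m1 w - herglotz m2 w"
  using set_integral_diff(2)[OF herglotz_integrable[OF assms(1,3)] herglotz_integrable[OF assms(2,3)]]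
  by (simp add: herglotz_def right_diff_distrib diff_divide_distrib)

text \<open>Splitting \<open>k\<close> into positive and negative parts exhibits a quotient of two
  bounded functions. The limit of the denominator is nonzero because its modulus is an
  exponential.\<close>

lemma exp_herglotz_nt_limit:
  assumes k: "set_integrable lborel {0..2*pi} k"
  shows "\<exists>N. negligible N \<and> (\<forall>x\<in>{0<..<2*pi} - N. \<exists>l. norm l = exp (k x) \<and>
    (\<forall>M>0. ((\<lambda>w. exp (herglotz k w)) \<longlongrightarrow> l) (at (cis x) within stolz (cis x) M)))"
proof -
  define m1 where "m1 t = max 0 (k t)" for t
  define m2 where "m2 t = max 0 (- k t)" for t
  have i1: "set_integrable lborel {0..2*pi} m1" and i2: "set_integrable lborel {0..2*pi} m2"
  proof -
    have a: "set_integrable lborel {0..2*pi} (\<lambda>t. norm (k t))" using k by (rule set_integrable_norm)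
    have "m1 = (\<lambda>t. (1/2) * (norm (k t) + k t))" "m2 = (\<lambda>t. (1/2) * (norm (k t) - k t))"
      by (auto simp: m1_def m2_def fun_eq_iff max_def abs_if)
    thus "set_integrable lborel {0..2*pi} m1" "set_integrable lborel {0..2*pi} m2"
      using set_integral_add(1)[OF a k] set_integral_diff(1)[OF a k] by simp_all
  qed
  have km: "k = (\<lambda>t. m1 t - m2 t)" by (auto simp: m1_def m2_def fun_eq_iff max_def)
  have "\<forall>t. 0 \<le> m1 t" by (simp add: m1_def)
  from exp_neg_herglotz_nt_limit[OF i1 this] obtain N1 where N1: "negligible N1" and
    l1: "\<forall>x\<in>{0<..<2*pi} - N1. \<exists>l. norm l = exp (- m1 x) \<and>
    (\<forall>M>0. ((\<lambda>w. exp (- herglotz m1 w)) \<longlongrightarrow> l) (at (cis x) within stolz (cis x) M))"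
    by (elim exE conjE)
  have "\<forall>t. 0 \<le> m2 t" by (simp add: m2_def)
  from exp_neg_herglotz_nt_limit[OF i2 this] obtain N2 where N2: "negligible N2" and
    l2: "\<forall>x\<in>{0<..<2*pi} - N2. \<exists>l. norm l = exp (- m2 x) \<and>
    (\<forall>M>0. ((\<lambda>w. exp (- herglotz m2 w)) \<longlongrightarrow> l) (at (cis x) within stolz (cis x) M))"
    by (elim exE conjE)
  show ?thesis
  proof (intro exI[of _ "N1 \<union> N2"] conjI ballI)
    show "negligible (N1 \<union> N2)" using N1 N2 by simp
    fix x assume x: "x \<in> {0<..<2*pi} - (N1 \<union> N2)"
    from l1 x obtain a1 where a1: "norm a1 = exp (- m1 x)"
      "\<forall>M>0. ((\<lambda>w. exp (- herglotz m1 w)) \<longlongrightarrow> a1) (at (cis x) within stolz (cis x) M)" by blast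
    from l2 x obtain a2 where a2: "norm a2 = exp (- m2 x)"
      "\<forall>M>0. ((\<lambda>w. exp (- herglotz m2 w)) \<longlongrightarrow> a2) (at (cis x) within stolz (cis x) M)" by blast
    have "a1 \<noteq> 0" using a1(1) by (metis exp_not_eq_zero norm_zero)
    show "\<exists>l. norm l = exp (k x) \<and>
      (\<forall>M>0. ((\<lambda>w. exp (herglotz k w)) \<longlongrightarrow> l) (at (cis x) within stolz (cis x) M))"
    proof (intro exI[of _ "a2 / a1"] conjI allI impI)
      have "k x = m1 x - m2 x" using km by metis
      thus "norm (a2 / a1) = exp (k x)"
        by (simp add: norm_divide a1(1) a2(1) exp_diff[symmetric])
      fix M :: real assume M: "M > 0"
      have "((\<lambda>w. exp (- herglotz m2 w) / exp (- herglotz m1 w)) \<longlongrightarrow> a2 / a1) (at (cis x) within stolz (cis x) M)"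
        using a1(2) a2(2) M \<open>a1 \<noteq> 0\<close> by (intro tendsto_divide) auto
      moreover have "exp (- herglotz m2 w) / exp (- herglotz m1 w) = exp (herglotz k w)" if "norm w < 1" for w
      proof -
        have "herglotz k w = herglotz m1 w - herglotz m2 w"
          by (subst km) (rule herglotz_diff[OF i1 i2 that])
        thus ?thesis by (simp add: exp_diff[symmetric])
      qed
      hence "\<forall>\<^sub>F w in at (cis x) within stolz (cis x) M. exp (- herglotz m2 w) / exp (- herglotz m1 w) = exp (herglotz k w)"
        by (simp add: eventually_at_filter stolz_def)
      ultimately show "((\<lambda>w. exp (herglotz k w)) \<longlongrightarrow> a2 / a1) (at (cis x) within stolz (cis x) M)"
        by (rule Lim_transform_eventually)
    qed
  qed
qed

section \<open>The conformal map near a boundary point\<close>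

text \<open>This is convexity of the norm. It makes the mean value inequality available for
  \<open>\<psi>\<close> near a boundary point.\<close>

lemma convex_stolz:
  assumes "0 \<le> M" shows "convex (stolz e M)"
proof (rule convexI)
  fix x y :: complex and u v :: real
  assume x: "x \<in> stolz e M" and y: "y \<in> stolz e M" and uv: "0 \<le> u" "0 \<le> v" "u + v = 1"
  have n: "norm (u *\<^sub>R x + v *\<^sub>R y) \<le> u * norm x + v * norm y"
    using norm_triangle_ineq[of "u *\<^sub>R x" "v *\<^sub>R y"] uv by simp
  have "u *\<^sub>R x + v *\<^sub>R y - e = u *\<^sub>R (x - e) + v *\<^sub>R (y - e)"
  proof -
    have e: "u *\<^sub>R e + v *\<^sub>R e = e" using uv(3) by (simp add: scaleR_add_left[symmetric])
    have "u *\<^sub>R (x - e) + v *\<^sub>R (y - e) = u *\<^sub>R x + v *\<^sub>R y - (u *\<^sub>R e + v *\<^sub>R e)"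
      by (simp add: scaleR_diff_right)
    thus ?thesis by (simp only: e)
  qed
  hence m: "norm (u *\<^sub>R x + v *\<^sub>R y - e) \<le> u * norm (x - e) + v * norm (y - e)"
    using norm_triangle_ineq[of "u *\<^sub>R (x - e)" "v *\<^sub>R (y - e)"] uv by simp
  have lt: "u * p + v * q < u * p' + v * q'" if "p < p'" "q < q'" for p q p' q' :: real
  proof (cases "u = 0")
    case True thus ?thesis using uv that by simp
  next
    case False
    hence "u * p < u * p'" using uv that by simp
    moreover have "v * q \<le> v * q'" using uv that by (intro mult_left_mono) auto
    ultimately show ?thesis by linarith
  qed
  have x': "norm x < 1" "norm (x - e) < M * (1 - norm x)" and y': "norm y < 1" "norm (y - e) < M * (1 - norm y)"
    using x y by (auto simp: stolz_def)
  have "norm (u *\<^sub>R x + v *\<^sub>R y) < 1"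
    using n lt[OF x'(1) y'(1)] uv by simp
  moreover have "norm (u *\<^sub>R x + v *\<^sub>R y - e) < M * (1 - norm (u *\<^sub>R x + v *\<^sub>R y))"
  proof -
    have "norm (u *\<^sub>R x + v *\<^sub>R y - e) < u * (M * (1 - norm x)) + v * (M * (1 - norm y))"
      using m lt[OF x'(2) y'(2)] by linarith
    also have "\<dots> = M * ((u + v) - (u * norm x + v * norm y))" by (simp add: algebra_simps)
    also have "\<dots> \<le> M * (1 - norm (u *\<^sub>R x + v *\<^sub>R y))"
      using n uv assms by (intro mult_left_mono) auto
    finally show ?thesis .
  qed
  ultimately show "u *\<^sub>R x + v *\<^sub>R y \<in> stolz e M" by (simp add: stolz_def)
qed

lemma stolz_mono: "M \<le> M' \<Longrightarrow> stolz e M \<subseteq> stolz e M'"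
  by (auto simp: stolz_def intro: less_le_trans mult_right_mono)

lemma radial_nz: "radial x n \<noteq> 0"
proof
  assume "radial x n = 0"
  hence "1 - 1 / (real n + 2) = 0" using norm_radial[of x n] by simp
  thus False by (simp add: field_simps)
qed

lemma radial_punctured: "radial x n \<in> ball 0 1 - {0}"
  using radial_nz[of x n] norm_radial[of x n] by simp

lemma stolz_near_punctured:
  assumes "w \<in> stolz (cis x) M" "dist w (cis x) < 1/2"
  shows "w \<in> ball 0 1 - {0}"
  using assms by (auto simp: stolz_def)

text \<open>Mean value inequality for \<open>\<psi> y - b * y\<close> on the truncated cone, with
  the second point sent to the vertex along the radius. The number \<open>b\<close> need not be the
  limit of the derivative: later it is also a nearby value from a countable set.\<close>

lemma cone_approx:
  assumes \<psi>: "\<psi> holomorphic_on ball 0 1 - {0}" and M: "1 < M" and \<eta>: "0 < \<eta>" "\<eta> \<le> 1/2"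
    and d: "\<And>w. w \<in> stolz (cis x) M \<Longrightarrow> dist w (cis x) < \<eta> \<Longrightarrow> norm (deriv \<psi> w - b) \<le> \<epsilon>"
    and p: "(\<lambda>n. \<psi> (radial x n)) \<longlonglongrightarrow> p"
    and w: "w \<in> stolz (cis x) M" "dist w (cis x) < \<eta>"
  shows "norm (\<psi> w - p - b * (w - cis x)) \<le> \<epsilon> * dist w (cis x)"
proof -
  define C where "C = stolz (cis x) M \<inter> ball (cis x) \<eta>"
  have convC: "convex C" unfolding C_def using M by (intro convex_Int convex_stolz) auto
  have op: "open (ball 0 1 - {0::complex})" by auto
  have CD: "z \<in> ball 0 1 - {0}" if "z \<in> C" for z
    by (rule stolz_near_punctured[of z x M]) (use that \<eta> in \<open>auto simp: C_def dist_commute\<close>)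
  have est: "norm ((\<psi> w - b * w) - (\<psi> z - b * z)) \<le> \<epsilon> * norm (w - z)" if z: "z \<in> C" for z
  proof (rule field_differentiable_bound[OF convC])
    fix y assume y: "y \<in> C"
    have "(\<psi> has_field_derivative deriv \<psi> y) (at y)" by (rule holomorphic_derivI[OF \<psi> op CD[OF y]])
    hence "((\<lambda>y. \<psi> y - b * y) has_field_derivative (deriv \<psi> y - b)) (at y)"
      by (auto intro!: derivative_eq_intros)
    thus "((\<lambda>y. \<psi> y - b * y) has_field_derivative (deriv \<psi> y - b)) (at y within C)"
      by (rule has_field_derivative_at_within)
    show "norm (deriv \<psi> y - b) \<le> \<epsilon>" by (rule d) (use y in \<open>auto simp: C_def dist_commute\<close>)
  next
    show "w \<in> C" using w by (auto simp: C_def dist_commute)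
  qed (rule z)
  have "(\<lambda>n. norm ((\<psi> w - b * w) - (\<psi> (radial x n) - b * radial x n))) \<longlonglongrightarrow> norm ((\<psi> w - b * w) - (p - b * cis x))"
    by (intro tendsto_intros p radial_lim)
  moreover have "(\<lambda>n. \<epsilon> * norm (w - radial x n)) \<longlonglongrightarrow> \<epsilon> * norm (w - cis x)"
    by (intro tendsto_intros radial_lim)
  moreover have "\<forall>\<^sub>F n in sequentially. norm ((\<psi> w - b * w) - (\<psi> (radial x n) - b * radial x n)) \<le> \<epsilon> * norm (w - radial x n)"
  proof -
    have "\<forall>\<^sub>F n in sequentially. dist (radial x n) (cis x) < \<eta>"
      by (rule tendstoD[OF radial_lim \<eta>(1)])
    thus ?thesis
      by eventually_elim (rule est, use radial_stolz[OF M] in \<open>auto simp: C_def dist_commute\<close>)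
  qed
  ultimately have "norm ((\<psi> w - b * w) - (p - b * cis x)) \<le> \<epsilon> * norm (w - cis x)"
    by (intro tendsto_le[OF sequentially_bot])
  moreover have "(\<psi> w - b * w) - (p - b * cis x) = \<psi> w - p - b * (w - cis x)" by (simp add: algebra_simps)
  ultimately show ?thesis by (simp add: dist_norm)
qed

definition nt_deriv :: "(complex \<Rightarrow> complex) \<Rightarrow> real \<Rightarrow> complex \<Rightarrow> bool" where
  "nt_deriv \<psi> x a \<longleftrightarrow> (\<forall>M>0. (deriv \<psi> \<longlongrightarrow> a) (at (cis x) within stolz (cis x) M))"

lemma nt_derivD:
  assumes "nt_deriv \<psi> x a" "0 < M" "0 < \<epsilon>"
  obtains \<eta> where "0 < \<eta>" "\<eta> \<le> 1/2" "\<And>w. w \<in> stolz (cis x) M \<Longrightarrow> dist w (cis x) < \<eta> \<Longrightarrow> norm (deriv \<psi> w - a) \<le> \<epsilon>"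
proof -
  have "(deriv \<psi> \<longlongrightarrow> a) (at (cis x) within stolz (cis x) M)" using assms by (simp add: nt_deriv_def)
  from tendstoD[OF this assms(3)] obtain d where d: "d > 0"
    "\<forall>w\<in>stolz (cis x) M. w \<noteq> cis x \<and> dist w (cis x) < d \<longrightarrow> dist (deriv \<psi> w) a < \<epsilon>"
    unfolding eventually_at by (elim exE conjE)
  show ?thesis
  proof (rule that[of "min d (1/2)"])
    fix w assume w: "w \<in> stolz (cis x) M" "dist w (cis x) < min d (1/2)"
    have "w \<noteq> cis x" using w(1) cis_notin_stolz by metis
    hence "dist (deriv \<psi> w) a < \<epsilon>" using d(2) w by simp
    thus "norm (deriv \<psi> w - a) \<le> \<epsilon>" by (simp add: dist_norm)
  qed (use d in auto)
qed

text \<open>A derivative that is bounded on a convex truncated cone makes \<open>\<psi>\<close>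
  Lipschitz there, hence Cauchy along the radius.\<close>

lemma nt_deriv_boundary_value:
  assumes \<psi>: "\<psi> holomorphic_on ball 0 1 - {0}" and a: "nt_deriv \<psi> x a"
  shows "\<exists>p. (\<lambda>n. \<psi> (radial x n)) \<longlonglongrightarrow> p"
proof -
  obtain \<eta> where \<eta>: "0 < \<eta>" "\<eta> \<le> 1/2" "\<And>w. w \<in> stolz (cis x) 2 \<Longrightarrow> dist w (cis x) < \<eta> \<Longrightarrow> norm (deriv \<psi> w - a) \<le> 1"
    using nt_derivD[OF a, of 2 1] by auto
  define C where "C = stolz (cis x) 2 \<inter> ball (cis x) \<eta>"
  have convC: "convex C" unfolding C_def by (intro convex_Int convex_stolz) auto
  have op: "open (ball 0 1 - {0::complex})" by auto
  have CD: "z \<in> ball 0 1 - {0}" if "z \<in> C" for z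
    by (rule stolz_near_punctured[of z x 2]) (use that \<eta> in \<open>auto simp: C_def dist_commute\<close>)
  have est: "norm (\<psi> w - \<psi> z) \<le> (norm a + 1) * norm (w - z)" if "w \<in> C" "z \<in> C" for w z
  proof (rule field_differentiable_bound[OF convC _ _ that])
    fix y assume y: "y \<in> C"
    show "(\<psi> has_field_derivative deriv \<psi> y) (at y within C)"
      by (rule has_field_derivative_at_within[OF holomorphic_derivI[OF \<psi> op CD[OF y]]])
    have "norm (deriv \<psi> y - a) \<le> 1" by (rule \<eta>(3)) (use y in \<open>auto simp: C_def dist_commute\<close>)
    thus "norm (deriv \<psi> y) \<le> norm a + 1" using norm_triangle_ineq2[of "deriv \<psi> y" a] by linarith
  qed
  have inC: "\<forall>\<^sub>F n in sequentially. radial x n \<in> C"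
    using tendstoD[OF radial_lim \<eta>(1)]
    by eventually_elim (use radial_stolz[of 2] in \<open>auto simp: C_def dist_commute\<close>)
  then obtain N0 where N0: "\<And>n. n \<ge> N0 \<Longrightarrow> radial x n \<in> C" by (auto simp: eventually_sequentially)
  have "Cauchy (\<lambda>n. \<psi> (radial x n))"
  proof (rule metric_CauchyI)
    fix e :: real assume e: "e > 0"
    have ca: "Cauchy (radial x)" using radial_lim LIMSEQ_imp_Cauchy by blast
    have "e / (norm a + 1) > 0" using e by (simp add: add_nonneg_pos)
    from metric_CauchyD[OF ca this] obtain N1 where N1: "\<And>m n. m \<ge> N1 \<Longrightarrow> n \<ge> N1 \<Longrightarrow> dist (radial x m) (radial x n) < e / (norm a + 1)" by blast
    show "\<exists>M. \<forall>m\<ge>M. \<forall>n\<ge>M. dist (\<psi> (radial x m)) (\<psi> (radial x n)) < e"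
    proof (intro exI[of _ "max N0 N1"] allI impI)
      fix m n assume mn: "max N0 N1 \<le> m" "max N0 N1 \<le> n"
      have pos: "0 < norm a + 1" by (simp add: add_nonneg_pos)
      have "norm (\<psi> (radial x m) - \<psi> (radial x n)) \<le> (norm a + 1) * norm (radial x m - radial x n)"
        by (rule est) (use mn in \<open>auto intro!: N0\<close>)
      also have "\<dots> < (norm a + 1) * (e / (norm a + 1))"
        using N1[of m n] mn pos by (intro mult_strict_left_mono) (auto simp: dist_norm)
      also have "\<dots> = e" using pos by simp
      finally show "dist (\<psi> (radial x m)) (\<psi> (radial x n)) < e" by (simp add: dist_norm)
    qed
  qed
  thus ?thesis by (auto simp: Cauchy_convergent_iff convergent_def)
qed

lemma nt_deriv_approx:
  assumes \<psi>: "\<psi> holomorphic_on ball 0 1 - {0}" and a: "nt_deriv \<psi> x a"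
    and p: "(\<lambda>n. \<psi> (radial x n)) \<longlonglongrightarrow> p" and \<epsilon>: "0 < \<epsilon>"
  obtains \<eta> where "0 < \<eta>" "\<eta> \<le> 1/2"
    "\<And>w. w \<in> stolz (cis x) M \<Longrightarrow> dist w (cis x) < \<eta> \<Longrightarrow> norm (\<psi> w - p - a * (w - cis x)) \<le> \<epsilon> * dist w (cis x)"
proof -
  \<comment> \<open>The cone is widened, if necessary, so that it contains the radial
    sequence.\<close>
  define M' where "M' = max M 2"
  have M': "1 < M'" "0 < M'" "M \<le> M'" by (auto simp: M'_def)
  obtain \<eta> where \<eta>: "0 < \<eta>" "\<eta> \<le> 1/2" "\<And>w. w \<in> stolz (cis x) M' \<Longrightarrow> dist w (cis x) < \<eta> \<Longrightarrow> norm (deriv \<psi> w - a) \<le> \<epsilon>"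
    using nt_derivD[OF a M'(2) \<epsilon>] by blast
  show ?thesis
  proof (rule that[OF \<eta>(1,2)])
    fix w assume w: "w \<in> stolz (cis x) M" "dist w (cis x) < \<eta>"
    have "w \<in> stolz (cis x) M'" using w stolz_mono[OF M'(3)] by blast
    from cone_approx[OF \<psi> M'(1) \<eta>(1,2) \<eta>(3) p this w(2)]
    show "norm (\<psi> w - p - a * (w - cis x)) \<le> \<epsilon> * dist w (cis x)" .
  qed
qed

text \<open>A disk of radius comparable to its distance from the boundary point lies in a Stolz cone, and
  there \<open>\<psi>\<close> is nearly affine; the covering lemma behind Bloch's theorem then gives a disk in the image.\<close>
lemma nt_deriv_covers:
  assumes \<psi>: "\<psi> holomorphic_on ball 0 1 - {0}" and a: "nt_deriv \<psi> x a" "a \<noteq> 0"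
    and p: "(\<lambda>n. \<psi> (radial x n)) \<longlonglongrightarrow> p" and \<xi>: "0 < Re \<xi>"
  shows "\<exists>\<beta>>0. \<exists>M>0. \<exists>t0>0. \<forall>t. 0 < t \<longrightarrow> t < t0 \<longrightarrow>
    ball (p - a * cis x * \<xi> * of_real t) (\<beta> * t) \<subseteq>
      \<psi> ` {w \<in> stolz (cis x) M. dist w (cis x) \<le> 2 * norm \<xi> * t \<and> w \<noteq> 0}"
proof -
  let ?e = "cis x"
  define R where "R = Re \<xi>"
  have R: "0 < R" "R \<le> norm \<xi>" using \<xi> complex_Re_le_cmod[of \<xi>] by (auto simp: R_def)
  have n\<xi>: "0 < norm \<xi>" using R by linarith
  \<comment> \<open>The centre \<open>wt\<close> has depth at least \<open>R * t / 2\<close> below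
    the circle; a disk of radius \<open>R * t / 4\<close> about it uses up half of that. Its points
    are within \<open>5 / 4 * norm \<xi> * t\<close> of the vertex, so any aperture above
    \<open>5 * norm \<xi> / R\<close> would serve.\<close>
  define \<rho> where "\<rho> = R / 4"
  define M where "M = 9 * norm \<xi> / R"
  define \<beta> where "\<beta> = \<rho> * norm a / 20"
  have na: "0 < norm a" using a by simp
  have pos: "0 < \<rho>" "0 < M" "0 < \<beta>" using R n\<xi> na by (auto simp: \<rho>_def M_def \<beta>_def)
  obtain \<eta>1 where \<eta>1: "0 < \<eta>1" "\<eta>1 \<le> 1/2" "\<And>w. w \<in> stolz ?e M \<Longrightarrow> dist w ?e < \<eta>1 \<Longrightarrow> norm (deriv \<psi> w - a) \<le> norm a / 4"
    using nt_derivD[OF a(1) pos(2), of "norm a / 4"] na by auto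
  have "0 < \<beta> / norm \<xi>" using pos n\<xi> by simp
  from nt_deriv_approx[OF \<psi> a(1) p this, where M=M]
  obtain \<eta>2 where \<eta>2: "0 < \<eta>2" "\<eta>2 \<le> 1/2"
    "\<And>w. w \<in> stolz ?e M \<Longrightarrow> dist w ?e < \<eta>2 \<Longrightarrow> norm (\<psi> w - p - a * (w - ?e)) \<le> \<beta> / norm \<xi> * dist w ?e" by blast
  define \<eta> where "\<eta> = min \<eta>1 \<eta>2"
  have \<eta>: "0 < \<eta>" "\<eta> \<le> 1/2" using \<eta>1 \<eta>2 by (auto simp: \<eta>_def)
  \<comment> \<open>In turn: this keeps \<open>1 - t * R / 2\<close> positive, absorbs the quadratic
    term in the modulus of \<open>1 - t * \<xi>\<close>, and keeps the disk where both
    approximations hold.\<close>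
  define t0 where "t0 = min (min (1 / R) (R / (norm \<xi>)\<^sup>2)) (\<eta> / (2 * norm \<xi>))"
  have t0: "0 < t0" using R n\<xi> \<eta> by (simp add: t0_def)
  have main: "ball (p - a * ?e * \<xi> * of_real t) (\<beta> * t) \<subseteq>
      \<psi> ` {w \<in> stolz ?e M. dist w ?e \<le> 2 * norm \<xi> * t \<and> w \<noteq> 0}" if t: "0 < t" "t < t0" for t
  proof -
    have t1: "t * R < 1" using t R by (simp add: t0_def pos_less_divide_eq)
    have t2: "t * (norm \<xi>)\<^sup>2 < R" using t n\<xi> by (simp add: t0_def pos_less_divide_eq)
    have t3: "2 * norm \<xi> * t < \<eta>" using t n\<xi> by (simp add: t0_def pos_less_divide_eq mult_ac)
    define wt where "wt = ?e * (1 - of_real t * \<xi>)"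
    have nwt: "norm wt \<le> 1 - t * R / 2"
    proof -
      have "(norm (1 - of_real t * \<xi>))\<^sup>2 = 1 - 2 * t * R + t * (t * (norm \<xi>)\<^sup>2)"
        unfolding cmod_power2 by (simp add: R_def power2_eq_square algebra_simps)
      also have "\<dots> \<le> 1 - 2 * t * R + t * R" using t2 t by simp
      also have "\<dots> \<le> (1 - t * R / 2)\<^sup>2"
        using zero_le_power2[of "t * R / 2"] by (simp add: power2_eq_square algebra_simps)
      finally have "norm (1 - of_real t * \<xi>) \<le> 1 - t * R / 2"
        by (rule power2_le_imp_le) (use t1 in simp)
      thus ?thesis by (simp add: wt_def norm_mult)
    qed
    have wte: "wt - ?e = - (?e * \<xi> * of_real t)" by (simp add: wt_def algebra_simps)
    hence dwt: "norm (wt - ?e) = norm \<xi> * t" using t by (simp add: norm_mult)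
    have inC: "w \<in> stolz ?e M" "dist w ?e \<le> 2 * norm \<xi> * t" "w \<noteq> 0" if w: "w \<in> cball wt (\<rho> * t)" for w
    proof -
      have d: "norm (w - wt) \<le> R * t / 4" using w by (simp add: dist_norm norm_minus_commute \<rho>_def)
      have "norm w \<le> norm wt + norm (w - wt)" using norm_triangle_ineq[of wt "w - wt"] by simp
      hence nw: "R * t / 4 \<le> 1 - norm w" using nwt d by (simp add: mult.commute)
      have Rt: "R * t \<le> norm \<xi> * t" using R t by (intro mult_right_mono) auto
      have "norm (w - ?e) \<le> norm (w - wt) + norm (wt - ?e)" using norm_triangle_ineq[of "w - wt" "wt - ?e"] by simp
      hence de: "norm (w - ?e) \<le> 5 / 4 * (norm \<xi> * t)" using d dwt Rt by simp
      have xt: "0 < norm \<xi> * t" using n\<xi> t by simp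
      thus d2: "dist w ?e \<le> 2 * norm \<xi> * t" using de by (simp add: dist_norm)
      have "norm (w - ?e) < 9 / 4 * (norm \<xi> * t)" using de xt by linarith
      also have "\<dots> = M * (R * t / 4)" using R by (simp add: M_def)
      also have "\<dots> \<le> M * (1 - norm w)" using nw pos by (intro mult_left_mono) auto
      finally have "norm (w - ?e) < M * (1 - norm w)" .
      moreover have "0 < R * t" using R t by simp
      hence "norm w < 1" using nw by linarith
      ultimately show "w \<in> stolz ?e M" by (simp add: stolz_def)
      have "dist w ?e < 1" using d2 t3 \<eta> by linarith
      thus "w \<noteq> 0" by auto
    qed
    have near: "dist w ?e < \<eta>" if w: "w \<in> cball wt (\<rho> * t)" for w using inC(2)[OF w] t3 by linarith
    have wtin: "wt \<in> cball wt (\<rho> * t)" using pos t by simp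
    have rt: "0 < \<rho> * t" using pos t by simp
    have dle: "norm (deriv \<psi> w - a) \<le> norm a / 4" if w: "w \<in> cball wt (\<rho> * t)" for w
      by (rule \<eta>1(3)[OF inC(1)[OF w]]) (use near[OF w] in \<open>simp add: \<eta>_def\<close>)
    have lowd: "3 / 4 * norm a \<le> norm (deriv \<psi> wt)"
      using dle[OF wtin] norm_triangle_ineq3[of "deriv \<psi> wt" a] by linarith
    have bloch: "ball (\<psi> wt) ((3 - 2 * sqrt 2) * (\<rho> * t) * norm (deriv \<psi> wt)) \<subseteq> \<psi> ` ball wt (\<rho> * t)"
    proof (rule Bloch_lemma[OF _ rt])
      have "cball wt (\<rho> * t) \<subseteq> ball 0 1 - {0}"
      proof
        fix w assume "w \<in> cball wt (\<rho> * t)"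
        from inC(1)[OF this] inC(3)[OF this] show "w \<in> ball 0 1 - {0}" by (simp add: stolz_def)
      qed
      thus "\<psi> holomorphic_on cball wt (\<rho> * t)" by (rule holomorphic_on_subset[OF \<psi>])
      fix z assume "z \<in> ball wt (\<rho> * t)"
      hence "z \<in> cball wt (\<rho> * t)" by simp
      from dle[OF this] have "norm (deriv \<psi> z) \<le> 5 / 4 * norm a"
        using norm_triangle_ineq2[of "deriv \<psi> z" a] by linarith
      thus "norm (deriv \<psi> z) \<le> 2 * norm (deriv \<psi> wt)" using lowd na by linarith
    qed
    \<comment> \<open>\<open>3 - 2 * sqrt 2\<close> is at least \<open>14/100\<close> and the
      derivative at \<open>wt\<close> is at least \<open>10/14\<close> of \<open>norm a\<close>;
      this accounts for the 20 in \<open>\<beta>\<close>. The factor 2 pays for moving the centre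
      from \<open>\<psi> wt\<close> to its affine approximation.\<close>
    have rad: "2 * (\<beta> * t) \<le> (3 - 2 * sqrt 2) * (\<rho> * t) * norm (deriv \<psi> wt)"
    proof -
      have s: "sqrt 2 \<le> 143 / 100" by (rule real_le_lsqrt) (auto simp: power2_eq_square)
      have "2 * (\<beta> * t) = (14/100 * (\<rho> * t)) * (10/14 * norm a)" by (simp add: \<beta>_def)
      also have "\<dots> \<le> ((3 - 2 * sqrt 2) * (\<rho> * t)) * norm (deriv \<psi> wt)"
      proof (rule mult_mono)
        show A: "14/100 * (\<rho> * t) \<le> (3 - 2 * sqrt 2) * (\<rho> * t)"
          by (rule mult_right_mono) (use s rt in linarith)+
        show "10/14 * norm a \<le> norm (deriv \<psi> wt)" using lowd na by linarith
        show "0 \<le> (3 - 2 * sqrt 2) * (\<rho> * t)" using A rt by linarith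
      qed simp
      finally show ?thesis .
    qed
    have "norm (\<psi> wt - p - a * (wt - ?e)) \<le> \<beta> / norm \<xi> * dist wt ?e"
      by (rule \<eta>2(3)[OF inC(1)[OF wtin]]) (use near[OF wtin] in \<open>simp add: \<eta>_def\<close>)
    also have "\<dots> = \<beta> * t" using n\<xi> by (simp add: dist_norm dwt)
    also have "\<psi> wt - p - a * (wt - ?e) = \<psi> wt - (p - a * ?e * \<xi> * of_real t)"
      unfolding wte by (simp add: algebra_simps)
    finally have c: "norm (\<psi> wt - (p - a * ?e * \<xi> * of_real t)) \<le> \<beta> * t" .
    show ?thesis
    proof
      fix z assume z: "z \<in> ball (p - a * ?e * \<xi> * of_real t) (\<beta> * t)"
      have "dist (\<psi> wt) z \<le> dist (\<psi> wt) (p - a * ?e * \<xi> * of_real t) + dist (p - a * ?e * \<xi> * of_real t) z"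
        by (rule dist_triangle)
      also have "\<dots> < \<beta> * t + \<beta> * t" using c z by (intro add_le_less_mono) (auto simp: dist_norm)
      finally have "z \<in> ball (\<psi> wt) ((3 - 2 * sqrt 2) * (\<rho> * t) * norm (deriv \<psi> wt))" using rad by simp
      then obtain w where w: "w \<in> ball wt (\<rho> * t)" "z = \<psi> w" using bloch by blast
      hence "w \<in> cball wt (\<rho> * t)" by simp
      from inC[OF this] show "z \<in> \<psi> ` {w \<in> stolz ?e M. dist w ?e \<le> 2 * norm \<xi> * t \<and> w \<noteq> 0}"
        using w(2) by blast
    qed
  qed
  show ?thesis
    by (rule exI[of _ \<beta>], rule conjI[OF pos(3)], rule exI[of _ M], rule conjI[OF pos(2)], rule exI[of _ t0], rule conjI[OF t0])
       (intro allI impI main)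
qed

section \<open>Arclength and harmonic measure\<close>

text \<open>The derivative stays within ten percent of a model value \<open>q\<close> on a cone of
  fixed size. Aperture 4 lets the cones at two nearby vertices share a suitable point. Since no
  limit of the derivative is mentioned, the set is closed without any measurability
  argument.\<close>

definition piece :: "(complex \<Rightarrow> complex) \<Rightarrow> complex \<Rightarrow> nat \<Rightarrow> real set" where
  "piece \<psi> q n = {x. \<forall>w\<in>stolz (cis x) 4. dist w (cis x) < 1 / (real n + 2) \<longrightarrow> norm (deriv \<psi> w - q) \<le> norm q / 10}"

text \<open>For fixed \<open>w\<close>, lying in the open truncated cone is an open condition on its
  vertex, so the set is an intersection of closed sets.\<close>

lemma closed_piece: "closed (piece \<psi> q n)"
proof -
  have eq: "piece \<psi> q n = (\<Inter>w\<in>{w. \<not> norm (deriv \<psi> w - q) \<le> norm q / 10}. - {x. w \<in> stolz (cis x) 4 \<and> dist w (cis x) < 1 / (real n + 2)})"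
    by (auto simp: piece_def)
  have "open {x. w \<in> stolz (cis x) 4 \<and> dist w (cis x) < 1 / (real n + 2)}" for w
    unfolding stolz_def mem_Collect_eq
    by (intro open_Collect_conj open_Collect_less open_Collect_const continuous_intros)
  thus ?thesis unfolding eq by (intro closed_INT ballI closed_Compl)
qed

text \<open>With \<open>d\<close> the chord, the point at depth \<open>d\<close> below
  \<open>cis x\<close> is within \<open>2 * d\<close> of \<open>cis y\<close> and lies in both
  cones. Approximating \<open>\<psi>\<close> there from the two vertices costs
  \<open>norm q * d / 10\<close> and \<open>norm q * 2 * d / 10\<close>, so the images differ by
  \<open>q\<close> times the chord up to 30 percent. The constants 3 also absorb the passage from
  chord to angle.\<close>

lemma piece_bilipschitz:
  assumes \<psi>: "\<psi> holomorphic_on ball 0 1 - {0}"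
    and x: "x \<in> piece \<psi> q n" "y \<in> piece \<psi> q n" and q: "q \<noteq> 0"
    and P: "(\<lambda>n. \<psi> (radial x n)) \<longlonglongrightarrow> Px" "(\<lambda>n. \<psi> (radial y n)) \<longlonglongrightarrow> Py"
    and near: "\<bar>x - y\<bar> < 1 / (2 * (real n + 2))"
  shows "\<bar>x - y\<bar> \<le> 3 / norm q * norm (Px - Py)" and "norm (Px - Py) \<le> 3 * norm q * \<bar>x - y\<bar>"
proof -
  define d where "d = norm (cis x - cis y)"
  have near1: "\<bar>x - y\<bar> < 1"
  proof (rule order_less_trans[OF near])
    show "1 / (2 * (real n + 2)) < 1" by (simp add: field_simps)
  qed
  have dxy: "d \<le> \<bar>x - y\<bar>" and xyd: "\<bar>x - y\<bar> \<le> 2 * d"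
    using cis_diff_bounds[of x y] near1 by (auto simp: d_def)
  have main: "norm (Px - Py - q * (cis x - cis y)) \<le> 3/10 * norm q * d"
  proof (cases "d = 0")
    case True
    hence "cis x = cis y" by (simp add: d_def)
    hence "radial x = radial y" by (auto simp: radial_def fun_eq_iff)
    hence "Px = Py" using P LIMSEQ_unique by metis
    thus ?thesis using \<open>cis x = cis y\<close> by (simp add: d_def)
  next
    case False
    hence d0: "0 < d" by (simp add: d_def)
    have eq: "1 / (2 * (real n + 2)) = (1 / (real n + 2)) / 2" by simp
    have "d < (1 / (real n + 2)) / 2" unfolding eq[symmetric] using dxy near by (rule order_le_less_trans)
    hence "d * 2 < 1 / (real n + 2)" by (simp only: pos_less_divide_eq[OF zero_less_numeral])
    hence d2: "2 * d < 1 / (real n + 2)" by (simp only: mult.commute)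
    have n2: "1 / (real n + 2) \<le> 1/2" by (simp add: field_simps)
    have d1: "d < 1" using d2 n2 by linarith
    define w where "w = of_real (1 - d) * cis x"
    have wx: "w - cis x = - (of_real d * cis x)" by (simp add: w_def algebra_simps)
    have nwx: "dist w (cis x) = d" unfolding dist_norm wx using d0 by (simp add: norm_mult)
    have nw: "norm w = 1 - d" unfolding w_def norm_mult norm_of_real norm_cis using d1 by simp
    have nwy: "dist w (cis y) \<le> 2 * d"
      using dist_triangle[of w "cis y" "cis x"] nwx by (simp add: d_def dist_norm)
    have wx4: "w \<in> stolz (cis x) 4" using nwx d0 by (simp add: stolz_def nw dist_norm)
    have wy4: "w \<in> stolz (cis y) 4" using nwy d0 by (simp add: stolz_def nw dist_norm)
    have r: "0 < 1 / (real n + 2)" by simp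
    have A: "norm (\<psi> w - Px - q * (w - cis x)) \<le> norm q / 10 * dist w (cis x)"
      by (rule cone_approx[OF \<psi> _ r n2 _ P(1) wx4]) (use x(1) nwx d2 d0 in \<open>auto simp: piece_def\<close>)
    have B: "norm (\<psi> w - Py - q * (w - cis y)) \<le> norm q / 10 * dist w (cis y)"
      by (rule cone_approx[OF \<psi> _ r n2 _ P(2) wy4]) (use x(2) nwy d2 d0 in \<open>auto simp: piece_def\<close>)
    have "Px - Py - q * (cis x - cis y) = (\<psi> w - Py - q * (w - cis y)) - (\<psi> w - Px - q * (w - cis x))"
      by (simp add: algebra_simps)
    hence "norm (Px - Py - q * (cis x - cis y)) \<le> norm (\<psi> w - Py - q * (w - cis y)) + norm (\<psi> w - Px - q * (w - cis x))"
      using norm_triangle_ineq4 by metis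
    also have "\<dots> \<le> norm q / 10 * (2 * d) + norm q / 10 * d"
    proof (rule add_mono)
      show "norm (\<psi> w - Py - q * (w - cis y)) \<le> norm q / 10 * (2 * d)"
        by (rule order_trans[OF B mult_left_mono[OF nwy]]) simp
      show "norm (\<psi> w - Px - q * (w - cis x)) \<le> norm q / 10 * d" using A by (simp only: nwx)
    qed
    finally show ?thesis by (simp add: algebra_simps)
  qed
  have nq: "norm (q * (cis x - cis y)) = norm q * d" by (simp add: norm_mult d_def)
  have low: "7/10 * (norm q * d) \<le> norm (Px - Py)" and up: "norm (Px - Py) \<le> 13/10 * (norm q * d)"
    using main nq norm_triangle_ineq2[of "q * (cis x - cis y)" "Px - Py"] norm_triangle_ineq2[of "Px - Py" "q * (cis x - cis y)"]
      norm_minus_commute[of "Px - Py" "q * (cis x - cis y)"] by auto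
  have q0: "0 < norm q" using q by simp
  have "norm q * \<bar>x - y\<bar> \<le> norm q * (2 * d)" using xyd q0 by (intro mult_left_mono) auto
  also have "\<dots> \<le> 3 * norm (Px - Py)" 
  proof -
    have "norm q * (2 * d) = 2 * (norm q * d)" by simp
    thus ?thesis using low norm_ge_zero[of "Px - Py"] by linarith
  qed
  finally show "\<bar>x - y\<bar> \<le> 3 / norm q * norm (Px - Py)" using q0 by (simp add: field_simps)
  have "norm q * d \<le> norm q * \<bar>x - y\<bar>" using dxy by (intro mult_left_mono) auto
  moreover have "0 \<le> norm q * \<bar>x - y\<bar>" by simp
  moreover have "3 * norm q * \<bar>x - y\<bar> = 3 * (norm q * \<bar>x - y\<bar>)" by simp
  ultimately show "norm (Px - Py) \<le> 3 * norm q * \<bar>x - y\<bar>" using up by linarith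
qed

text \<open>The index runs over a dense set of nonzero \<open>q\<close>, cone sizes, and intervals
  of angles whose length \<open>1 / (4 * (n + 2))\<close> is below what the bi-Lipschitz estimate
  requires.\<close>

lemma countable_pieces:
  fixes \<psi> :: "complex \<Rightarrow> complex"
  obtains X :: "nat \<Rightarrow> real set" and q :: "nat \<Rightarrow> complex" where
    "\<And>i. compact (X i)" "\<And>i. q i \<noteq> 0"
    "\<And>x a. x \<in> {0<..<2*pi} \<Longrightarrow> nt_deriv \<psi> x a \<Longrightarrow> a \<noteq> 0 \<Longrightarrow> \<exists>i. x \<in> X i"
    "\<And>i x a. x \<in> X i \<Longrightarrow> nt_deriv \<psi> x a \<Longrightarrow> norm a \<le> 2 * norm (q i)"
    "\<And>i x y Px Py. \<psi> holomorphic_on ball 0 1 - {0} \<Longrightarrow> x \<in> X i \<Longrightarrow> y \<in> X i \<Longrightarrow>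
       (\<lambda>n. \<psi> (radial x n)) \<longlonglongrightarrow> Px \<Longrightarrow> (\<lambda>n. \<psi> (radial y n)) \<longlonglongrightarrow> Py \<Longrightarrow>
       \<bar>x - y\<bar> \<le> 3 / norm (q i) * norm (Px - Py) \<and> norm (Px - Py) \<le> 3 * norm (q i) * \<bar>x - y\<bar>"
proof -
  obtain D :: "complex set" where D: "countable D" "\<And>S. open S \<Longrightarrow> S \<noteq> {} \<Longrightarrow> \<exists>d\<in>D. d \<in> S"
    by (erule countable_dense_setE)
  define I where "I = (D - {0}) \<times> (UNIV :: nat set) \<times> (UNIV :: nat set)"
  have cI: "countable I" unfolding I_def using D(1) by auto
  obtain d1 where d1: "d1 \<in> D" "d1 \<in> ball (5::complex) 1" using D(2)[of "ball 5 1"] by auto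
  have "d1 \<noteq> 0" using d1(2) by (auto simp: dist_norm)
  hence neI: "I \<noteq> {}" using d1 by (auto simp: I_def)
  define ix where "ix = from_nat_into I"
  have ixI: "ix i \<in> I" for i unfolding ix_def by (rule from_nat_into[OF neI])
  have ixs: "\<exists>i. ix i = p" if "p \<in> I" for p unfolding ix_def using from_nat_into_surj[OF cI that] by auto
  define Xf where "Xf p = (case p of (q, n, j) \<Rightarrow> piece \<psi> q n \<inter> {real j / (4 * (real n + 2)) .. (real j + 1) / (4 * (real n + 2))})" for p :: "complex \<times> nat \<times> nat"
  show ?thesis
  proof (rule that[of "\<lambda>i. Xf (ix i)" "\<lambda>i. fst (ix i)"])
    show "compact (Xf (ix i))" for i
      by (auto simp: Xf_def split: prod.split intro!: closed_Int_compact closed_piece)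
    show "fst (ix i) \<noteq> 0" for i using ixI[of i] by (auto simp: I_def)
    fix x a assume x: "x \<in> {0<..<2*pi}" and a: "nt_deriv \<psi> x a" "a \<noteq> 0"
    have na: "0 < norm a" using a by simp
    \<comment> \<open>An error of \<open>norm a / 40\<close> is at most \<open>norm q / 20\<close>
      once \<open>a\<close> is exchanged for \<open>q\<close>; with the \<open>norm q / 20\<close>
      from the cone limit this stays within ten percent.\<close>
    obtain q where q: "q \<in> D" "q \<in> ball a (norm a / 40)" using D(2)[of "ball a (norm a / 40)"] na by auto
    have aq: "norm (a - q) < norm a / 40" using q by (simp add: dist_norm)
    have nq: "norm a \<le> norm q + norm a / 40" using aq norm_triangle_ineq2[of a q] by linarith
    have q0: "0 < norm q" using nq na by linarith
    have q20: "0 < norm q / 20" using q0 by simp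
    have z4: "(0::real) < 4" by simp
    obtain \<eta> where \<eta>: "0 < \<eta>" "\<And>w. w \<in> stolz (cis x) 4 \<Longrightarrow> dist w (cis x) < \<eta> \<Longrightarrow> norm (deriv \<psi> w - a) \<le> norm q / 20"
      using nt_derivD[OF a(1) z4 q20] by blast
    obtain n :: nat where n: "1 / (real n + 1) < \<eta>" using \<eta>(1) by (metis nat_approx_posE of_nat_Suc add.commute)
    have n': "1 / (real n + 2) < \<eta>" by (rule order_le_less_trans[OF _ n]) (simp add: frac_le)
    have xp: "x \<in> piece \<psi> q n" unfolding piece_def mem_Collect_eq
    proof (intro ballI impI)
      fix w assume w: "w \<in> stolz (cis x) 4" "dist w (cis x) < 1 / (real n + 2)"
      have "norm (deriv \<psi> w - a) \<le> norm q / 20" by (rule \<eta>(2)) (use w n' in auto)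
      moreover have "norm (deriv \<psi> w - q) \<le> norm (deriv \<psi> w - a) + norm (a - q)"
        using norm_triangle_ineq[of "deriv \<psi> w - a" "a - q"] by simp
      ultimately show "norm (deriv \<psi> w - q) \<le> norm q / 10" using aq nq norm_ge_zero[of q] by linarith
    qed
    define j where "j = nat \<lfloor>x * (4 * (real n + 2))\<rfloor>"
    have "real j \<le> x * (4 * (real n + 2))" "x * (4 * (real n + 2)) \<le> real j + 1"
      using x by (auto simp: j_def of_nat_nat)
    hence "x \<in> {real j / (4 * (real n + 2)) .. (real j + 1) / (4 * (real n + 2))}"
      by (simp add: pos_divide_le_eq pos_le_divide_eq)
    hence "x \<in> Xf (q, n, j)" using xp by (simp add: Xf_def)
    moreover have "(q, n, j) \<in> I" using q q0 by (auto simp: I_def)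
    ultimately show "\<exists>i. x \<in> Xf (ix i)" using ixs by metis
  next
    fix i x a assume x: "x \<in> Xf (ix i)" and a: "nt_deriv \<psi> x a"
    obtain q n j where ie: "ix i = (q, n, j)" by (cases "ix i") auto
    have xp: "x \<in> piece \<psi> q n" using x by (simp add: ie Xf_def)
    have "q \<noteq> 0" using ixI[of i] by (auto simp: I_def ie)
    hence q0: "0 < norm q" by simp
    have q20: "0 < norm q / 20" using q0 by simp
    have z4: "(0::real) < 4" by simp
    obtain \<eta> where \<eta>: "0 < \<eta>" "\<And>w. w \<in> stolz (cis x) 4 \<Longrightarrow> dist w (cis x) < \<eta> \<Longrightarrow> norm (deriv \<psi> w - a) \<le> norm q / 20"
      using nt_derivD[OF a(1) z4 q20] by blast
    have "0 < min \<eta> (1 / (real n + 2))" using \<eta>(1) by simp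
    from eventually_happens'[OF sequentially_bot tendstoD[OF radial_lim[of x] this]]
    obtain m where m: "dist (radial x m) (cis x) < min \<eta> (1 / (real n + 2))" by (elim exE)
    have r: "radial x m \<in> stolz (cis x) 4" by (rule radial_stolz) simp
    have "norm (deriv \<psi> (radial x m) - a) \<le> norm q / 20" by (rule \<eta>(2)[OF r]) (use m in simp)
    moreover have "norm (deriv \<psi> (radial x m) - q) \<le> norm q / 10" using xp r m by (simp add: piece_def)
    ultimately show "norm a \<le> 2 * norm (fst (ix i))"
      using norm_triangle_ineq[of "deriv \<psi> (radial x m) - q" "q"] norm_triangle_ineq3[of "deriv \<psi> (radial x m)" a] q0
      by (simp add: ie abs_le_iff)
  next
    fix i x y Px Py assume \<psi>: "\<psi> holomorphic_on ball 0 1 - {0}" and x: "x \<in> Xf (ix i)" and y: "y \<in> Xf (ix i)"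
      and P: "(\<lambda>n. \<psi> (radial x n)) \<longlonglongrightarrow> Px" "(\<lambda>n. \<psi> (radial y n)) \<longlonglongrightarrow> Py"
    obtain q n j where ie: "ix i = (q, n, j)" by (cases "ix i") auto
    have q: "q \<noteq> 0" using ixI[of i] by (auto simp: I_def ie)
    have xp: "x \<in> piece \<psi> q n" "y \<in> piece \<psi> q n" using x y by (auto simp: ie Xf_def)
    have "\<bar>x - y\<bar> \<le> (real j + 1) / (4 * (real n + 2)) - real j / (4 * (real n + 2))"
      using x y by (auto simp: ie Xf_def)
    also have "\<dots> = 1 / (4 * (real n + 2))" by (simp add: diff_divide_distrib[symmetric])
    also have "\<dots> < 1 / (2 * (real n + 2))" by (rule divide_strict_left_mono) auto
    finally have near: "\<bar>x - y\<bar> < 1 / (2 * (real n + 2))" .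
    show "\<bar>x - y\<bar> \<le> 3 / norm (fst (ix i)) * norm (Px - Py) \<and> norm (Px - Py) \<le> 3 * norm (fst (ix i)) * \<bar>x - y\<bar>"
      using piece_bilipschitz[OF \<psi> xp q P near] by (simp add: ie)
  qed
qed

section \<open>Comparison of angle and arclength\<close>

text \<open>The inequality makes \<open>\<tau>\<close> injective with a Lipschitz inverse, and
  Lipschitz maps preserve null sets; \<open>\<tau>\<close> itself may be wildly
  discontinuous.\<close>

lemma negligible_lipschitz_preimage:
  fixes \<tau> :: "real \<Rightarrow> real"
  assumes lip: "\<And>x y. x \<in> X \<Longrightarrow> y \<in> X \<Longrightarrow> \<bar>x - y\<bar> \<le> C * \<bar>\<tau> x - \<tau> y\<bar>"
    and neg: "negligible (\<tau> ` X)"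
  shows "negligible X"
proof -
  have inj: "inj_on \<tau> X" by (rule inj_onI) (use lip in fastforce)
  define \<sigma> where "\<sigma> = inv_into X \<tau>"
  have \<sigma>: "\<sigma> (\<tau> x) = x" if "x \<in> X" for x using that inj by (simp add: \<sigma>_def)
  have "negligible (\<sigma> ` (\<tau> ` X))"
  proof (rule negligible_locally_Lipschitz_image[OF _ neg])
    fix s assume "s \<in> \<tau> ` X"
    then obtain x where x: "x \<in> X" "s = \<tau> x" by blast
    have "\<forall>y\<in>\<tau> ` X \<inter> UNIV. norm (\<sigma> y - \<sigma> s) \<le> C * norm (y - s)"
      using lip x \<sigma> by auto
    thus "\<exists>T B. open T \<and> s \<in> T \<and> (\<forall>y\<in>\<tau> ` X \<inter> T. norm (\<sigma> y - \<sigma> s) \<le> B * norm (y - s))"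
      by (intro exI[of _ UNIV] exI[of _ C]) auto
  qed simp
  moreover have "\<sigma> ` (\<tau> ` X) = X" using \<sigma> by (auto simp: image_iff)
  ultimately show ?thesis by simp
qed

text \<open>The image is covered by nonoverlapping intervals of total length close to its measure.
  The hypothesis bounds the diameter of the part of \<open>X\<close> sent into one interval, so the
  hulls of these parts cover \<open>X\<close> with at most \<open>C\<close> times that
  length.\<close>

lemma lipschitz_preimage_measure:
  fixes \<tau> :: "real \<Rightarrow> real"
  assumes X: "compact X" and C: "0 \<le> C"
    and lip: "\<And>x y. x \<in> X \<Longrightarrow> y \<in> X \<Longrightarrow> \<bar>x - y\<bar> \<le> C * \<bar>\<tau> x - \<tau> y\<bar>"
    and S: "\<tau> ` X \<in> lmeasurable" "\<tau> ` X \<subseteq> {a..b}" and ab: "a < b"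
  shows "measure lebesgue X \<le> C * measure lebesgue (\<tau> ` X)"
proof -
  have Xm: "X \<in> lmeasurable" using X by (rule lmeasurable_compact)
  have "measure lebesgue X \<le> C * (measure lebesgue (\<tau> ` X) + \<epsilon>)" if \<epsilon>: "0 < \<epsilon>" for \<epsilon>
  proof -
    have Sb: "\<tau> ` X \<subseteq> cbox a b" using S(2) by simp
    obtain \<D> where D: "countable \<D>" "\<And>K. K \<in> \<D> \<Longrightarrow> K \<subseteq> cbox a b \<and> K \<noteq> {} \<and> (\<exists>c d. K = cbox c d)"
        "pairwise (\<lambda>A B. interior A \<inter> interior B = {}) \<D>"
        "\<tau> ` X \<subseteq> \<Union>\<D>" "\<Union>\<D> \<in> lmeasurable" "measure lebesgue (\<Union>\<D>) \<le> measure lebesgue (\<tau> ` X) + \<epsilon>"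
      by (rule measurable_outer_intervals_bounded[OF S(1) Sb \<epsilon>]) (rule that; blast)
    define K where "K n = (if n \<in> to_nat_on \<D> ` \<D> then from_nat_into \<D> n else {})" for n
    have K_D: "K n \<in> \<D> \<or> K n = {}" for n using D(1) by (auto simp: K_def)
    have K_UN: "(\<Union>n. K n) = \<Union>\<D>"
    proof
      show "(\<Union>n. K n) \<subseteq> \<Union>\<D>" using K_D by blast
      show "\<Union>\<D> \<subseteq> (\<Union>n. K n)"
      proof
        fix s assume "s \<in> \<Union>\<D>"
        then obtain k where k: "k \<in> \<D>" "s \<in> k" by blast
        have "K (to_nat_on \<D> k) = k" using k D(1) by (simp add: K_def)
        thus "s \<in> (\<Union>n. K n)" using k by blast
      qed
    qed
    have K_disj: "interior (K m) \<inter> interior (K n) = {}" if "m \<noteq> n" for m n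
    proof (cases "m \<in> to_nat_on \<D> ` \<D> \<and> n \<in> to_nat_on \<D> ` \<D>")
      case True
      then obtain k l where kl: "k \<in> \<D>" "l \<in> \<D>" "m = to_nat_on \<D> k" "n = to_nat_on \<D> l" by blast
      hence "k \<noteq> l" using that by auto
      thus ?thesis using D(3) kl D(1) by (simp add: K_def pairwise_def)
    qed (auto simp: K_def)
    have K_int: "\<exists>c d. K n = {c..d}" for n
    proof (cases "K n = {}")
      case True
      thus ?thesis by (intro exI[of _ "1::real"] exI[of _ "0::real"]) simp
    next
      case False
      hence "K n \<in> \<D>" using K_D by blast
      from D(2)[OF this] show ?thesis by auto
    qed
    \<comment> \<open>The interval hull of the part of \<open>X\<close> sent into
      \<open>K n\<close>. The empty case is separate because \<open>Inf\<close> and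
      \<open>Sup\<close> of the empty set carry no information.\<close>
    define J where "J n = (let A = {x \<in> X. \<tau> x \<in> K n} in if A = {} then {} else {Inf A..Sup A})" for n
    have J: "{x \<in> X. \<tau> x \<in> K n} \<subseteq> J n" "emeasure lborel (J n) \<le> ennreal C * emeasure lborel (interior (K n))" "J n \<in> sets lborel" for n
    proof -
      define A where "A = {x \<in> X. \<tau> x \<in> K n}"
      obtain c d where cd: "K n = {c..d}" using K_int by blast
      have "bounded A" by (rule bounded_subset[OF compact_imp_bounded[OF X]]) (auto simp: A_def)
      hence bdd: "bdd_above A" "bdd_below A" by (rule bounded_imp_bdd_above, rule bounded_imp_bdd_below)
      show "{x \<in> X. \<tau> x \<in> K n} \<subseteq> J n"
        using bdd by (auto simp: J_def Let_def A_def[symmetric] intro: cInf_lower cSup_upper)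
      show "J n \<in> sets lborel" by (auto simp: J_def Let_def)
      show "emeasure lborel (J n) \<le> ennreal C * emeasure lborel (interior (K n))"
      proof (cases "A = {}")
        case False
        hence "K n \<noteq> {}" by (auto simp: A_def)
        hence cd': "c \<le> d" by (auto simp: cd)
        have "x - y \<le> C * (d - c)" if "x \<in> A" "y \<in> A" for x y
        proof -
          have "x - y \<le> C * \<bar>\<tau> x - \<tau> y\<bar>" using lip[of x y] that by (auto simp: A_def)
          also have "\<dots> \<le> C * (d - c)" using that C by (intro mult_left_mono) (auto simp: A_def cd)
          finally show ?thesis .
        qed
        hence "x \<le> y + C * (d - c)" if "x \<in> A" "y \<in> A" for x y using that by (simp add: algebra_simps)
        hence "Sup A \<le> y + C * (d - c)" if "y \<in> A" for y using that False by (intro cSup_least) auto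
        hence "Sup A - C * (d - c) \<le> y" if "y \<in> A" for y using that by (simp add: algebra_simps)
        hence le: "Sup A - C * (d - c) \<le> Inf A" using False by (intro cInf_greatest) auto
        have "Inf A \<le> Sup A" using False bdd by (metis cInf_le_cSup)
        hence "emeasure lborel (J n) = ennreal (Sup A - Inf A)" using False by (simp add: J_def Let_def A_def[symmetric])
        also have "\<dots> \<le> ennreal (C * (d - c))" using le by (intro ennreal_leI) simp
        also have "\<dots> = ennreal C * emeasure lborel (interior (K n))"
          using C cd' by (simp add: cd interior_atLeastAtMost_real ennreal_mult)
        finally show ?thesis .
      qed (simp add: J_def Let_def A_def)
    qed
    have Xb: "X \<in> sets lborel" using X by (simp add: compact_imp_closed borel_closed)
    have "emeasure lborel X \<le> emeasure lborel (\<Union>n. J n)"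
    proof (rule emeasure_mono)
      show "X \<subseteq> (\<Union>n. J n)"
      proof
        fix x assume x: "x \<in> X"
        hence "\<tau> x \<in> (\<Union>n. K n)" using D(4) K_UN by blast
        then obtain n where "\<tau> x \<in> K n" by blast
        thus "x \<in> (\<Union>n. J n)" using J(1)[of n] x by blast
      qed
    qed (use J(3) in auto)
    also have "\<dots> \<le> (\<Sum>n. emeasure lborel (J n))" by (rule emeasure_subadditive_countably) (use J(3) in auto)
    also have "\<dots> \<le> (\<Sum>n. ennreal C * emeasure lborel (interior (K n)))" by (intro suminf_le J(2)) auto
    also have "\<dots> = ennreal C * (\<Sum>n. emeasure lborel (interior (K n)))" by (rule ennreal_suminf_cmult)
    also have "(\<Sum>n. emeasure lborel (interior (K n))) = emeasure lborel (\<Union>n. interior (K n))"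
      by (rule suminf_emeasure) (use K_disj in \<open>auto simp: disjoint_family_on_def\<close>)
    also have "emeasure lborel (\<Union>n. interior (K n)) = emeasure lebesgue (\<Union>n. interior (K n))"
      by simp
    finally have 1: "emeasure lborel X \<le> ennreal C * emeasure lebesgue (\<Union>n. interior (K n))" .
    have 2: "emeasure lebesgue (\<Union>n. interior (K n)) \<le> emeasure lebesgue (\<Union>\<D>)"
    proof (rule emeasure_mono)
      show "(\<Union>n. interior (K n)) \<subseteq> \<Union>\<D>" unfolding K_UN[symmetric] using interior_subset by blast
    qed (use D(5) in auto)
    have 3: "emeasure lebesgue (\<Union>\<D>) = ennreal (measure lebesgue (\<Union>\<D>))"
      using D(5) by (rule emeasure_eq_measure2)
    have "emeasure lebesgue X \<le> ennreal C * ennreal (measure lebesgue (\<tau> ` X) + \<epsilon>)"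
    proof -
      have "emeasure lebesgue X = emeasure lborel X" using Xb by simp
      also have "\<dots> \<le> ennreal C * emeasure lebesgue (\<Union>n. interior (K n))" by (rule 1)
      also have "\<dots> \<le> ennreal C * ennreal (measure lebesgue (\<tau> ` X) + \<epsilon>)"
        using order_trans[OF 2[unfolded 3] ennreal_leI[OF D(6)]] by (intro mult_left_mono) auto
      finally show ?thesis .
    qed
    also have "\<dots> = ennreal (C * (measure lebesgue (\<tau> ` X) + \<epsilon>))" using C \<epsilon> by (simp add: ennreal_mult)
    finally have "ennreal (measure lebesgue X) \<le> ennreal (C * (measure lebesgue (\<tau> ` X) + \<epsilon>))"
      using emeasure_eq_measure2[OF Xm] by simp
    thus ?thesis using C \<epsilon> by (subst (asm) ennreal_le_iff) auto
  qed
  hence lim: "measure lebesgue X \<le> C * measure lebesgue (\<tau> ` X) + C * \<epsilon>" if "0 < \<epsilon>" for \<epsilon>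
    using that by (simp add: distrib_left)
  show ?thesis
  proof (rule field_le_epsilon)
    fix e :: real assume e: "0 < e"
    have "C * (e / (C + 1)) \<le> e" using C e by (simp add: field_simps)
    moreover have "0 < e / (C + 1)" using C e by simp
    ultimately show "measure lebesgue X \<le> C * measure lebesgue (\<tau> ` X) + e" using lim[of "e / (C + 1)"] by linarith
  qed
qed

text \<open>The parameter of \<open>P x\<close> on \<open>\<gamma>\<close> is merely picked by
  choice. On one piece the lower bound for \<open>P\<close> and the upper bound for
  \<open>\<gamma>\<close> combine into a lower bound for the increments of this parameter, whatever
  the choice was.\<close>

lemma negligible_boundary_preimage:
  fixes P \<gamma> :: "real \<Rightarrow> complex" and X :: "nat \<Rightarrow> real set"
  assumes bil: "\<And>i x y. x \<in> X i \<Longrightarrow> y \<in> X i \<Longrightarrow> x \<in> G \<Longrightarrow> y \<in> G \<Longrightarrow> \<bar>x - y\<bar> \<le> c i * norm (P x - P y)"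
    and c: "\<And>i. 0 \<le> c i" and cover: "G \<subseteq> (\<Union>i. X i)"
    and lip: "\<And>s t. s \<in> {0..L} \<Longrightarrow> t \<in> {0..L} \<Longrightarrow> norm (\<gamma> s - \<gamma> t) \<le> \<bar>s - t\<bar>"
    and Z: "negligible Z"
  shows "negligible {x\<in>G. P x \<in> \<gamma> ` (Z \<inter> {0..L})}"
proof -
  define A where "A i = {x \<in> G \<inter> X i. P x \<in> \<gamma> ` (Z \<inter> {0..L})}" for i
  have "negligible (A i)" for i
  proof -
    define \<tau> where "\<tau> x = (SOME s. s \<in> Z \<inter> {0..L} \<and> P x = \<gamma> s)" for x
    have \<tau>: "\<tau> x \<in> Z \<inter> {0..L} \<and> P x = \<gamma> (\<tau> x)" if "x \<in> A i" for x
      unfolding \<tau>_def by (rule someI_ex) (use that in \<open>auto simp: A_def\<close>)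
    show ?thesis
    proof (rule negligible_lipschitz_preimage[where \<tau>=\<tau> and C="c i"])
      fix x y assume xy: "x \<in> A i" "y \<in> A i"
      have "\<bar>x - y\<bar> \<le> c i * norm (P x - P y)" by (rule bil) (use xy in \<open>auto simp: A_def\<close>)
      also have "\<dots> = c i * norm (\<gamma> (\<tau> x) - \<gamma> (\<tau> y))" using \<tau>[OF xy(1)] \<tau>[OF xy(2)] by simp
      also have "\<dots> \<le> c i * \<bar>\<tau> x - \<tau> y\<bar>"
        by (rule mult_left_mono[OF lip c]) (use \<tau>[OF xy(1)] \<tau>[OF xy(2)] in auto)
      finally show "\<bar>x - y\<bar> \<le> c i * \<bar>\<tau> x - \<tau> y\<bar>" .
    next
      show "negligible (\<tau> ` A i)" by (rule negligible_subset[OF Z]) (use \<tau> in blast)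
    qed
  qed
  hence "negligible (\<Union>i. A i)" by (rule negligible_Union_nat)
  moreover have "{x\<in>G. P x \<in> \<gamma> ` (Z \<inter> {0..L})} = (\<Union>i. A i)" using cover by (auto simp: A_def)
  ultimately show ?thesis by simp
qed

text \<open>On a piece \<open>\<kappa>\<close> is at most \<open>2 * q i\<close>, while angle is at
  most \<open>3 / q i\<close> times arclength, so \<open>q i\<close> cancels. Injectivity of
  \<open>P\<close> keeps the parameter sets of different pieces disjoint, and their lengths add up
  to at most \<open>L\<close>.\<close>

lemma boundary_length_bound:
  fixes P \<gamma> :: "real \<Rightarrow> complex" and X :: "nat \<Rightarrow> real set" and q :: "nat \<Rightarrow> real"
  assumes X: "\<And>i. compact (X i)" and q: "\<And>i. 0 < q i"
    and G: "G \<in> sets lebesgue" "G \<subseteq> (\<Union>i. X i)" "G \<subseteq> {0..2*pi}"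
    and bil1: "\<And>i x y. x \<in> X i \<Longrightarrow> y \<in> X i \<Longrightarrow> x \<in> G \<Longrightarrow> y \<in> G \<Longrightarrow> \<bar>x - y\<bar> \<le> 3 / q i * norm (P x - P y)"
    and bil2: "\<And>i x y. x \<in> X i \<Longrightarrow> y \<in> X i \<Longrightarrow> x \<in> G \<Longrightarrow> y \<in> G \<Longrightarrow> norm (P x - P y) \<le> 3 * q i * \<bar>x - y\<bar>"
    and \<kappa>: "\<And>i x. x \<in> X i \<Longrightarrow> x \<in> G \<Longrightarrow> \<kappa> x \<le> 2 * q i" "\<kappa> \<in> borel_measurable lebesgue"
    and lip: "\<And>s t. s \<in> {0..L} \<Longrightarrow> t \<in> {0..L} \<Longrightarrow> norm (\<gamma> s - \<gamma> t) \<le> \<bar>s - t\<bar>"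
    and inj: "inj_on \<gamma> {0..<L}" "\<gamma> 0 = \<gamma> L" and L: "0 < L"
    and P\<gamma>: "\<And>x. x \<in> G \<Longrightarrow> \<exists>t\<in>{0<..<L}. P x = \<gamma> t" and injP: "inj_on P G"
  shows "(\<integral>\<^sup>+x. ennreal (\<kappa> x) * indicator G x \<partial>lebesgue) \<le> ennreal (12 * L)"
proof -
  define D where "D i = G \<inter> disjointed X i" for i
  have XL: "X i \<in> sets lebesgue" for i using lmeasurable_compact[OF X] by blast
  have "disjointed X i \<in> sets lebesgue" for i
    using sets.range_disjointed_sets[of X lebesgue] XL by blast
  hence DL: "D i \<in> sets lebesgue" for i unfolding D_def using G(1) by blast
  have DX: "D i \<subseteq> X i" for i unfolding D_def using disjointed_subset[of X i] by blast
  have DG: "D i \<subseteq> G" for i by (auto simp: D_def)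
  have Ddisj: "disjoint_family D"
    using disjoint_family_disjointed[of X] by (auto simp: D_def disjoint_family_on_def)
  have "(\<Union>i. D i) = G \<inter> (\<Union>i. disjointed X i)" unfolding D_def by (rule Int_UN_distrib[symmetric])
  also have "\<dots> = G \<inter> (\<Union>i. X i)" by (simp only: UN_disjointed_eq)
  also have "\<dots> = G" by (rule Int_absorb2[OF G(2)])
  finally have DUN: "(\<Union>i. D i) = G" .
  have Dlm: "D i \<in> lmeasurable" for i
    by (rule bounded_set_imp_lmeasurable[OF bounded_subset[OF bounded_closed_interval order_trans[OF DG G(3)]] DL])
  \<comment> \<open>Compact subsets carrying half of the measure have compact images and closed
    parameter sets, so measurability of images of general sets never arises. This extra factor 2
    leads to \<open>12 = 2 * 2 * 3\<close>.\<close>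
  have "\<exists>K. compact K \<and> K \<subseteq> D i \<and> measure lebesgue (D i) \<le> 2 * measure lebesgue K" for i
  proof (cases "measure lebesgue (D i) = 0")
    case True thus ?thesis by (intro exI[of _ "{}"]) auto
  next
    case False
    hence pos: "0 < measure lebesgue (D i)" using measure_nonneg[of lebesgue "D i"] by linarith
    obtain T where T: "closed T" "T \<subseteq> D i" "D i - T \<in> lmeasurable" "emeasure lebesgue (D i - T) < ennreal (measure lebesgue (D i) / 2)"
      by (rule sets_lebesgue_inner_closed[OF DL half_gt_zero[OF pos]]) (rule that)
    have "bounded T" by (rule bounded_subset[OF bounded_closed_interval order_trans[OF T(2) order_trans[OF DG G(3)]]])
    hence cT: "compact T" using T(1) compact_eq_bounded_closed by blast
    have "measure lebesgue (D i - T) < measure lebesgue (D i) / 2"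
      using T(4) emeasure_eq_measure2[OF T(3)] pos by (simp add: ennreal_less_iff)
    moreover have "measure lebesgue (D i - T) = measure lebesgue (D i) - measure lebesgue T"
      by (rule measurable_measure_Diff[OF Dlm _ T(2)]) (use lmeasurable_compact[OF cT] in blast)
    ultimately show ?thesis using cT T(2) by (intro exI[of _ T]) auto
  qed
  hence "\<exists>K. \<forall>i. compact (K i) \<and> K i \<subseteq> D i \<and> measure lebesgue (D i) \<le> 2 * measure lebesgue (K i)"
    by (intro choice allI)
  then obtain K where K: "\<forall>i. compact (K i) \<and> K i \<subseteq> D i \<and> measure lebesgue (D i) \<le> 2 * measure lebesgue (K i)"
    by (elim exE)
  define \<tau> where "\<tau> x = (SOME t. t \<in> {0<..<L} \<and> P x = \<gamma> t)" for x
  have \<tau>: "\<tau> x \<in> {0<..<L}" "P x = \<gamma> (\<tau> x)" if "x \<in> G" for x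
  proof -
    have "\<exists>t. t \<in> {0<..<L} \<and> P x = \<gamma> t" using P\<gamma>[OF that] by blast
    from someI_ex[OF this] show "\<tau> x \<in> {0<..<L}" "P x = \<gamma> (\<tau> x)" by (auto simp: \<tau>_def)
  qed
  have \<tau>inj: "inj_on \<tau> G"
  proof (rule inj_onI)
    fix x y assume xy: "x \<in> G" "y \<in> G" "\<tau> x = \<tau> y"
    hence "P x = P y" using \<tau>(2)[OF xy(1)] \<tau>(2)[OF xy(2)] by simp
    thus "x = y" using injP xy by (auto dest: inj_onD)
  qed
  have KG: "K i \<subseteq> G" for i using K DG by blast
  have KX: "K i \<subseteq> X i" for i using K DX by blast
  define T where "T i = \<tau> ` K i" for i
  \<comment> \<open>A description free of the chosen parameter, from which closedness will follow.
    The common value of \<open>\<gamma>\<close> at 0 and \<open>L\<close> does no harm, since the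
    chosen parameters are interior.\<close>
  have Teq: "T i = {t\<in>{0..L}. \<gamma> t \<in> P ` K i}" for i
  proof
    show "T i \<subseteq> {t\<in>{0..L}. \<gamma> t \<in> P ` K i}"
    proof
      fix t assume "t \<in> T i"
      then obtain x where x: "x \<in> K i" "t = \<tau> x" by (auto simp: T_def)
      hence "x \<in> G" using KG by blast
      from \<tau>[OF this] x show "t \<in> {t\<in>{0..L}. \<gamma> t \<in> P ` K i}" by force
    qed
    show "{t\<in>{0..L}. \<gamma> t \<in> P ` K i} \<subseteq> T i"
    proof
      fix t assume t: "t \<in> {t\<in>{0..L}. \<gamma> t \<in> P ` K i}"
      then obtain x where x: "x \<in> K i" "\<gamma> t = P x" by auto
      hence xG: "x \<in> G" using KG by blast
      define s where "s = (if t = L then 0 else t)"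
      have s: "s \<in> {0..<L}" "\<gamma> s = \<gamma> t" using t inj(2) L by (auto simp: s_def)
      have "\<gamma> s = \<gamma> (\<tau> x)" using s x \<tau>[OF xG] by simp
      hence "s = \<tau> x" using inj(1) s(1) \<tau>(1)[OF xG] by (auto dest: inj_onD)
      hence "s \<noteq> 0" using \<tau>(1)[OF xG] by auto
      hence "s = t" by (auto simp: s_def split: if_splits)
      thus "t \<in> T i" using \<open>s = \<tau> x\<close> x(1) by (auto simp: T_def)
    qed
  qed
  have c\<gamma>: "continuous_on {0..L} \<gamma>"
  proof (rule continuous_onI)
    fix s e :: real assume "s \<in> {0..L}" "0 < e"
    thus "\<exists>d>0. \<forall>t\<in>{0..L}. dist t s < d \<longrightarrow> dist (\<gamma> t) (\<gamma> s) \<le> e"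
      by (intro exI[of _ e]) (auto simp: dist_norm intro!: order_trans[OF lip])
  qed
  have Tclosed: "closed (T i)" for i
  proof -
    have "continuous_on (K i) P"
    proof (rule continuous_onI)
      fix s e :: real assume s: "s \<in> K i" and e: "0 < e"
      have "dist (P t) (P s) \<le> e" if t: "t \<in> K i" "dist t s < e / (3 * q i)" for t
      proof -
        have "norm (P t - P s) \<le> 3 * q i * \<bar>t - s\<bar>" by (rule bil2) (use t s KX KG in blast)+
        also have "\<dots> \<le> 3 * q i * (e / (3 * q i))" using t(2) q[of i] by (intro mult_left_mono) (auto simp: dist_real_def)
        also have "\<dots> = e" using q[of i] by simp
        finally show ?thesis by (simp add: dist_norm)
      qed
      moreover have "0 < e / (3 * q i)" using e q[of i] by simp
      ultimately show "\<exists>d>0. \<forall>t\<in>K i. dist t s < d \<longrightarrow> dist (P t) (P s) \<le> e" by blast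
    qed
    hence "closed (P ` K i)" using K compact_continuous_image compact_imp_closed by blast
    hence "closed ({0..L} \<inter> \<gamma> -` (P ` K i))" by (rule continuous_closed_preimage[OF c\<gamma> closed_atLeastAtMost])
    moreover have "{0..L} \<inter> \<gamma> -` (P ` K i) = T i" by (auto simp: Teq)
    ultimately show ?thesis by simp
  qed
  have Tsub: "T i \<subseteq> {0..L}" for i by (auto simp: Teq)
  have Tlm: "T i \<in> lmeasurable" for i
    using bounded_subset[OF bounded_closed_interval Tsub[of i]] Tclosed[of i]
    by (intro lmeasurable_compact) (simp add: compact_eq_bounded_closed)
  have Tdisj: "disjoint_family T"
    unfolding disjoint_family_on_def
  proof (intro ballI impI)
    fix i j :: nat assume ij: "i \<noteq> j"
    have "D i \<inter> D j = {}" using Ddisj ij by (simp add: disjoint_family_on_def)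
    hence "K i \<inter> K j = {}" using K by blast
    thus "T i \<inter> T j = {}" unfolding T_def
      using inj_on_image_Int[OF \<tau>inj KG[of i] KG[of j]] by simp
  qed
  have piece: "(\<integral>\<^sup>+x. ennreal (\<kappa> x) * indicator (D i) x \<partial>lebesgue) \<le> ennreal 12 * emeasure lebesgue (T i)" for i
  proof -
    have "(\<integral>\<^sup>+x. ennreal (\<kappa> x) * indicator (D i) x \<partial>lebesgue) \<le> (\<integral>\<^sup>+x. ennreal (2 * q i) * indicator (D i) x \<partial>lebesgue)"
    proof (rule nn_integral_mono)
      fix x
      show "ennreal (\<kappa> x) * indicator (D i) x \<le> ennreal (2 * q i) * indicator (D i) x"
      proof (cases "x \<in> D i")
        case True
        hence "\<kappa> x \<le> 2 * q i" using \<kappa>(1)[of x i] DX DG by blast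
        thus ?thesis by (intro mult_right_mono ennreal_leI) auto
      qed simp
    qed
    also have "\<dots> = ennreal (2 * q i) * emeasure lebesgue (D i)" by (rule nn_integral_cmult_indicator[OF DL])
    also have "\<dots> = ennreal (2 * q i * measure lebesgue (D i))"
      using emeasure_eq_measure2[OF Dlm] q[of i] by (simp add: ennreal_mult)
    also have "\<dots> \<le> ennreal (12 * measure lebesgue (T i))"
    proof (rule ennreal_leI)
      have "measure lebesgue (K i) \<le> 3 / q i * measure lebesgue (\<tau> ` K i)"
      proof (rule lipschitz_preimage_measure[OF _ _ _ _ _ L])
        show "compact (K i)" using K by blast
        show "0 \<le> 3 / q i" using q[of i] by simp
        show "\<tau> ` K i \<in> lmeasurable" using Tlm[of i] by (simp add: T_def)
        show "\<tau> ` K i \<subseteq> {0..L}" using Tsub[of i] by (simp add: T_def)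
        fix x y assume xy: "x \<in> K i" "y \<in> K i"
        have xyG: "x \<in> G" "y \<in> G" using xy KG by blast+
        have "\<bar>x - y\<bar> \<le> 3 / q i * norm (P x - P y)" by (rule bil1) (use xy xyG KX in blast)+
        also have "\<dots> = 3 / q i * norm (\<gamma> (\<tau> x) - \<gamma> (\<tau> y))" using \<tau>(2)[OF xyG(1)] \<tau>(2)[OF xyG(2)] by simp
        also have "\<dots> \<le> 3 / q i * \<bar>\<tau> x - \<tau> y\<bar>"
          by (rule mult_left_mono[OF lip]) (use \<tau>(1)[OF xyG(1)] \<tau>(1)[OF xyG(2)] q[of i] in auto)
        finally show "\<bar>x - y\<bar> \<le> 3 / q i * \<bar>\<tau> x - \<tau> y\<bar>" .
      qed
      hence "2 * q i * (2 * measure lebesgue (K i)) \<le> 2 * q i * (2 * (3 / q i * measure lebesgue (T i)))"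
        using q[of i] by (intro mult_left_mono) (auto simp: T_def)
      also have "\<dots> = 12 * measure lebesgue (T i)" using q[of i] by simp
      finally have "2 * q i * (2 * measure lebesgue (K i)) \<le> 12 * measure lebesgue (T i)" .
      moreover have "2 * q i * measure lebesgue (D i) \<le> 2 * q i * (2 * measure lebesgue (K i))"
        using K q[of i] by (intro mult_left_mono) auto
      ultimately show "2 * q i * measure lebesgue (D i) \<le> 12 * measure lebesgue (T i)" by linarith
    qed
    also have "\<dots> = ennreal 12 * emeasure lebesgue (T i)"
      using emeasure_eq_measure2[OF Tlm] by (simp add: ennreal_mult)
    finally show ?thesis .
  qed
  have "(\<integral>\<^sup>+x. ennreal (\<kappa> x) * indicator G x \<partial>lebesgue) = (\<integral>\<^sup>+x. (\<Sum>i. ennreal (\<kappa> x) * indicator (D i) x) \<partial>lebesgue)"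
    unfolding DUN[symmetric]
    by (intro nn_integral_cong) (simp add: suminf_indicator[OF Ddisj])
  also have "\<dots> = (\<Sum>i. (\<integral>\<^sup>+x. ennreal (\<kappa> x) * indicator (D i) x \<partial>lebesgue))"
    by (intro nn_integral_suminf borel_measurable_times_ennreal borel_measurable_indicator DL measurable_compose[OF \<kappa>(2) measurable_ennreal])
  also have "\<dots> \<le> (\<Sum>i. ennreal 12 * emeasure lebesgue (T i))" by (intro suminf_le piece) auto
  also have "\<dots> = ennreal 12 * (\<Sum>i. emeasure lebesgue (T i))" by (rule ennreal_suminf_cmult)
  also have "(\<Sum>i. emeasure lebesgue (T i)) = emeasure lebesgue (\<Union>i. T i)"
    by (rule suminf_emeasure) (use Tlm Tdisj in auto)
  finally have 1: "(\<integral>\<^sup>+x. ennreal (\<kappa> x) * indicator G x \<partial>lebesgue) \<le> ennreal 12 * emeasure lebesgue (\<Union>i. T i)" .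
  have "emeasure lebesgue (\<Union>i. T i) \<le> emeasure lebesgue {0..L}" by (rule emeasure_mono) (use Tsub in auto)
  also have "\<dots> = ennreal L" using L by simp
  finally have "ennreal 12 * emeasure lebesgue (\<Union>i. T i) \<le> ennreal 12 * ennreal L" by (rule mult_left_mono) simp
  also have "\<dots> = ennreal (12 * L)" using L by (simp add: ennreal_mult)
  finally show ?thesis using 1 by (rule order_trans[rotated])
qed

section \<open>Good boundary points\<close>

text \<open>An injective holomorphic map is open, so values close to an image point have preimages
  close to one interior point; a sequence tending to the circle cannot have such a limit.\<close>

lemma boundary_value_frontier:
  assumes \<psi>: "\<psi> holomorphic_on ball 0 1 - {0}" and inj: "inj_on \<psi> (ball 0 1 - {0})"
    and p: "(\<lambda>n. \<psi> (radial x n)) \<longlonglongrightarrow> p"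
  shows "p \<in> frontier (\<psi> ` (ball 0 1 - {0}))"
proof -
  let ?D = "ball 0 1 - {0::complex}"
  have op: "open ?D" by auto
  have opI: "open (\<psi> ` ?D)" by (rule open_mapping_thm3[OF \<psi> op inj])
  have "p \<in> closure (\<psi> ` ?D)"
    unfolding closure_sequential using p radial_punctured by (intro exI[of _ "\<lambda>n. \<psi> (radial x n)"]) blast
  moreover have "p \<notin> \<psi> ` ?D"
  proof
    assume "p \<in> \<psi> ` ?D"
    then obtain w where w: "w \<in> ?D" "p = \<psi> w" by blast
    define r where "r = (1 - norm w) / 2"
    have r: "0 < r" using w by (simp add: r_def)
    have sub: "ball w r \<inter> ?D \<subseteq> ?D" by blast
    have "open (\<psi> ` (ball w r \<inter> ?D))"
      by (rule open_mapping_thm3[OF holomorphic_on_subset[OF \<psi> sub] _ inj_on_subset[OF inj sub]]) auto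
    moreover have "p \<in> \<psi> ` (ball w r \<inter> ?D)" using w r by auto
    ultimately have "\<forall>\<^sub>F n in sequentially. \<psi> (radial x n) \<in> \<psi> ` (ball w r \<inter> ?D)"
      using p topological_tendstoD by blast
    hence "\<forall>\<^sub>F n in sequentially. norm (radial x n) \<le> 1 - r"
    proof eventually_elim
      case (elim n)
      then obtain z where z: "z \<in> ball w r" "z \<in> ?D" "\<psi> (radial x n) = \<psi> z" by blast
      hence "radial x n = z" using inj radial_punctured by (auto dest: inj_onD)
      hence "norm (radial x n) \<le> norm w + norm (radial x n - w)" using norm_triangle_ineq[of w "radial x n - w"] by simp
      also have "norm (radial x n - w) < r" using z \<open>radial x n = z\<close> by (simp add: dist_norm norm_minus_commute)
      finally show ?case by (simp add: r_def field_simps)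
    qed
    moreover have "(\<lambda>n. norm (radial x n)) \<longlonglongrightarrow> norm (cis x)" by (intro tendsto_norm radial_lim)
    ultimately have "norm (cis x) \<le> 1 - r" by (intro tendsto_upperbound[OF _ _ sequentially_bot])
    thus False using r by simp
  qed
  ultimately show ?thesis by (simp add: frontier_def interior_open[OF opI])
qed

text \<open>The curve is the preimage of a segment leaving \<open>p\<close> along the normal
  \<open>sgn c * \<i> * \<tau>\<close>. That this segment depends on \<open>c\<close> and
  \<open>\<tau>\<close> but not on \<open>x\<close> is the point of the formulation: two angles with
  the same boundary point get the same segment, which later yields injectivity.\<close>

lemma good_boundary_point:
  fixes u :: "complex \<Rightarrow> real" and \<gamma> :: "real \<Rightarrow> complex"
  assumes \<psi>: "\<psi> holomorphic_on ball 0 1 - {0}" and im: "\<psi> ` (ball 0 1 - {0}) = \<Omega>" and op: "open \<Omega>"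
    and a: "nt_deriv \<psi> x a" "a \<noteq> 0" and p: "(\<lambda>n. \<psi> (radial x n)) \<longlonglongrightarrow> p"
    and fr: "\<gamma> ` {0..L} \<subseteq> frontier \<Omega>" and t: "t \<in> {0<..<L}" "\<gamma> t = p"
    and \<tau>: "(\<gamma> has_vector_derivative \<tau>) (at t)" "norm \<tau> = 1"
    and du: "\<And>z. z \<in> \<Omega> \<Longrightarrow> (u has_derivative (\<lambda>d. Re (cnj (cgrad u z) * d))) (at z)"
    and upos: "\<And>z. z \<in> \<Omega> \<Longrightarrow> 0 < u z"
    and nt0: "nt_tendsto \<Omega> u p 0"
    and ntc: "nt_tendsto \<Omega> (\<lambda>z. Re (cgrad u z * cnj (\<i> * \<tau>))) p c" and c: "c \<noteq> 0"
  shows "\<exists>w. (w \<longlongrightarrow> cis x) (at_right 0) \<and>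
    (\<forall>\<^sub>F h in at_right 0. w h \<in> ball 0 1 - {0} \<and> \<psi> (w h) = p + of_real (sgn c * h) * (\<i> * \<tau>)) \<and>
    ((\<lambda>h. u (\<psi> (w h)) / (1 - norm (w h))) \<longlongrightarrow> \<bar>c\<bar> * norm a) (at_right 0)"
proof -
  let ?e = "cis x"
  have na: "0 < norm a" using a by simp
  have frn: "z \<notin> \<Omega>" if "z \<in> frontier \<Omega>" for z using that op by (simp add: frontier_def interior_open)
  \<comment> \<open>The unit direction in which the image leaves \<open>p\<close> when
    \<open>w\<close> moves inward along the radius.\<close>
  define \<nu> where "\<nu> = - (a * ?e) / of_real (norm a)"
  have n\<nu>: "norm \<nu> = 1" using na by (simp add: \<nu>_def norm_mult norm_divide)
  have \<nu>cnj: "\<nu> * cnj \<nu> = 1" using complex_norm_square[of \<nu>] n\<nu> by simp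
  \<comment> \<open>Otherwise one of the two tangent directions points into the half plane filled by
    image disks: a disk of radius \<open>\<beta> * h\<close> about \<open>p + s * h * \<tau>\<close>
    lies in \<open>\<Omega>\<close>. But \<open>\<gamma>\<close> at parameter
    \<open>t + s * h\<close> is within \<open>\<beta> / 2 * h\<close> of its centre and is a
    frontier point.\<close>
  have orth: "Re (\<tau> * cnj \<nu>) = 0"
  proof (rule ccontr)
    assume ne: "Re (\<tau> * cnj \<nu>) \<noteq> 0"
    define s where "s = sgn (Re (\<tau> * cnj \<nu>))"
    have s: "s = 1 \<or> s = -1" using ne by (auto simp: s_def sgn_if)
    define \<xi> where "\<xi> = (of_real s * \<tau>) * cnj \<nu> / of_real (norm a)"
    have "Re \<xi> = s * Re (\<tau> * cnj \<nu>) / norm a"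
      unfolding \<xi>_def by (simp only: Re_divide_of_real mult.assoc) simp
    also have "s * Re (\<tau> * cnj \<nu>) = \<bar>Re (\<tau> * cnj \<nu>)\<bar>" by (simp add: s_def abs_sgn mult.commute)
    finally have \<xi>: "0 < Re \<xi>" using ne na by simp
    have a\<xi>: "- (a * ?e * \<xi>) = of_real s * \<tau>"
    proof -
      have "a * ?e = - (\<nu> * of_real (norm a))" using na by (simp add: \<nu>_def)
      hence "- (a * ?e * \<xi>) = \<nu> * of_real (norm a) * \<xi>" by simp
      also have "\<dots> = (\<nu> * cnj \<nu>) * (of_real s * \<tau>)" using na by (simp add: \<xi>_def)
      finally show ?thesis by (simp add: \<nu>cnj)
    qed
    from nt_deriv_covers[OF \<psi> a p \<xi>] obtain \<beta> M t0 where b: "0 < \<beta>" "0 < t0"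
      and cov: "\<forall>h. 0 < h \<longrightarrow> h < t0 \<longrightarrow> ball (p - a * ?e * \<xi> * of_real h) (\<beta> * h) \<subseteq>
        \<psi> ` {w \<in> stolz ?e M. dist w ?e \<le> 2 * norm \<xi> * h \<and> w \<noteq> 0}" by (elim exE conjE)
    have covO: "ball (p + of_real s * \<tau> * of_real h) (\<beta> * h) \<subseteq> \<Omega>" if h: "0 < h" "h < t0" for h
    proof -
      have eq: "p - a * ?e * \<xi> * of_real h = p + of_real s * \<tau> * of_real h" unfolding a\<xi>[symmetric] by simp
      hence "ball (p + of_real s * \<tau> * of_real h) (\<beta> * h) \<subseteq> \<psi> ` {w \<in> stolz ?e M. dist w ?e \<le> 2 * norm \<xi> * h \<and> w \<noteq> 0}"
        using cov[rule_format, OF h] by (simp only: eq)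
      also have "\<dots> \<subseteq> \<Omega>" unfolding im[symmetric] by (intro image_mono) (auto simp: stolz_def)
      finally show ?thesis .
    qed
    have "(\<gamma> has_derivative (\<lambda>h. h *\<^sub>R \<tau>)) (at t)" using \<tau>(1) by (simp add: has_vector_derivative_def)
    from has_derivative_at_alt[THEN iffD1, OF this] b(1)
    obtain d where d: "d > 0" "\<And>y. norm (y - t) < d \<Longrightarrow> norm (\<gamma> y - \<gamma> t - (y - t) *\<^sub>R \<tau>) \<le> \<beta> / 2 * norm (y - t)"
      by (metis half_gt_zero)
    define h where "h = min (min d t0) (min t (L - t)) / 2"
    have h: "0 < h" "h < d" "h < t0" "h < t" "h < L - t" using d(1) b t(1) by (auto simp: h_def)
    define y where "y = t + s * h"
    have ny: "norm (y - t) = h" using s h by (auto simp: y_def)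
    have "norm (\<gamma> y - \<gamma> t - (y - t) *\<^sub>R \<tau>) \<le> \<beta> / 2 * h" using d(2)[of y] ny h by simp
    moreover have "\<gamma> y - \<gamma> t - (y - t) *\<^sub>R \<tau> = \<gamma> y - (p + of_real s * \<tau> * of_real h)"
      using t(2) by (simp add: y_def scaleR_conv_of_real algebra_simps)
    moreover have "\<beta> / 2 * h < \<beta> * h" using b(1) h(1) by simp
    ultimately have "\<gamma> y \<in> ball (p + of_real s * \<tau> * of_real h) (\<beta> * h)"
      by (simp add: dist_norm norm_minus_commute)
    hence "\<gamma> y \<in> \<Omega>" using covO[OF h(1,3)] by blast
    moreover have "y \<in> {0..L}" using s h t(1) by (auto simp: y_def)
    hence "\<gamma> y \<in> frontier \<Omega>" using fr by blast
    ultimately show False using frn by blast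
  qed
  define \<sigma> where "\<sigma> = - Im (\<tau> * cnj \<nu>)"
  have it: "\<i> * \<tau> = of_real \<sigma> * \<nu>"
  proof -
    have "\<tau> * cnj \<nu> = \<i> * of_real (Im (\<tau> * cnj \<nu>))" using orth by (simp add: complex_eq_iff)
    hence "\<i> * (\<tau> * cnj \<nu>) = of_real \<sigma>" by (simp add: \<sigma>_def complex_eq_iff orth)
    hence "(\<i> * (\<tau> * cnj \<nu>)) * \<nu> = of_real \<sigma> * \<nu>" by simp
    moreover have "(\<i> * (\<tau> * cnj \<nu>)) * \<nu> = (\<i> * \<tau>) * (\<nu> * cnj \<nu>)" by (simp add: mult_ac)
    ultimately show ?thesis by (simp add: \<nu>cnj)
  qed
  have "norm (\<i> * \<tau>) = \<bar>\<sigma>\<bar>" unfolding it by (simp add: norm_mult n\<nu>)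
  hence \<sigma>: "\<bar>\<sigma>\<bar> = 1" using \<tau>(2) by (simp add: norm_mult)
  hence \<sigma>\<sigma>: "\<sigma> * \<sigma> = 1" by (metis abs_mult_self_eq mult_1)
  define \<xi> where "\<xi> = complex_of_real (1 / norm a)"
  have \<xi>: "0 < Re \<xi>" "norm \<xi> = 1 / norm a" using na by (auto simp: \<xi>_def norm_divide)
  have a\<xi>: "- (a * ?e * \<xi>) = \<nu>" by (simp add: \<nu>_def \<xi>_def)
  from nt_deriv_covers[OF \<psi> a p \<xi>(1)] obtain \<beta> M t0 where b: "0 < \<beta>" "0 < M" "0 < t0"
    and cov: "\<forall>h. 0 < h \<longrightarrow> h < t0 \<longrightarrow> ball (p - a * ?e * \<xi> * of_real h) (\<beta> * h) \<subseteq>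
      \<psi> ` {w \<in> stolz ?e M. dist w ?e \<le> 2 * norm \<xi> * h \<and> w \<noteq> 0}" by (elim exE conjE)
  define z where "z h = p + \<nu> * of_real h" for h :: real
  have covz: "ball (z h) (\<beta> * h) \<subseteq> \<psi> ` {w \<in> stolz ?e M. dist w ?e \<le> 2 * norm \<xi> * h \<and> w \<noteq> 0}" if h: "0 < h" "h < t0" for h
  proof -
    have eq: "p - a * ?e * \<xi> * of_real h = z h" unfolding z_def a\<xi>[symmetric] by simp
    show ?thesis using cov[rule_format, OF h] by (simp only: eq)
  qed
  have sub\<Omega>: "\<psi> ` {w \<in> stolz ?e M. dist w ?e \<le> 2 * norm \<xi> * h \<and> w \<noteq> 0} \<subseteq> \<Omega>" for h
    unfolding im[symmetric] by (intro image_mono) (auto simp: stolz_def)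
  have z\<Omega>: "z h \<in> \<Omega>" if h: "0 < h" "h < t0" for h
    using covz[OF h] sub\<Omega> centre_in_ball[of "z h" "\<beta> * h"] b h by (meson mult_pos_pos subsetD)
  have evh: "\<forall>\<^sub>F h in at_right 0. 0 < h \<and> h < t0"
    using eventually_at_right_real[OF b(3)] by eventually_elim simp
  \<comment> \<open>The covering disks keep \<open>z h\<close> at distance at least
    \<open>\<beta> * h\<close> from the frontier, so the segment runs inside the approach region
    with \<open>\<alpha> = 1 / \<beta>\<close>.\<close>
  define R where "R = {y\<in>\<Omega>. norm (y - p) < (1 + 1 / \<beta>) * infdist y (frontier \<Omega>)}"
  have zR: "z h \<in> R" if h: "0 < h" "h < t0" for h
  proof -
    have pF: "p \<in> frontier \<Omega>" using fr t by auto
    have "\<beta> * h \<le> dist (z h) y" if "y \<in> frontier \<Omega>" for y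
    proof (rule ccontr)
      assume "\<not> \<beta> * h \<le> dist (z h) y"
      hence "y \<in> ball (z h) (\<beta> * h)" by simp
      hence "y \<in> \<Omega>" using covz[OF h] sub\<Omega> by blast
      thus False using frn[OF that] by blast
    qed
    hence "\<beta> * h \<le> infdist (z h) (frontier \<Omega>)"
      using pF unfolding infdist_def by (auto intro!: cINF_greatest)
    hence "(1 + 1 / \<beta>) * (\<beta> * h) \<le> (1 + 1 / \<beta>) * infdist (z h) (frontier \<Omega>)" using b by (intro mult_left_mono) auto
    moreover have "(1 + 1 / \<beta>) * (\<beta> * h) = \<beta> * h + h" using b by (simp add: field_simps)
    moreover have "norm (z h - p) = h" using h by (simp add: z_def norm_mult n\<nu>)
    moreover have "0 < \<beta> * h" using b h by simp
    ultimately show ?thesis using z\<Omega>[OF h] by (simp add: R_def)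
  qed
  have zlim: "filterlim z (at p within R) (at_right 0)"
    unfolding filterlim_at
  proof
    show "\<forall>\<^sub>F h in at_right 0. z h \<in> R \<and> z h \<noteq> p"
      using evh
    proof eventually_elim
      case (elim h)
      have "\<nu> \<noteq> 0" using n\<nu> by auto
      thus ?case using zR[of h] elim by (simp add: z_def)
    qed
    have "((\<lambda>h::real. p + \<nu> * of_real h) \<longlongrightarrow> p + \<nu> * of_real 0) (at_right 0)" by (intro tendsto_intros)
    thus "(z \<longlongrightarrow> p) (at_right 0)" by (simp add: z_def[abs_def])
  qed
  have ib: "0 < 1 / \<beta>" using b by simp
  have u0: "((\<lambda>h. u (z h)) \<longlongrightarrow> 0) (at_right 0)"
    by (rule filterlim_compose[OF _ zlim]) (use nt0 ib in \<open>simp add: nt_tendsto_def R_def\<close>)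
  have gc: "((\<lambda>h. Re (cgrad u (z h) * cnj (\<i> * \<tau>))) \<longlongrightarrow> c) (at_right 0)"
    by (rule filterlim_compose[OF _ zlim]) (use ntc[unfolded nt_tendsto_def, rule_format, OF ib] in \<open>simp only: R_def\<close>)
  have g\<sigma>: "((\<lambda>h. Re (cnj (cgrad u (z h)) * \<nu>)) \<longlongrightarrow> \<sigma> * c) (at_right 0)"
  proof -
    have "Re (cnj (cgrad u y) * \<nu>) = \<sigma> * Re (cgrad u y * cnj (\<i> * \<tau>))" for y
    proof -
      have "cgrad u y * cnj (\<i> * \<tau>) = of_real \<sigma> * (cgrad u y * cnj \<nu>)" unfolding it by simp
      moreover have "Re (of_real \<sigma> * X) = \<sigma> * Re X" for X by simp
      ultimately have "\<sigma> * Re (cgrad u y * cnj (\<i> * \<tau>)) = \<sigma> * (\<sigma> * Re (cgrad u y * cnj \<nu>))" by (simp only:)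
      also have "\<dots> = Re (cgrad u y * cnj \<nu>)" using \<sigma>\<sigma> by (simp add: mult.assoc[symmetric])
      also have "\<dots> = Re (cnj (cgrad u y) * \<nu>)" by simp
      finally show ?thesis by simp
    qed
    thus ?thesis using tendsto_mult_left[OF gc, of \<sigma>] by simp
  qed
  define U where "U h = u (z h)" for h
  have dU: "(U has_real_derivative Re (cnj (cgrad u (z h)) * \<nu>)) (at h)" if h: "0 < h" "h < t0" for h
  proof -
    have "(z has_derivative (\<lambda>d. \<nu> * of_real d)) (at h)"
      unfolding z_def[abs_def] by (auto intro!: derivative_eq_intros)
    from has_derivative_compose[OF this du[OF z\<Omega>[OF h]]]
    have "(U has_derivative (\<lambda>d. Re (cnj (cgrad u (z h)) * (\<nu> * of_real d)))) (at h)" by (simp add: U_def[abs_def])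
    moreover have "(\<lambda>d. Re (cnj (cgrad u (z h)) * (\<nu> * of_real d))) = (*) (Re (cnj (cgrad u (z h)) * \<nu>))"
      by (auto simp: fun_eq_iff algebra_simps)
    ultimately show ?thesis by (simp add: has_field_derivative_def)
  qed
  \<comment> \<open>The hypothesis controls the derivative of \<open>u\<close> along the normal
    segment; as \<open>u\<close> tends to 0 there, L'Hopital's rule converts this into the rate at
    which \<open>U\<close> vanishes.\<close>
  have Uh: "((\<lambda>h. U h / h) \<longlongrightarrow> \<sigma> * c) (at_right 0)"
  proof (rule lhopital_right[where f'="\<lambda>h. Re (cnj (cgrad u (z h)) * \<nu>)" and g'="\<lambda>_. 1"])
    show "(U \<longlongrightarrow> 0) (at_right 0)" using u0 by (simp add: U_def[abs_def])
    show "((\<lambda>h. h) \<longlongrightarrow> 0) (at_right (0::real))" by (rule tendsto_ident_at)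
    show "\<forall>\<^sub>F h in at_right 0. h \<noteq> (0::real)" using evh by eventually_elim simp
    show "\<forall>\<^sub>F h in at_right (0::real). (1::real) \<noteq> 0" by simp
    show "\<forall>\<^sub>F h in at_right 0. (U has_real_derivative Re (cnj (cgrad u (z h)) * \<nu>)) (at h)"
      using evh by eventually_elim (use dU in blast)
    show "\<forall>\<^sub>F h in at_right 0. ((\<lambda>h. h) has_real_derivative 1) (at (h::real))" by simp
    show "((\<lambda>h. Re (cnj (cgrad u (z h)) * \<nu>) / 1) \<longlongrightarrow> \<sigma> * c) (at_right 0)" using g\<sigma> by simp
  qed
  \<comment> \<open>Positivity of \<open>u\<close> decides the sign: of the two normals
    \<open>\<i> * \<tau>\<close> and its negative, the inner one \<open>\<nu>\<close> is that on
    which \<open>c\<close> becomes positive.\<close>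
  have ge: "0 \<le> \<sigma> * c"
  proof (rule tendsto_lowerbound[OF Uh])
    show "\<forall>\<^sub>F h in at_right 0. 0 \<le> U h / h"
      using evh
    proof eventually_elim
      case (elim h)
      thus ?case using upos[OF z\<Omega>[of h]] by (simp add: U_def)
    qed
  qed (simp add: trivial_limit_at_right_real)
  have \<sigma>c: "\<sigma> * c = \<bar>c\<bar>" using ge \<sigma> by (metis abs_mult abs_of_nonneg mult_1)
  have \<sigma>sgn: "\<sigma> = sgn c"
  proof -
    have "\<sigma> = 1 \<or> \<sigma> = -1" using \<sigma> by (auto simp: abs_if split: if_splits)
    thus ?thesis using \<sigma>c c by (auto simp: sgn_if abs_if split: if_splits)
  qed
  have \<nu>eq: "\<nu> = of_real (sgn c) * (\<i> * \<tau>)"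
  proof -
    have "of_real (sgn c) * (\<i> * \<tau>) = of_real (\<sigma> * \<sigma>) * \<nu>" unfolding it \<sigma>sgn[symmetric] by simp
    thus ?thesis by (simp add: \<sigma>\<sigma>)
  qed
  define w where "w h = (SOME w. w \<in> stolz ?e M \<and> dist w ?e \<le> 2 * norm \<xi> * h \<and> w \<noteq> 0 \<and> \<psi> w = z h)" for h
  have w: "w h \<in> stolz ?e M \<and> dist (w h) ?e \<le> 2 * norm \<xi> * h \<and> w h \<noteq> 0 \<and> \<psi> (w h) = z h" if h: "0 < h" "h < t0" for h
  proof -
    have "z h \<in> \<psi> ` {w \<in> stolz ?e M. dist w ?e \<le> 2 * norm \<xi> * h \<and> w \<noteq> 0}"
      using covz[OF h] centre_in_ball[of "z h" "\<beta> * h"] b h by (meson mult_pos_pos subsetD)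
    hence "\<exists>w. w \<in> stolz ?e M \<and> dist w ?e \<le> 2 * norm \<xi> * h \<and> w \<noteq> 0 \<and> \<psi> w = z h" by force
    thus ?thesis unfolding w_def by (rule someI_ex)
  qed
  have wlim: "(w \<longlongrightarrow> ?e) (at_right 0)"
  proof (rule tendsto_dist_iff[THEN iffD2], rule Lim_null_comparison)
    show "\<forall>\<^sub>F h in at_right 0. norm (dist (w h) ?e) \<le> 2 * norm \<xi> * h"
      using evh by eventually_elim (use w in simp)
    have "((\<lambda>h. 2 * norm \<xi> * h) \<longlongrightarrow> 2 * norm \<xi> * 0) (at_right 0)" by (intro tendsto_intros)
    thus "((\<lambda>h. 2 * norm \<xi> * h) \<longlongrightarrow> 0) (at_right 0)" by simp
  qed
  \<comment> \<open>The preimage differs from \<open>cis x * (1 - h / norm a)\<close> by a small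
    multiple of \<open>h\<close>; the value of \<open>\<epsilon>\<close> is solved from the
    requirement that this error be at most \<open>e / 2 * h\<close>.\<close>
  have ratio: "((\<lambda>h. (1 - norm (w h)) / h) \<longlongrightarrow> 1 / norm a) (at_right 0)"
    unfolding tendsto_iff dist_real_def
  proof (intro allI impI)
    fix e :: real assume e: "0 < e"
    define \<epsilon> where "\<epsilon> = e * (norm a)\<^sup>2 / 4"
    have \<epsilon>: "0 < \<epsilon>" using e na by (simp add: \<epsilon>_def)
    obtain \<eta> where \<eta>: "0 < \<eta>" "\<eta> \<le> 1/2"
      "\<And>w. w \<in> stolz ?e M \<Longrightarrow> dist w ?e < \<eta> \<Longrightarrow> norm (\<psi> w - p - a * (w - ?e)) \<le> \<epsilon> * dist w ?e"
      using nt_deriv_approx[OF \<psi> a(1) p \<epsilon>, where M=M] by blast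
    have "\<forall>\<^sub>F h in at_right 0. dist (w h) ?e < \<eta>" by (rule tendstoD[OF wlim \<eta>(1)])
    moreover have "\<forall>\<^sub>F h in at_right 0. 0 < h \<and> h < norm a"
      using eventually_at_right_real[OF na] by eventually_elim simp
    ultimately show "\<forall>\<^sub>F h in at_right 0. \<bar>(1 - norm (w h)) / h - 1 / norm a\<bar> < e"
      using evh
    proof eventually_elim
      case (elim h)
      have h: "0 < h" "h < t0" "h < norm a" using elim by auto
      note wh = w[OF h(1,2)]
      have "norm (\<psi> (w h) - p - a * (w h - ?e)) \<le> \<epsilon> * dist (w h) ?e" using \<eta>(3)[of "w h"] wh elim(1) by simp
      also have "\<dots> \<le> \<epsilon> * (2 * norm \<xi> * h)" using wh \<epsilon> by (intro mult_left_mono) auto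
      also have "\<psi> (w h) - p - a * (w h - ?e) = - a * (w h - ?e * of_real (1 - h / norm a))"
      proof -
        have "\<nu> * of_real h = - a * (?e * of_real (h / norm a))" by (simp add: \<nu>_def)
        thus ?thesis using wh by (simp add: z_def algebra_simps)
      qed
      finally have "norm a * norm (w h - ?e * of_real (1 - h / norm a)) \<le> \<epsilon> * (2 * norm \<xi> * h)"
        by (simp add: norm_mult)
      also have "\<epsilon> * (2 * norm \<xi> * h) = norm a * (e / 2 * h)"
        using na by (simp add: \<epsilon>_def \<xi>(2) power2_eq_square)
      finally have 1: "norm (w h - ?e * of_real (1 - h / norm a)) \<le> e / 2 * h" using na by simp
      have "norm (?e * of_real (1 - h / norm a)) = 1 - h / norm a"
        unfolding norm_mult norm_of_real norm_cis using h na by simp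
      hence "\<bar>1 - h / norm a - norm (w h)\<bar> \<le> e / 2 * h"
        using 1 norm_triangle_ineq3[of "w h" "?e * of_real (1 - h / norm a)"] by linarith
      moreover have "(1 - norm (w h)) / h - 1 / norm a = (1 - h / norm a - norm (w h)) / h"
        using h na by (simp add: field_simps)
      ultimately have "\<bar>(1 - norm (w h)) / h - 1 / norm a\<bar> \<le> e / 2" using h by (simp add: abs_divide pos_divide_le_eq)
      thus ?case using e by linarith
    qed
  qed
  have final: "((\<lambda>h. u (\<psi> (w h)) / (1 - norm (w h))) \<longlongrightarrow> \<bar>c\<bar> * norm a) (at_right 0)"
  proof (rule Lim_transform_eventually)
    have "((\<lambda>h. (U h / h) / ((1 - norm (w h)) / h)) \<longlongrightarrow> (\<sigma> * c) / (1 / norm a)) (at_right 0)"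
      by (rule tendsto_divide[OF Uh ratio]) (use na in simp)
    thus "((\<lambda>h. (U h / h) / ((1 - norm (w h)) / h)) \<longlongrightarrow> \<bar>c\<bar> * norm a) (at_right 0)" by (simp add: \<sigma>c)
    show "\<forall>\<^sub>F h in at_right 0. (U h / h) / ((1 - norm (w h)) / h) = u (\<psi> (w h)) / (1 - norm (w h))"
      using evh
    proof eventually_elim
      case (elim h)
      thus ?case using w[of h] by (simp add: U_def)
    qed
  qed
  have evw: "\<forall>\<^sub>F h in at_right 0. w h \<in> ball 0 1 - {0} \<and> \<psi> (w h) = p + of_real (sgn c * h) * (\<i> * \<tau>)"
    using evh
  proof eventually_elim
    case (elim h)
    have "z h = p + of_real (sgn c * h) * (\<i> * \<tau>)" unfolding z_def \<nu>eq by (simp add: mult_ac)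
    thus ?case using w[of h] elim by (simp add: stolz_def)
  qed
  show ?thesis using wlim evw final by blast
qed

section \<open>Uniqueness of the roof function\<close>

lemma integral_split_arcs:
  fixes g :: "real \<Rightarrow> real"
  assumes \<delta>: "0 \<le> \<delta>" and g: "g integrable_on {0..real n * \<delta>}"
  shows "(\<Sum>i<n. integral {real i * \<delta>..(real i + 1) * \<delta>} g) = integral {0..real n * \<delta>} g"
  using g
proof (induction n)
  case (Suc n)
  have le: "0 \<le> real n * \<delta>" "real n * \<delta> \<le> real (Suc n) * \<delta>" using \<delta> by (auto intro: mult_right_mono)
  have "g integrable_on {0..real n * \<delta>}" by (rule integrable_on_subinterval[OF Suc.prems]) (use le in auto)
  from Suc.IH[OF this] have "(\<Sum>i<Suc n. integral {real i * \<delta>..(real i + 1) * \<delta>} g)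
     = integral {0..real n * \<delta>} g + integral {real n * \<delta>..real (Suc n) * \<delta>} g" by (simp add: add.commute)
  also have "\<dots> = integral {0..real (Suc n) * \<delta>} g"
    by (rule Henstock_Kurzweil_Integration.integral_combine[OF le Suc.prems])
  finally show ?case .
qed simp

text \<open>The summand \<open>b - a\<close> raises the average by 1; this slack makes the
  contradiction strict, while the value of \<open>\<kappa>\<close> off \<open>G\<close> is replaced
  by that raised average.\<close>

lemma exists_le_average:
  fixes \<kappa> :: "real \<Rightarrow> real"
  assumes ab: "a < b" and \<kappa>: "\<kappa> integrable_on {a..b}" and G: "negligible ({a..b} - G)"
  shows "\<exists>x\<in>{a..b} \<inter> G. \<kappa> x * (b - a) \<le> integral {a..b} \<kappa> + (b - a)"
proof (rule ccontr)
  assume "\<not> ?thesis"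
  hence gt: "integral {a..b} \<kappa> / (b - a) + 1 \<le> \<kappa> x" if "x \<in> {a..b} \<inter> G" for x
  proof -
    have "integral {a..b} \<kappa> + (b - a) \<le> \<kappa> x * (b - a)"
      using \<open>\<not> (\<exists>x\<in>{a..b} \<inter> G. \<kappa> x * (b - a) \<le> integral {a..b} \<kappa> + (b - a))\<close> that by (meson linear)
    hence "(integral {a..b} \<kappa> + (b - a)) / (b - a) \<le> \<kappa> x" using ab by (simp add: pos_divide_le_eq)
    thus ?thesis using ab by (simp add: add_divide_distrib)
  qed
  define m where "m = integral {a..b} \<kappa> / (b - a) + 1"
  define \<kappa>' where "\<kappa>' x = (if x \<in> G then \<kappa> x else m)" for x
  have i: "(\<kappa>' has_integral integral {a..b} \<kappa>) {a..b}"
    by (rule has_integral_spike[OF G _ integrable_integral[OF \<kappa>]]) (auto simp: \<kappa>'_def)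
  have "((\<lambda>x. m) has_integral (b - a) *\<^sub>R m) {a..b}" using has_integral_const_real[of m a b] ab by simp
  from has_integral_le[OF this i] gt have "(b - a) * m \<le> integral {a..b} \<kappa>"
    by (auto simp: \<kappa>'_def m_def)
  moreover have "(b - a) * m = integral {a..b} \<kappa> + (b - a)" using ab by (simp add: m_def distrib_left)
  ultimately show False using ab by simp
qed

text \<open>If a nonnegative harmonic function had positive mass, the Poisson kernel would force its normal
  difference quotients to be at least of order \<open>1 / \<delta>\<close> on average over arcs of length \<open>\<delta>\<close>.\<close>
lemma positive_harmonic_vanishes:
  assumes H: "H holomorphic_on ball 0 1" and pos: "\<And>w. w \<in> ball 0 1 \<Longrightarrow> 0 \<le> Re (H w)"
    and G: "negligible ({0..2*pi} - G)" and \<kappa>: "\<kappa> integrable_on {0..2*pi}"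
    and good: "\<And>x \<delta>. x \<in> G \<Longrightarrow> 0 < \<delta> \<Longrightarrow> \<exists>w. norm w < 1 \<and> dist w (cis x) < \<delta> \<and> Re (H w) \<le> (\<kappa> x + 1) * (1 - norm w)"
  shows "Re (H 0) = 0"
proof -
  define B where "B = integral {0..2*pi} \<kappa>"
  \<comment> \<open>One point \<open>w i\<close> is taken near each of \<open>N\<close> arcs. The
    share of an arc in \<open>Re (H 0)\<close> is \<open>O(\<delta>\<^sup>2)\<close> times the
    difference quotient at \<open>w i\<close>, hence \<open>O(\<delta>)\<close> times the integral
    of \<open>\<kappa>\<close> over the arc plus \<open>2 * \<delta>\<close>. Summation over the
    arcs leaves \<open>O(\<delta>)\<close>, and \<open>\<delta>\<close> is
    \<open>2 * pi / N\<close>.\<close>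
  have bound: "Re (H 0) \<le> 9 * (2 * pi / real N) * (B + 4 * pi)" if N: "0 < N" for N :: nat
  proof -
    define \<delta> where "\<delta> = 2 * pi / real N"
    have \<delta>: "0 < \<delta>" "real N * \<delta> = 2 * pi" using N by (auto simp: \<delta>_def)
    define lo where "lo i = real i * \<delta>" for i :: nat
    define hi where "hi i = (real i + 1) * \<delta>" for i :: nat
    have lohi: "hi i - lo i = \<delta>" for i by (simp add: lo_def hi_def algebra_simps)
    have lh: "lo i < hi i" for i using lohi[of i] \<delta>(1) by linarith
    have sub: "{lo i..hi i} \<subseteq> {0..2*pi}" if "i < N" for i
    proof -
      have "(real i + 1) * \<delta> \<le> real N * \<delta>" using that \<delta>(1) by (intro mult_right_mono) auto
      thus ?thesis using \<delta> by (auto simp: lo_def hi_def intro: order_trans[OF mult_nonneg_nonneg])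
    qed
    have ex: "\<exists>x. x \<in> {lo i..hi i} \<inter> G \<and> \<kappa> x * \<delta> \<le> integral {lo i..hi i} \<kappa> + \<delta>" if i: "i < N" for i
    proof -
      have "negligible ({lo i..hi i} - G)" by (rule negligible_subset[OF G]) (use sub[OF i] in blast)
      from exists_le_average[OF lh integrable_on_subinterval[OF \<kappa> sub[OF i]] this]
      show ?thesis unfolding lohi by blast
    qed
    define x where "x i = (SOME x. x \<in> {lo i..hi i} \<inter> G \<and> \<kappa> x * \<delta> \<le> integral {lo i..hi i} \<kappa> + \<delta>)" for i
    have x: "x i \<in> {lo i..hi i}" "x i \<in> G" "\<kappa> (x i) * \<delta> \<le> integral {lo i..hi i} \<kappa> + \<delta>" if "i < N" for i
      using someI_ex[OF ex[OF that]] by (auto simp: x_def)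
    define w where "w i = (SOME w. norm w < 1 \<and> dist w (cis (x i)) < \<delta> \<and> Re (H w) \<le> (\<kappa> (x i) + 1) * (1 - norm w))" for i
    have w: "norm (w i) < 1" "dist (w i) (cis (x i)) < \<delta>" "Re (H (w i)) \<le> (\<kappa> (x i) + 1) * (1 - norm (w i))" if "i < N" for i
      using someI_ex[OF good[OF x(2)[OF that] \<delta>(1)]] by (auto simp: w_def)
    \<comment> \<open>Radii above all \<open>norm (w i)\<close>, so that the Poisson formula holds
      at these points, and within \<open>\<delta>\<close> of 1, so that the arc of radius
      \<open>\<rho>\<close> is within \<open>3 * \<delta>\<close> of \<open>w i\<close>.\<close>
    define \<rho>0 where "\<rho>0 = Max (insert (1 - \<delta>) (insert 0 ((\<lambda>i. norm (w i)) ` {..<N})))"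
    have \<rho>0: "\<rho>0 < 1" "1 - \<delta> \<le> \<rho>0" "0 \<le> \<rho>0" "\<And>i. i < N \<Longrightarrow> norm (w i) \<le> \<rho>0"
    proof -
      have fin: "finite (insert (1 - \<delta>) (insert 0 ((\<lambda>i. norm (w i)) ` {..<N})))" by simp
      show "\<rho>0 < 1" unfolding \<rho>0_def using w(1) \<delta>(1) by (subst Max_less_iff[OF fin]) auto
      show "1 - \<delta> \<le> \<rho>0" "0 \<le> \<rho>0" unfolding \<rho>0_def by (rule Max_ge[OF fin], simp)+
      show "norm (w i) \<le> \<rho>0" if "i < N" for i unfolding \<rho>0_def by (rule Max_ge[OF fin]) (use that in simp)
    qed
    have est: "2 * pi * Re (H 0) \<le> (\<Sum>i<N. 18 * pi * \<delta>\<^sup>2 * Re (H (w i)) / (\<rho>\<^sup>2 - (norm (w i))\<^sup>2))"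
      if \<rho>: "\<rho>0 < \<rho>" "\<rho> < 1" for \<rho>
    proof -
      have \<rho>p: "0 < \<rho>" using \<rho> \<rho>0 by linarith
      define h where "h t = Re (H (of_real \<rho> * cis t))" for t
      define k where "k v t = (\<rho>\<^sup>2 - (norm v)\<^sup>2) / (norm (of_real \<rho> * cis t - v))\<^sup>2" for v t
      have inb: "of_real \<rho> * cis t \<in> ball 0 1" for t using \<rho> \<rho>p by (simp add: norm_mult)
      have hpos: "0 \<le> h t" for t unfolding h_def by (rule pos[OF inb])
      have pf: "((\<lambda>t. k v t * h t) has_integral (2 * pi * Re (H v))) {0..2*pi}" if v: "norm v < \<rho>" for v
      proof -
        have "((\<lambda>t. Re (of_real (k v t) * H (of_real \<rho> * cis t))) has_integral Re (of_real (2 * pi) * H v)) {0..2*pi}"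
          unfolding k_def by (rule has_integral_Re[OF poisson_formula[OF H \<rho>p \<rho>(2) v]])
        moreover have "Re (of_real r * z) = r * Re z" for r z by simp
        ultimately show ?thesis by (simp only: h_def)
      qed
      have ch: "continuous_on UNIV h"
        unfolding h_def by (intro continuous_on_Re continuous_on_compose2[OF holomorphic_on_imp_continuous_on[OF H]])
          (use inb in \<open>auto intro!: continuous_intros\<close>)
      have hi: "h integrable_on {a..b}" for a b
        by (rule integrable_continuous_interval[OF continuous_on_subset[OF ch]]) simp
      have "k 0 t = 1" for t using \<rho>p by (simp add: k_def norm_mult)
      hence "(h has_integral (2 * pi * Re (H 0))) {0..2*pi}" using pf[of 0] \<rho>p by simp
      hence "2 * pi * Re (H 0) = integral {0..real N * \<delta>} h" unfolding \<delta>(2) by (simp add: integral_unique)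
      also have "\<dots> = (\<Sum>i<N. integral {lo i..hi i} h)"
        unfolding lo_def hi_def using hi by (intro integral_split_arcs[symmetric]) (use \<delta> in auto)
      also have "\<dots> \<le> (\<Sum>i<N. 18 * pi * \<delta>\<^sup>2 * Re (H (w i)) / (\<rho>\<^sup>2 - (norm (w i))\<^sup>2))"
      proof (rule sum_mono)
        fix i assume "i \<in> {..<N}"
        hence i: "i < N" by simp
        have wr: "norm (w i) < \<rho>" using \<rho>0(4)[OF i] \<rho> by linarith
        define D where "D = \<rho>\<^sup>2 - (norm (w i))\<^sup>2"
        have D: "0 < D" using power_strict_mono[OF wr norm_ge_zero, of 2] by (simp add: D_def)
        have kpos: "0 \<le> k (w i) t" for t using D by (simp add: k_def D_def)
        have klow: "D / (9 * \<delta>\<^sup>2) \<le> k (w i) t" if t: "t \<in> {lo i..hi i}" for t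
        proof -
          have "norm (of_real \<rho> * cis t - w i) \<le> norm (of_real \<rho> * cis t - cis t) + norm (cis t - cis (x i)) + norm (cis (x i) - w i)"
            using norm_triangle_ineq[of "of_real \<rho> * cis t - cis t" "cis t - cis (x i)"]
              norm_triangle_ineq[of "of_real \<rho> * cis t - cis (x i)" "cis (x i) - w i"] by simp
          also have "of_real \<rho> * cis t - cis t = - (of_real (1 - \<rho>) * cis t)" by (simp add: algebra_simps)
          also have "norm (- (of_real (1 - \<rho>) * cis t)) = 1 - \<rho>"
            using \<rho> by (simp only: norm_minus_cancel norm_mult norm_of_real norm_cis) simp
          also have "norm (cis t - cis (x i)) \<le> \<bar>t - x i\<bar>" by (rule cis_diff_bounds(1))
          also have "\<bar>t - x i\<bar> \<le> \<delta>" using t x(1)[OF i] lohi[of i] by (simp add: abs_le_iff)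
          also have "norm (cis (x i) - w i) \<le> \<delta>" using w(2)[OF i] by (simp add: dist_norm norm_minus_commute)
          finally have "norm (of_real \<rho> * cis t - w i) \<le> 3 * \<delta>" using \<rho>0(2) \<rho> by simp
          hence le: "(norm (of_real \<rho> * cis t - w i))\<^sup>2 \<le> (3 * \<delta>)\<^sup>2" by (rule power_mono) simp
          have "of_real \<rho> * cis t \<noteq> w i"
          proof
            assume "of_real \<rho> * cis t = w i"
            hence "norm (w i) = \<rho>" using \<rho>p by (metis abs_of_pos mult_1_right norm_cis norm_mult norm_of_real)
            thus False using wr by simp
          qed
          hence "0 < (norm (of_real \<rho> * cis t - w i))\<^sup>2" by simp
          hence "D / (3 * \<delta>)\<^sup>2 \<le> k (w i) t" unfolding k_def D_def[symmetric]
            using le D \<delta>(1) by (intro divide_left_mono mult_pos_pos) auto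
          thus ?thesis by (simp add: power_mult_distrib)
        qed
        have "D / (9 * \<delta>\<^sup>2) * integral {lo i..hi i} h = integral {lo i..hi i} (\<lambda>t. D / (9 * \<delta>\<^sup>2) * h t)"
          by (rule integral_mult_right[symmetric])
        also have "\<dots> \<le> integral {lo i..hi i} (\<lambda>t. k (w i) t * h t)"
        proof (rule integral_le)
          show "(\<lambda>t. D / (9 * \<delta>\<^sup>2) * h t) integrable_on {lo i..hi i}" by (rule integrable_on_mult_right[OF hi])
          show "(\<lambda>t. k (w i) t * h t) integrable_on {lo i..hi i}"
            by (rule integrable_on_subinterval[OF has_integral_integrable[OF pf[OF wr]] sub[OF i]])
          show "D / (9 * \<delta>\<^sup>2) * h t \<le> k (w i) t * h t" if "t \<in> {lo i..hi i}" for t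
            by (rule mult_right_mono[OF klow[OF that] hpos])
        qed
        also have "\<dots> \<le> integral {0..2*pi} (\<lambda>t. k (w i) t * h t)"
        proof (rule integral_subset_le[OF sub[OF i]])
          show "(\<lambda>t. k (w i) t * h t) integrable_on {lo i..hi i}"
            by (rule integrable_on_subinterval[OF has_integral_integrable[OF pf[OF wr]] sub[OF i]])
          show "(\<lambda>t. k (w i) t * h t) integrable_on {0..2*pi}" by (rule has_integral_integrable[OF pf[OF wr]])
        qed (use kpos hpos in \<open>auto intro: mult_nonneg_nonneg\<close>)
        also have "\<dots> = 2 * pi * Re (H (w i))" by (rule integral_unique[OF pf[OF wr]])
        finally have fin: "D / (9 * \<delta>\<^sup>2) * integral {lo i..hi i} h \<le> 2 * pi * Re (H (w i))" .
        have "integral {lo i..hi i} h = (9 * \<delta>\<^sup>2 / D) * (D / (9 * \<delta>\<^sup>2) * integral {lo i..hi i} h)"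
          using D \<delta>(1) by simp
        also have "\<dots> \<le> (9 * \<delta>\<^sup>2 / D) * (2 * pi * Re (H (w i)))"
          using fin D \<delta>(1) by (intro mult_left_mono) auto
        also have "\<dots> = 18 * pi * \<delta>\<^sup>2 * Re (H (w i)) / D" by simp
        finally show "integral {lo i..hi i} h \<le> 18 * pi * \<delta>\<^sup>2 * Re (H (w i)) / (\<rho>\<^sup>2 - (norm (w i))\<^sup>2)"
          by (simp add: D_def)
      qed
      finally show ?thesis .
    qed
    \<comment> \<open>The points \<open>w i\<close> were fixed before \<open>\<rho>\<close> tends to
      1, so the argument gets by without a boundary measure for \<open>H\<close>.\<close>
    have lim: "((\<lambda>\<rho>. \<Sum>i<N. 18 * pi * \<delta>\<^sup>2 * Re (H (w i)) / (\<rho>\<^sup>2 - (norm (w i))\<^sup>2)) \<longlongrightarrow>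
       (\<Sum>i<N. 18 * pi * \<delta>\<^sup>2 * Re (H (w i)) / (1\<^sup>2 - (norm (w i))\<^sup>2))) (at_left 1)"
    proof (intro tendsto_sum tendsto_divide tendsto_intros)
      fix i assume "i \<in> {..<N}"
      hence "norm (w i) < 1" using w(1) by simp
      hence "(norm (w i))\<^sup>2 < 1" by (simp add: power_less_one_iff abs_square_less_1)
      thus "1\<^sup>2 - (norm (w i))\<^sup>2 \<noteq> 0" by simp
    qed
    have "\<forall>\<^sub>F \<rho> in at_left 1. 2 * pi * Re (H 0) \<le> (\<Sum>i<N. 18 * pi * \<delta>\<^sup>2 * Re (H (w i)) / (\<rho>\<^sup>2 - (norm (w i))\<^sup>2))"
      using eventually_at_left_real[OF \<rho>0(1)] by eventually_elim (use est in auto)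
    from tendsto_lowerbound[OF lim this] have
      "2 * pi * Re (H 0) \<le> (\<Sum>i<N. 18 * pi * \<delta>\<^sup>2 * Re (H (w i)) / (1\<^sup>2 - (norm (w i))\<^sup>2))"
      by (simp add: trivial_limit_at_left_real)
    also have "\<dots> \<le> (\<Sum>i<N. 18 * pi * \<delta> * (integral {lo i..hi i} \<kappa> + 2 * \<delta>))"
    proof (rule sum_mono)
      fix i assume "i \<in> {..<N}"
      hence i: "i < N" by simp
      define n where "n = norm (w i)"
      have n: "0 \<le> n" "n < 1" using w(1)[OF i] by (auto simp: n_def)
      have fac: "1\<^sup>2 - n\<^sup>2 = (1 - n) * (1 + n)" by (simp add: power2_eq_square algebra_simps)
      have h0: "0 \<le> Re (H (w i))" using pos[of "w i"] w(1)[OF i] by simp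
      have "Re (H (w i)) / (1\<^sup>2 - n\<^sup>2) \<le> Re (H (w i)) / (1 - n)"
        unfolding fac using n h0 by (intro divide_left_mono mult_pos_pos) (auto simp: algebra_simps mult_left_le)
      also have "\<dots> \<le> \<kappa> (x i) + 1" using w(3)[OF i] n by (simp add: pos_divide_le_eq n_def)
      finally have "\<delta> * (Re (H (w i)) / (1\<^sup>2 - n\<^sup>2)) \<le> \<delta> * (\<kappa> (x i) + 1)" using \<delta>(1) by (intro mult_left_mono) auto
      also have "\<dots> \<le> integral {lo i..hi i} \<kappa> + 2 * \<delta>" using x(3)[OF i] by (simp add: algebra_simps)
      finally have "18 * pi * \<delta> * (\<delta> * (Re (H (w i)) / (1\<^sup>2 - n\<^sup>2))) \<le> 18 * pi * \<delta> * (integral {lo i..hi i} \<kappa> + 2 * \<delta>)"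
        using \<delta>(1) by (intro mult_left_mono) auto
      thus "18 * pi * \<delta>\<^sup>2 * Re (H (w i)) / (1\<^sup>2 - (norm (w i))\<^sup>2) \<le> 18 * pi * \<delta> * (integral {lo i..hi i} \<kappa> + 2 * \<delta>)"
        by (simp add: n_def power2_eq_square mult.assoc)
    qed
    also have "\<dots> = 18 * pi * \<delta> * (\<Sum>i<N. integral {lo i..hi i} \<kappa> + 2 * \<delta>)"
      by (rule sum_distrib_left[symmetric])
    also have "(\<Sum>i<N. integral {lo i..hi i} \<kappa> + 2 * \<delta>) = B + 4 * pi"
    proof -
      have a: "(\<Sum>i<N. integral {lo i..hi i} \<kappa>) = integral {0..real N * \<delta>} \<kappa>"
        unfolding lo_def hi_def by (rule integral_split_arcs) (use \<delta> \<kappa> in auto)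
      have "real N * (2 * \<delta>) = 2 * (real N * \<delta>)" by (rule mult.left_commute)
      hence "real N * (2 * \<delta>) = 4 * pi" unfolding \<delta>(2) by simp
      hence c: "(\<Sum>i<N. 2 * \<delta>) = 4 * pi" by (simp only: sum_constant card_lessThan)
      show ?thesis by (simp only: sum.distrib a c \<delta>(2) B_def)
    qed
    finally have "2 * pi * Re (H 0) \<le> 2 * pi * (9 * \<delta> * (B + 4 * pi))" by (simp add: mult_ac)
    hence "Re (H 0) \<le> 9 * \<delta> * (B + 4 * pi)" by simp
    thus ?thesis by (simp add: \<delta>_def)
  qed
  have "(\<lambda>N. 9 * (2 * pi) * (B + 4 * pi) * (1 / real N)) \<longlonglongrightarrow> 9 * (2 * pi) * (B + 4 * pi) * 0"
    by (intro tendsto_mult tendsto_const lim_1_over_n)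
  hence lim0: "(\<lambda>N. 9 * (2 * pi) * (B + 4 * pi) * (1 / real N)) \<longlonglongrightarrow> 0" by simp
  have "Re (H 0) \<le> 0"
  proof (rule tendsto_lowerbound[OF lim0 _ sequentially_bot])
    show "\<forall>\<^sub>F N in sequentially. Re (H 0) \<le> 9 * (2 * pi) * (B + 4 * pi) * (1 / real N)"
      using eventually_gt_at_top[of 0] by eventually_elim (use bound in \<open>simp add: mult_ac\<close>)
  qed
  thus ?thesis using pos[of 0] by simp
qed

lemma ln_ratio_limit: "((\<lambda>r. ln (1 / r) / (1 - r)) \<longlongrightarrow> 1) (at (1::real))"
proof -
  have "(ln has_real_derivative 1 / 1) (at (1::real))" by (rule DERIV_ln_divide) simp
  hence "((\<lambda>r. (ln r - ln 1) / (r - 1)) \<longlongrightarrow> 1) (at (1::real))" by (simp add: has_field_derivative_iff)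
  moreover have "(ln r - ln 1) / (r - 1) = ln (1 / r) / (1 - r)" if "0 < r" for r :: real
  proof -
    have "ln (1 / r) / (1 - r) = (- ln r) / (- (r - 1))" using that by (simp add: ln_div)
    thus ?thesis by (simp only: minus_divide_divide) simp
  qed
  moreover have "\<forall>\<^sub>F r in at (1::real). 0 < r"
    by (rule eventually_at_topological[THEN iffD2]) (auto intro!: exI[of _ "{0<..}"])
  ultimately show ?thesis
    by (rule_tac Lim_transform_eventually) (auto elim: eventually_mono)
qed

lemma AE_lborel_negligible:
  assumes "AE t in lborel. P t" obtains N where "negligible N" "\<And>t. t \<notin> N \<Longrightarrow> P t"
proof -
  obtain N where N: "{t \<in> space lborel. \<not> P t} \<subseteq> N" "emeasure lborel N = 0" "N \<in> sets lborel"
    by (rule AE_E[OF assms]) (rule that)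
  have "N \<in> null_sets lborel" using N by (simp add: null_sets_def)
  hence "negligible N" unfolding negligible_iff_null_sets by (rule null_sets_completionI)
  thus ?thesis using N(1) by (intro that) auto
qed

section \<open>Boundary modulus of the derivative and shape of the domain\<close>

text \<open>The factor \<open>- 1 / w\<^sup>2\<close> from the inversion is continuous and
  unimodular on the circle, so it affects the limit but not its modulus.\<close>

lemma outer_boundary_behaviour:
  assumes F: "\<And>w. w \<in> ball 0 1 \<Longrightarrow> F w = b * exp (herglotz k w)" and b: "norm b = 1"
    and k: "set_integrable lborel {0..2*pi} k"
    and d: "\<And>w. w \<in> ball 0 1 - {0} \<Longrightarrow> deriv \<psi> w = - F w / w\<^sup>2"
  shows "\<exists>N. negligible N \<and> (\<forall>x\<in>{0<..<2*pi} - N. \<exists>a. nt_deriv \<psi> x a \<and> norm a = exp (k x))"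
proof -
  from exp_herglotz_nt_limit[OF k] obtain N where N: "negligible N" and
    lim: "\<forall>x\<in>{0<..<2*pi} - N. \<exists>l. norm l = exp (k x) \<and>
    (\<forall>M>0. ((\<lambda>w. exp (herglotz k w)) \<longlongrightarrow> l) (at (cis x) within stolz (cis x) M))" by (elim exE conjE)
  show ?thesis
  proof (intro exI[of _ N] conjI ballI N)
    fix x assume "x \<in> {0<..<2*pi} - N"
    with lim obtain l where l: "norm l = exp (k x)"
      "\<forall>M>0. ((\<lambda>w. exp (herglotz k w)) \<longlongrightarrow> l) (at (cis x) within stolz (cis x) M)" by blast
    show "\<exists>a. nt_deriv \<psi> x a \<and> norm a = exp (k x)"
    proof (intro exI[of _ "- (b * l) / (cis x)\<^sup>2"] conjI)
      show "norm (- (b * l) / (cis x)\<^sup>2) = exp (k x)"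
        by (simp add: norm_divide norm_mult norm_power b l(1))
      show "nt_deriv \<psi> x (- (b * l) / (cis x)\<^sup>2)"
        unfolding nt_deriv_def
      proof (intro allI impI)
        fix M :: real assume M: "0 < M"
        have "((\<lambda>w. - (b * exp (herglotz k w)) / w\<^sup>2) \<longlongrightarrow> - (b * l) / (cis x)\<^sup>2) (at (cis x) within stolz (cis x) M)"
          by (intro tendsto_divide tendsto_minus tendsto_mult tendsto_const tendsto_power tendsto_ident_at l(2)[rule_format, OF M]) simp
        moreover have "\<forall>\<^sub>F w in at (cis x) within stolz (cis x) M. - (b * exp (herglotz k w)) / w\<^sup>2 = deriv \<psi> w"
          unfolding eventually_at
        proof (intro exI[of _ "1/2"] conjI ballI impI)
          fix w assume w: "w \<in> stolz (cis x) M" "w \<noteq> cis x \<and> dist w (cis x) < 1/2"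
          have "w \<in> ball 0 1 - {0}" by (rule stolz_near_punctured[OF w(1)]) (use w(2) in simp)
          thus "- (b * exp (herglotz k w)) / w\<^sup>2 = deriv \<psi> w" using F[of w] d[of w] by simp
        qed simp
        ultimately show "(deriv \<psi> \<longlongrightarrow> - (b * l) / (cis x)\<^sup>2) (at (cis x) within stolz (cis x) M)"
          by (rule Lim_transform_eventually)
      qed
    qed
  qed
qed

lemma herglotz_constant_modulus:
  assumes k: "set_integrable lborel {0..2*pi} k" and N: "negligible N" "\<And>x. x \<in> {0..2*pi} - N \<Longrightarrow> k x = k0"
    and w: "norm w < 1"
  shows "Re (herglotz k w) = k0"
proof -
  have "((\<lambda>t. poisson_kernel w t * k0) has_integral (2 * pi) * k0) {0..2*pi}"
    by (rule has_integral_mult_left[OF poisson_kernel_has_integral[OF w]])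
  hence "((\<lambda>t. poisson_kernel w t *\<^sub>R k t) has_integral (2 * pi) * k0) {0..2*pi}"
    by (rule has_integral_spike[OF N(1), rotated]) (simp add: N(2))
  hence "integral {0..2*pi} (\<lambda>t. poisson_kernel w t *\<^sub>R k t) = 2 * pi * k0" by (rule integral_unique)
  thus ?thesis using Re_herglotz[OF k w] by simp
qed

lemma integrable_on_nn_integral_finite:
  fixes \<kappa> :: "real \<Rightarrow> real"
  assumes \<kappa>: "\<kappa> \<in> borel_measurable lebesgue" "\<And>x. 0 \<le> \<kappa> x" and G: "G \<in> sets lebesgue"
    and fin: "(\<integral>\<^sup>+x. ennreal (\<kappa> x) * indicator G x \<partial>lebesgue) < \<infinity>"
    and sub: "G \<subseteq> {a..b}" "negligible ({a..b} - G)"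
  shows "\<kappa> integrable_on {a..b}"
proof -
  have "integrable lebesgue (\<lambda>x. indicator G x *\<^sub>R \<kappa> x)"
  proof (rule integrableI_bounded)
    show "(\<lambda>x. indicator G x *\<^sub>R \<kappa> x) \<in> borel_measurable lebesgue"
      by (intro borel_measurable_scaleR borel_measurable_indicator G \<kappa>(1))
    have "(\<integral>\<^sup>+x. ennreal (norm (indicator G x *\<^sub>R \<kappa> x)) \<partial>lebesgue) = (\<integral>\<^sup>+x. ennreal (\<kappa> x) * indicator G x \<partial>lebesgue)"
      by (intro nn_integral_cong) (simp add: indicator_def \<kappa>(2))
    thus "(\<integral>\<^sup>+x. ennreal (norm (indicator G x *\<^sub>R \<kappa> x)) \<partial>lebesgue) < \<infinity>" using fin by simp
  qed
  hence "\<kappa> absolutely_integrable_on G" by (simp add: set_integrable_def)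
  hence "\<kappa> integrable_on G" using set_lebesgue_integral_eq_integral(1) by blast
  thus ?thesis
  proof (rule integrable_spike_set)
    have "{x \<in> G - {a..b}. \<kappa> x \<noteq> 0} = {}" using sub(1) by blast
    thus "negligible {x \<in> G - {a..b}. \<kappa> x \<noteq> 0}" by (simp only: negligible_empty)
    show "negligible {x \<in> {a..b} - G. \<kappa> x \<noteq> 0}" by (rule negligible_subset[OF sub(2)]) blast
  qed
qed

lemma exterior_conformal_reflect:
  assumes "exterior_conformal_map \<phi> \<Omega>"
  defines "\<psi> \<equiv> \<lambda>w. \<phi> (1 / w)"
  shows "\<psi> holomorphic_on ball 0 1 - {0}" "inj_on \<psi> (ball 0 1 - {0})" "\<psi> ` (ball 0 1 - {0}) = \<Omega>"
    "\<And>w. w \<in> ball 0 1 - {0} \<Longrightarrow> deriv \<psi> w = - deriv \<phi> (1 / w) / w\<^sup>2"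
proof -
  let ?D = "ball 0 1 - {0::complex}" and ?E = "{z::complex. 1 < norm z}"
  have hol: "\<phi> holomorphic_on ?E" and inj: "inj_on \<phi> ?E" and im: "\<phi> ` ?E = \<Omega>"
    using assms(1) by (auto simp: exterior_conformal_map_def)
  have opE: "open ?E" by (intro open_Collect_less continuous_intros)
  have DE: "1 / w \<in> ?E" if "w \<in> ?D" for w using that by (simp add: norm_divide)
  have im1: "(\<lambda>w. 1 / w) ` ?D = ?E"
  proof
    show "(\<lambda>w. 1 / w) ` ?D \<subseteq> ?E" using DE by blast
    show "?E \<subseteq> (\<lambda>w. 1 / w) ` ?D"
    proof
      fix z assume z: "z \<in> ?E"
      hence "z \<noteq> 0" by auto
      hence "1 / z \<in> ?D" "z = 1 / (1 / z)" using z by (auto simp: norm_divide)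
      thus "z \<in> (\<lambda>w. 1 / w) ` ?D" by blast
    qed
  qed
  show "\<psi> holomorphic_on ?D" unfolding \<psi>_def
    by (rule holomorphic_on_compose_gen[OF _ hol, unfolded o_def]) (use DE in \<open>auto intro!: holomorphic_intros\<close>)
  show "inj_on \<psi> ?D"
  proof (rule inj_onI)
    fix v w assume vw: "v \<in> ?D" "w \<in> ?D" "\<psi> v = \<psi> w"
    have "1 / v = 1 / w" by (rule inj_onD[OF inj vw(3)[unfolded \<psi>_def] DE[OF vw(1)] DE[OF vw(2)]])
    thus "v = w" using vw by (simp add: field_simps)
  qed
  have "\<psi> ` ?D = \<phi> ` ((\<lambda>w. 1 / w) ` ?D)" by (simp add: \<psi>_def image_image)
  thus "\<psi> ` ?D = \<Omega>" by (simp only: im1 im)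
  fix w assume w: "w \<in> ?D"
  have w0: "w \<noteq> 0" using w by auto
  have 1: "((\<lambda>w. 1 / w) has_field_derivative - 1 / w\<^sup>2) (at w)"
    using w0 by (auto intro!: derivative_eq_intros simp: power2_eq_square)
  have 2: "(\<phi> has_field_derivative deriv \<phi> (1 / w)) (at (1 / w))" by (rule holomorphic_derivI[OF hol opE DE[OF w]])
  have "(\<psi> has_field_derivative deriv \<phi> (1 / w) * (- 1 / w\<^sup>2)) (at w)" unfolding \<psi>_def by (rule DERIV_chain2[OF 2 1])
  thus "deriv \<psi> w = - deriv \<phi> (1 / w) / w\<^sup>2" by (simp add: DERIV_imp_deriv)
qed

text \<open>Constant modulus forces \<open>F\<close> to be a constant \<open>b\<close>. On the
  connected punctured disk this integrates to \<open>\<psi> w = d + b / w\<close>, and the radius is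
  \<open>norm b = C\<close>.\<close>

lemma constant_outer_imp_disk:
  assumes map: "exterior_conformal_map \<phi> \<Omega>"
    and hF: "F holomorphic_on ball 0 1" and nF: "\<And>w. w \<in> ball 0 1 \<Longrightarrow> norm (F w) = C" and C: "0 < C"
    and F: "\<And>w. w \<in> ball 0 1 - {0} \<Longrightarrow> F w = deriv \<phi> (1 / w)"
  shows "\<exists>a r. 0 < r \<and> \<Omega> = {z. r < dist a z}"
proof -
  let ?D = "ball 0 1 - {0::complex}"
  have "F constant_on ball 0 1"
    by (rule maximum_modulus_principle[OF hF open_ball connected_ball open_ball order_refl, of 0]) (use nF in auto)
  then obtain b where b: "\<And>w. w \<in> ball 0 1 \<Longrightarrow> F w = b" by (auto simp: constant_on_def)
  have nb: "norm b = C" using nF[of 0] b[of 0] by simp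
  have b0: "b \<noteq> 0" using nb C by auto
  define \<psi> where "\<psi> w = \<phi> (1 / w)" for w
  note \<psi> = exterior_conformal_reflect[OF map, folded \<psi>_def]
  have op: "open ?D" by auto
  have "\<exists>d. \<forall>w\<in>?D. \<psi> w - b / w = d"
  proof -
    have "(\<lambda>w. \<psi> w - b / w) constant_on ?D"
    proof (rule DERIV_zero_connected_constant_on[OF _ op finite.emptyI])
      show "connected ?D" by (rule connected_punctured_ball) simp
      show "continuous_on ?D (\<lambda>w. \<psi> w - b / w)"
        by (intro continuous_intros holomorphic_on_imp_continuous_on[OF \<psi>(1)]) auto
      show "\<forall>w\<in>?D - {}. ((\<lambda>w. \<psi> w - b / w) has_field_derivative 0) (at w)"
      proof
        fix w assume "w \<in> ?D - {}"
        hence w: "w \<in> ?D" by simp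
        hence w0: "w \<noteq> 0" by auto
        have "deriv \<psi> w = - b / w\<^sup>2" using \<psi>(4)[OF w] F[OF w] b[of w] w by simp
        hence "(\<psi> has_field_derivative - b / w\<^sup>2) (at w)" using holomorphic_derivI[OF \<psi>(1) op w] by simp
        moreover have "((\<lambda>w. b / w) has_field_derivative - b / w\<^sup>2) (at w)"
          using w0 by (auto intro!: derivative_eq_intros simp: power2_eq_square)
        ultimately have "((\<lambda>w. \<psi> w - b / w) has_field_derivative (- b / w\<^sup>2 - - b / w\<^sup>2)) (at w)"
          by (rule DERIV_diff)
        thus "((\<lambda>w. \<psi> w - b / w) has_field_derivative 0) (at w)" by simp
      qed
    qed
    thus ?thesis by (auto simp: constant_on_def)
  qed
  then obtain d where d0: "\<forall>w\<in>?D. \<psi> w - b / w = d" by (elim exE)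
  have d: "\<psi> w = d + b / w" if "w \<in> ?D" for w using d0[rule_format, OF that] by (simp add: diff_eq_eq)
  have "\<Omega> = {z. C < dist d z}"
  proof
    show "\<Omega> \<subseteq> {z. C < dist d z}"
    proof
      fix z assume "z \<in> \<Omega>"
      hence "z \<in> \<psi> ` ?D" by (simp only: \<psi>(3))
      then obtain w where w: "w \<in> ?D" "z = d + b / w" using d by blast
      have "0 < norm w" "norm w < 1" using w(1) by auto
      hence "C < C / norm w" using C by (simp add: pos_less_divide_eq)
      hence "C < norm (b / w)" by (simp add: norm_divide nb)
      thus "z \<in> {z. C < dist d z}" using w(2) by (simp add: dist_norm)
    qed
    show "{z. C < dist d z} \<subseteq> \<Omega>"
    proof
      fix z assume "z \<in> {z. C < dist d z}"
      hence z: "C < norm (z - d)" by (simp add: dist_norm norm_minus_commute)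
      hence zd: "z - d \<noteq> 0" using C by auto
      define w where "w = b / (z - d)"
      have "w \<in> ?D" using z zd b0 C by (simp add: w_def norm_divide nb divide_less_eq)
      moreover have "z = d + b / w" using b0 zd by (simp add: w_def)
      ultimately have "z = \<psi> w" "w \<in> ?D" using d by simp_all
      thus "z \<in> \<Omega>" unfolding \<psi>(3)[symmetric] by blast
    qed
  qed
  thus ?thesis using C by blast
qed

theorem theorem3p1:
  fixes \<Omega> :: "complex set" and \<gamma> :: "real \<Rightarrow> complex" and L :: real
  assumes "open \<Omega>" and "connected \<Omega>"
    and "arclength_jordan \<gamma> L" and "\<gamma> ` {0..L} = frontier \<Omega>"
    and "bounded (- \<Omega>)" and "connected (- \<Omega>)"
    and "exceptional_weak \<Omega> \<gamma> L"
    and "smirnov_domain \<Omega>"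
  shows "\<exists>a r. 0 < r \<and> \<Omega> = {z. r < dist a z}"
proof -
  let ?D = "ball 0 1 - {0::complex}"
  have L: "0 < L" "\<gamma> 0 = \<gamma> L" "inj_on \<gamma> {0..<L}"
    and lip: "\<And>s t. s \<in> {0..L} \<Longrightarrow> t \<in> {0..L} \<Longrightarrow> norm (\<gamma> s - \<gamma> t) \<le> \<bar>s - t\<bar>"
    and AE1: "AE t in lborel. t \<in> {0..L} \<longrightarrow> (\<exists>v. (\<gamma> has_vector_derivative v) (at t) \<and> norm v = 1)"
    using assms(3) unfolding arclength_jordan_def by auto
  obtain u c where hu: "harmonic_on \<Omega> u" and upos: "\<forall>z\<in>\<Omega>. 0 < u z" and c: "c \<noteq> 0"
    and AE2: "AE t in lborel. t \<in> {0..L} \<longrightarrow> nt_tendsto \<Omega> u (\<gamma> t) 0 \<and>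
      nt_tendsto \<Omega> (\<lambda>z. Re (cgrad u z * cnj (\<i> * vector_derivative \<gamma> (at t)))) (\<gamma> t) c"
    using assms(7) unfolding exceptional_weak_def by (elim exE conjE)
  obtain \<phi> F where map: "exterior_conformal_map \<phi> \<Omega>" and oF: "outer_function F"
    and F\<phi>: "\<forall>w. 0 < norm w \<and> norm w < 1 \<longrightarrow> F w = deriv \<phi> (1 / w)"
    using assms(8) unfolding smirnov_domain_def by (elim exE conjE)
  obtain b k where b: "norm b = 1" and k: "set_integrable lborel {0..2*pi} k"
    and Fk0: "\<forall>w\<in>ball 0 1. F w = b * exp (herglotz k w)"
    using oF unfolding outer_function_def herglotz_def by (elim exE conjE)
  have Fk: "F w = b * exp (herglotz k w)" if "w \<in> ball 0 1" for w using Fk0 that by blast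
  have hF: "F holomorphic_on ball 0 1"
    by (rule holomorphic_transform[of "\<lambda>w. b * exp (herglotz k w)"])
       (intro holomorphic_intros herglotz_holomorphic k, simp add: Fk)
  have F\<phi>': "F w = deriv \<phi> (1 / w)" if "w \<in> ?D" for w using F\<phi> that by simp
  define \<psi> where "\<psi> w = \<phi> (1 / w)" for w
  note \<psi> = exterior_conformal_reflect[OF map, folded \<psi>_def]
  have d\<psi>: "deriv \<psi> w = - F w / w\<^sup>2" if "w \<in> ?D" for w using \<psi>(4)[OF that] F\<phi>'[OF that] by simp
  have in\<Omega>: "\<psi> w \<in> \<Omega>" if "w \<in> ?D" for w using \<psi>(3) that by blast
  have du: "(u has_derivative (\<lambda>d. Re (cnj (cgrad u z) * d))) (at z)" if "z \<in> \<Omega>" for z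
    by (rule harmonic_on_holomorphic_gradient(2)[OF hu that])
  have upos': "0 < u z" if "z \<in> \<Omega>" for z using upos that by blast

  \<comment> \<open>Pull-back of the roof function to the punctured disk\<close>
  define v where "v w = u (\<psi> w)" for w
  define g where "g w = cnj (cgrad u (\<psi> w)) * deriv \<psi> w" for w
  have opD: "open ?D" by auto
  have hg: "g holomorphic_on ?D" unfolding g_def
  proof (rule holomorphic_on_mult)
    show "(\<lambda>w. cnj (cgrad u (\<psi> w))) holomorphic_on ?D"
      by (rule holomorphic_on_compose_gen[OF \<psi>(1) harmonic_on_holomorphic_gradient(1)[OF hu], unfolded o_def])
         (use in\<Omega> in blast)
    show "deriv \<psi> holomorphic_on ?D" by (rule holomorphic_deriv[OF \<psi>(1) opD])
  qed
  have dv: "(v has_derivative (\<lambda>d. Re (g w * d))) (at w)" if w: "w \<in> ?D" for w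
  proof -
    have "(\<psi> has_derivative (*) (deriv \<psi> w)) (at w)"
      using holomorphic_derivI[OF \<psi>(1) opD w] by (simp add: has_field_derivative_def)
    from has_derivative_compose[OF this du[OF in\<Omega>[OF w]]]
    show ?thesis by (simp add: v_def[abs_def] g_def mult.assoc)
  qed
  have vpos: "0 < v w" if "w \<in> ?D" for w using upos'[OF in\<Omega>[OF that]] by (simp add: v_def)
  have "\<exists>A H. 0 \<le> A \<and> H holomorphic_on ball 0 1 \<and> (\<forall>w\<in>ball 0 1. 0 \<le> Re (H w)) \<and>
    (\<forall>w\<in>?D. v w = A * ln (1 / norm w) + Re (H w))"
    by (rule positive_harmonic_punctured_disk[OF hg dv vpos])
  then obtain A H where A: "0 \<le> A" and H: "H holomorphic_on ball 0 1" and Hpos: "\<forall>w\<in>ball 0 1. 0 \<le> Re (H w)"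
    and vA: "\<forall>w\<in>?D. v w = A * ln (1 / norm w) + Re (H w)" by (elim exE conjE)

  \<comment> \<open>The boundary map and its bi-Lipschitz pieces\<close>
  have "\<exists>N. negligible N \<and> (\<forall>x\<in>{0<..<2*pi} - N. \<exists>a. nt_deriv \<psi> x a \<and> norm a = exp (k x))"
    by (rule outer_boundary_behaviour[OF Fk b k d\<psi>])
  then obtain N0 where N0: "negligible N0" and nt: "\<forall>x\<in>{0<..<2*pi} - N0. \<exists>a. nt_deriv \<psi> x a \<and> norm a = exp (k x)"
    by (elim exE conjE)
  define G0 where "G0 = {0<..<2*pi} - N0"
  have "\<exists>a. \<forall>x\<in>G0. nt_deriv \<psi> x (a x) \<and> norm (a x) = exp (k x)"
    unfolding G0_def by (rule bchoice[OF nt])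
  then obtain a where a0: "\<forall>x\<in>G0. nt_deriv \<psi> x (a x) \<and> norm (a x) = exp (k x)" by (elim exE)
  have a: "nt_deriv \<psi> x (a x)" "norm (a x) = exp (k x)" "a x \<noteq> 0" if "x \<in> G0" for x
    using a0 that by (auto dest: arg_cong[of "a x" 0 norm])
  have "\<forall>x\<in>G0. \<exists>p. (\<lambda>n. \<psi> (radial x n)) \<longlonglongrightarrow> p"
    using nt_deriv_boundary_value[OF \<psi>(1) a(1)] by blast
  from bchoice[OF this] obtain P where P0: "\<forall>x\<in>G0. (\<lambda>n. \<psi> (radial x n)) \<longlonglongrightarrow> P x" by (elim exE)
  have P: "(\<lambda>n. \<psi> (radial x n)) \<longlonglongrightarrow> P x" if "x \<in> G0" for x using P0 that by blast
  have Pfr: "P x \<in> \<gamma> ` {0..L}" if "x \<in> G0" for x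
    using boundary_value_frontier[OF \<psi>(1,2) P[OF that]] by (simp only: \<psi>(3) assms(4))
  obtain X q where X: "\<And>i. compact (X i)" and q: "\<And>i::nat. q i \<noteq> (0::complex)"
    and Xcov: "\<And>x a. x \<in> {0<..<2*pi} \<Longrightarrow> nt_deriv \<psi> x a \<Longrightarrow> a \<noteq> 0 \<Longrightarrow> \<exists>i. x \<in> X i"
    and Xq: "\<And>i x a. x \<in> X i \<Longrightarrow> nt_deriv \<psi> x a \<Longrightarrow> norm a \<le> 2 * norm (q i)"
    and Xbil: "\<And>i x y Px Py. \<psi> holomorphic_on ball 0 1 - {0} \<Longrightarrow> x \<in> X i \<Longrightarrow> y \<in> X i \<Longrightarrow>
       (\<lambda>n. \<psi> (radial x n)) \<longlonglongrightarrow> Px \<Longrightarrow> (\<lambda>n. \<psi> (radial y n)) \<longlonglongrightarrow> Py \<Longrightarrow>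
       \<bar>x - y\<bar> \<le> 3 / norm (q i) * norm (Px - Py) \<and> norm (Px - Py) \<le> 3 * norm (q i) * \<bar>x - y\<bar>"
    by (rule countable_pieces[of \<psi>]) (rule that)
  have cov0: "G0 \<subseteq> (\<Union>i. X i)"
  proof
    fix x assume x: "x \<in> G0"
    have "x \<in> {0<..<2*pi}" using x by (simp add: G0_def)
    from Xcov[OF this a(1)[OF x] a(3)[OF x]] show "x \<in> (\<Union>i. X i)" by blast
  qed
  have bil1: "\<bar>x - y\<bar> \<le> 3 / norm (q i) * norm (P x - P y)"
    and bil2: "norm (P x - P y) \<le> 3 * norm (q i) * \<bar>x - y\<bar>"
    if "x \<in> X i" "y \<in> X i" "x \<in> G0" "y \<in> G0" for i x y
    using Xbil[OF \<psi>(1) that(1,2) P[OF that(3)] P[OF that(4)]] by auto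

  \<comment> \<open>Removal of the exceptional angles\<close>
  obtain Z1 where Z1: "negligible Z1" "\<And>t. t \<notin> Z1 \<Longrightarrow> t \<in> {0..L} \<longrightarrow> (\<exists>v. (\<gamma> has_vector_derivative v) (at t) \<and> norm v = 1)"
    by (rule AE_lborel_negligible[OF AE1]) (rule that)
  obtain Z2 where Z2: "negligible Z2" "\<And>t. t \<notin> Z2 \<Longrightarrow> t \<in> {0..L} \<longrightarrow> nt_tendsto \<Omega> u (\<gamma> t) 0 \<and>
      nt_tendsto \<Omega> (\<lambda>z. Re (cgrad u z * cnj (\<i> * vector_derivative \<gamma> (at t)))) (\<gamma> t) c"
    by (rule AE_lborel_negligible[OF AE2]) (rule that)
  \<comment> \<open>The parameters 0 and \<open>L\<close> are discarded as well: the tangent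
    argument moves along \<open>\<gamma>\<close> in both directions and so needs interior
    parameters.\<close>
  define Z where "Z = insert 0 (insert L (Z1 \<union> Z2))"
  have Z: "negligible Z" using Z1(1) Z2(1) by (simp add: Z_def)
  define Bad where "Bad = {x\<in>G0. P x \<in> \<gamma> ` (Z \<inter> {0..L})}"
  have Bad: "negligible Bad" unfolding Bad_def
  proof (rule negligible_boundary_preimage[OF bil1 _ cov0 lip Z])
    show "0 \<le> 3 / norm (q i)" for i by simp
  qed
  define G where "G = G0 - Bad"
  have GG0: "x \<in> G0" if "x \<in> G" for x using that by (simp add: G_def)
  have GL: "G \<in> sets lebesgue"
  proof -
    have "N0 \<in> sets lebesgue" "Bad \<in> sets lebesgue" using N0 Bad by (auto intro: negligible_imp_sets)
    thus ?thesis unfolding G_def G0_def by (intro sets.Diff) auto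
  qed
  have Gsub: "G \<subseteq> {0..2*pi}" by (auto simp: G_def G0_def)
  have Gneg: "negligible ({0..2*pi} - G)"
  proof (rule negligible_subset[of "insert 0 (insert (2*pi) (N0 \<union> Bad))"])
    show "negligible (insert 0 (insert (2*pi) (N0 \<union> Bad)))" using N0 Bad by simp
    show "{0..2*pi} - G \<subseteq> insert 0 (insert (2*pi) (N0 \<union> Bad))" by (auto simp: G_def G0_def)
  qed

  \<comment> \<open>Behaviour at the remaining angles and injectivity\<close>
  have good: "\<exists>\<tau> w. norm \<tau> = 1 \<and> (\<gamma> has_vector_derivative \<tau>) (at t) \<and> (w \<longlongrightarrow> cis x) (at_right 0) \<and>
    (\<forall>\<^sub>F h in at_right 0. w h \<in> ?D \<and> \<psi> (w h) = P x + of_real (sgn c * h) * (\<i> * \<tau>)) \<and>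
    ((\<lambda>h. v (w h) / (1 - norm (w h))) \<longlongrightarrow> \<bar>c\<bar> * norm (a x)) (at_right 0)"
    if x: "x \<in> G" and t: "t \<in> {0..L}" "P x = \<gamma> t" for x t
  proof -
    have xG0: "x \<in> G0" by (rule GG0[OF x])
    have tZ: "t \<notin> Z" using x t xG0 by (auto simp: G_def Bad_def)
    hence tin: "t \<in> {0<..<L}" using t(1) by (auto simp: Z_def)
    obtain \<tau> where \<tau>: "(\<gamma> has_vector_derivative \<tau>) (at t)" "norm \<tau> = 1"
      using Z1(2)[of t] tZ t(1) by (auto simp: Z_def)
    have vd: "vector_derivative \<gamma> (at t) = \<tau>" by (rule vector_derivative_at[OF \<tau>(1)])
    have n: "nt_tendsto \<Omega> u (P x) 0" "nt_tendsto \<Omega> (\<lambda>z. Re (cgrad u z * cnj (\<i> * \<tau>))) (P x) c"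
      using Z2(2)[of t] tZ t by (auto simp: Z_def vd)
    have "\<gamma> ` {0..L} \<subseteq> frontier \<Omega>" using assms(4) by simp
    from good_boundary_point[OF \<psi>(1,3) assms(1) a(1)[OF xG0] a(3)[OF xG0] P[OF xG0] this tin t(2)[symmetric] \<tau> du upos' n c]
    show ?thesis using \<tau> unfolding v_def by blast
  qed
  have PG: "\<exists>t\<in>{0<..<L}. P x = \<gamma> t" if x: "x \<in> G" for x
  proof -
    obtain t where t: "t \<in> {0..L}" "P x = \<gamma> t" using Pfr[OF GG0[OF x]] by blast
    have "t \<notin> Z" using x t GG0[OF x] by (auto simp: G_def Bad_def)
    hence "t \<in> {0<..<L}" using t(1) by (auto simp: Z_def)
    thus ?thesis using t(2) by blast
  qed
  \<comment> \<open>At a common boundary point both curves lie over the same normal segment. As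
    \<open>\<psi>\<close> is injective they coincide near their end, and so do their end
    points.\<close>
  have injP: "inj_on P G"
  proof (rule inj_onI)
    fix x y assume xy: "x \<in> G" "y \<in> G" "P x = P y"
    obtain t where t: "t \<in> {0<..<L}" "P x = \<gamma> t" using PG[OF xy(1)] by blast
    hence t0: "t \<in> {0..L}" by simp
    from good[OF xy(1) t0 t(2)] obtain \<tau> w where w: "(\<gamma> has_vector_derivative \<tau>) (at t)" "(w \<longlongrightarrow> cis x) (at_right 0)"
      "\<forall>\<^sub>F h in at_right 0. w h \<in> ?D \<and> \<psi> (w h) = P x + of_real (sgn c * h) * (\<i> * \<tau>)" by (elim exE conjE)
    have "P y = \<gamma> t" using xy(3) t(2) by simp
    from good[OF xy(2) t0 this] obtain \<tau>' w' where w': "(\<gamma> has_vector_derivative \<tau>') (at t)" "(w' \<longlongrightarrow> cis y) (at_right 0)"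
      "\<forall>\<^sub>F h in at_right 0. w' h \<in> ?D \<and> \<psi> (w' h) = P y + of_real (sgn c * h) * (\<i> * \<tau>')" by (elim exE conjE)
    have "\<tau>' = \<tau>" by (rule vector_derivative_unique_at[OF w'(1) w(1)])
    have "\<forall>\<^sub>F h in at_right 0. w' h = w h"
      using w(3) w'(3)
    proof eventually_elim
      case (elim h)
      hence "\<psi> (w' h) = \<psi> (w h)" using \<open>\<tau>' = \<tau>\<close> xy(3) by simp
      thus ?case using inj_onD[OF \<psi>(2)] elim by blast
    qed
    from Lim_transform_eventually[OF w'(2) this] have "(w \<longlongrightarrow> cis y) (at_right 0)" .
    hence "cis x = cis y" using tendsto_unique[OF _ w(2)] by (simp add: trivial_limit_at_right_real)
    moreover have "0 < x" "x < 2*pi" "0 < y" "y < 2*pi" using GG0[OF xy(1)] GG0[OF xy(2)] by (auto simp: G0_def)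
    ultimately show "x = y" using cis_neq_cis[of y x] by (cases "x = y") auto
  qed

  \<comment> \<open>Integrability of the boundary derivative\<close>
  \<comment> \<open>Outside the interval nothing is known about \<open>k\<close>, not even
    measurability; the indicator replaces it by 0 there.\<close>
  define \<kappa> where "\<kappa> x = exp (indicator {0..2*pi} x *\<^sub>R k x)" for x :: real
  have \<kappa>m: "\<kappa> \<in> borel_measurable lebesgue"
  proof -
    have "(\<lambda>x. indicator {0..2*pi} x *\<^sub>R k x) \<in> borel_measurable lborel"
      using k unfolding set_integrable_def by (rule borel_measurable_integrable)
    hence "\<kappa> \<in> borel_measurable lborel" unfolding \<kappa>_def by measurable
    thus ?thesis by (rule measurable_completion)
  qed
  have \<kappa>a: "norm (a x) = \<kappa> x" if "x \<in> G" for x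
  proof -
    have "x \<in> {0..2*pi}" using Gsub that by blast
    thus ?thesis using a(2)[OF GG0[OF that]] by (simp add: \<kappa>_def)
  qed
  have fin: "(\<integral>\<^sup>+x. ennreal (\<kappa> x) * indicator G x \<partial>lebesgue) \<le> ennreal (12 * L)"
  proof (rule boundary_length_bound[where X=X and q="\<lambda>i. norm (q i)" and P=P and \<gamma>=\<gamma>])
    show "G \<subseteq> (\<Union>i. X i)" using cov0 GG0 by blast
    fix i x assume "x \<in> X i" "x \<in> G"
    thus "\<kappa> x \<le> 2 * norm (q i)" using Xq[OF _ a(1)[OF GG0]] \<kappa>a by metis
  qed (use X q GL Gsub bil1 bil2 GG0 \<kappa>m lip L PG injP in auto)
  have \<kappa>i: "\<kappa> integrable_on {0..2*pi}"
    by (rule integrable_on_nn_integral_finite[OF \<kappa>m _ GL _ Gsub Gneg])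
       (use le_less_trans[OF fin] in \<open>auto simp: \<kappa>_def\<close>)
  \<comment> \<open>The logarithmic term is nonnegative, so the remainder inherits every upper bound
    for \<open>v\<close>.\<close>
  have Hle: "Re (H w) \<le> v w" if w: "w \<in> ?D" for w
  proof -
    have "0 \<le> ln (1 / norm w)" using w by (simp add: ln_div)
    thus ?thesis using vA w A by simp
  qed

  \<comment> \<open>Vanishing of the harmonic remainder\<close>
  have H0: "Re (H 0) = 0"
  proof (rule positive_harmonic_vanishes[OF H _ Gneg integrable_on_mult_right[OF \<kappa>i, of "\<bar>c\<bar>"]])
    show "0 \<le> Re (H w)" if "w \<in> ball 0 1" for w using Hpos that by blast
    fix x \<delta> :: real assume x: "x \<in> G" and \<delta>: "0 < \<delta>"
    obtain t where t: "t \<in> {0<..<L}" "P x = \<gamma> t" using PG[OF x] by blast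
    hence t0: "t \<in> {0..L}" by simp
    from good[OF x t0 t(2)] obtain \<tau> w where w: "(w \<longlongrightarrow> cis x) (at_right 0)"
      "\<forall>\<^sub>F h in at_right 0. w h \<in> ?D \<and> \<psi> (w h) = P x + of_real (sgn c * h) * (\<i> * \<tau>)"
      "((\<lambda>h. v (w h) / (1 - norm (w h))) \<longlongrightarrow> \<bar>c\<bar> * norm (a x)) (at_right 0)" by (elim exE conjE)
    have e1: "\<forall>\<^sub>F h in at_right 0. v (w h) / (1 - norm (w h)) < \<bar>c\<bar> * norm (a x) + 1"
      by (rule order_tendstoD(2)[OF w(3)]) simp
    have e2: "\<forall>\<^sub>F h in at_right 0. dist (w h) (cis x) < \<delta>" by (rule tendstoD[OF w(1) \<delta>])
    have "\<forall>\<^sub>F h in at_right 0. w h \<in> ?D \<and> dist (w h) (cis x) < \<delta> \<and> v (w h) / (1 - norm (w h)) < \<bar>c\<bar> * norm (a x) + 1"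
      using w(2) e1 e2 by eventually_elim blast
    from eventually_happens'[OF _ this] obtain h where h: "w h \<in> ?D" "dist (w h) (cis x) < \<delta>"
      "v (w h) / (1 - norm (w h)) < \<bar>c\<bar> * norm (a x) + 1" by (auto simp: trivial_limit_at_right_real)
    have "0 < 1 - norm (w h)" using h(1) by simp
    hence "v (w h) \<le> (\<bar>c\<bar> * norm (a x) + 1) * (1 - norm (w h))" using h(3) by (simp add: pos_divide_less_eq less_imp_le)
    hence "Re (H (w h)) \<le> (\<bar>c\<bar> * \<kappa> x + 1) * (1 - norm (w h))" using Hle[OF h(1)] \<kappa>a[OF x] by simp
    thus "\<exists>w. norm w < 1 \<and> dist w (cis x) < \<delta> \<and> Re (H w) \<le> (\<bar>c\<bar> * \<kappa> x + 1) * (1 - norm w)"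
      using h(1,2) by (intro exI[of _ "w h"]) simp
  qed
  \<comment> \<open>\<open>exp (- H)\<close> attains its maximal modulus 1 at the centre.\<close>
  have ReH: "Re (H w) = 0" if w: "w \<in> ball 0 1" for w
  proof -
    have "(\<lambda>w. exp (- H w)) constant_on ball 0 1"
    proof (rule maximum_modulus_principle[OF _ open_ball connected_ball open_ball order_refl, of _ _ _ 0])
      show "(\<lambda>w. exp (- H w)) holomorphic_on ball 0 1" by (intro holomorphic_intros H)
      show "norm (exp (- H z)) \<le> norm (exp (- H 0))" if "z \<in> ball 0 1" for z
        using Hpos that H0 by simp
    qed simp
    then obtain y where y: "\<forall>w\<in>ball 0 1. exp (- H w) = y" by (auto simp: constant_on_def)
    have "exp (- H w) = exp (- H 0)" using y w by simp
    hence "norm (exp (- H w)) = norm (exp (- H 0))" by simp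
    thus ?thesis using H0 by simp
  qed

  \<comment> \<open>Constancy of the boundary modulus\<close>
  have Ac: "A = \<bar>c\<bar> * exp (k x)" if x: "x \<in> G" for x
  proof -
    obtain t where t: "t \<in> {0<..<L}" "P x = \<gamma> t" using PG[OF x] by blast
    hence t0: "t \<in> {0..L}" by simp
    from good[OF x t0 t(2)] obtain \<tau> w where w: "(w \<longlongrightarrow> cis x) (at_right 0)"
      "\<forall>\<^sub>F h in at_right 0. w h \<in> ?D \<and> \<psi> (w h) = P x + of_real (sgn c * h) * (\<i> * \<tau>)"
      "((\<lambda>h. v (w h) / (1 - norm (w h))) \<longlongrightarrow> \<bar>c\<bar> * norm (a x)) (at_right 0)" by (elim exE conjE)
    have fl: "filterlim (\<lambda>h. norm (w h)) (at 1) (at_right 0)"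
      unfolding filterlim_at
    proof
      show "\<forall>\<^sub>F h in at_right 0. norm (w h) \<in> UNIV \<and> norm (w h) \<noteq> 1" using w(2) by eventually_elim auto
      show "((\<lambda>h. norm (w h)) \<longlongrightarrow> 1) (at_right 0)" using tendsto_norm[OF w(1)] by simp
    qed
    have "((\<lambda>h. A * (ln (1 / norm (w h)) / (1 - norm (w h)))) \<longlongrightarrow> A * 1) (at_right 0)"
      by (intro tendsto_mult tendsto_const filterlim_compose[OF ln_ratio_limit fl])
    moreover have "\<forall>\<^sub>F h in at_right 0. A * (ln (1 / norm (w h)) / (1 - norm (w h))) = v (w h) / (1 - norm (w h))"
      using w(2)
    proof eventually_elim
      case (elim h)
      hence wD: "w h \<in> ?D" by blast
      hence "v (w h) = A * ln (1 / norm (w h))" using vA ReH[of "w h"] by simp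
      thus ?case by simp
    qed
    ultimately have "((\<lambda>h. v (w h) / (1 - norm (w h))) \<longlongrightarrow> A * 1) (at_right 0)" by (rule Lim_transform_eventually)
    from tendsto_unique[OF _ this w(3)] have "A * 1 = \<bar>c\<bar> * norm (a x)" by (simp add: trivial_limit_at_right_real)
    thus ?thesis using a(2)[OF GG0[OF x]] by simp
  qed
  \<comment> \<open>Any point of \<open>G\<close> shows that \<open>A / \<bar>c\<bar>\<close> is an
    exponential, so this is the logarithm of a positive number.\<close>
  define k0 where "k0 = ln (A / \<bar>c\<bar>)"
  have k0: "k x = k0" if "x \<in> {0..2*pi} - ({0..2*pi} - G)" for x
  proof -
    have "x \<in> G" using that by simp
    from Ac[OF this] have "A / \<bar>c\<bar> = exp (k x)" using c by simp
    thus ?thesis by (simp add: k0_def)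
  qed
  have nF: "norm (F w) = exp k0" if w: "w \<in> ball 0 1" for w
  proof -
    have "Re (herglotz k w) = k0" by (rule herglotz_constant_modulus[OF k Gneg k0]) (use w in auto)
    thus ?thesis by (simp add: Fk[OF w] norm_mult b)
  qed
  show ?thesis
    by (rule constant_outer_imp_disk[OF map hF nF exp_gt_zero F\<phi>'])
qed

end
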